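(* Let $n\ge1$, $m\ge0$, and let $\Omega\subseteq\mathbb C^{n+m}$ be a domain (not necessarily bounded) which is $n$-star-shaped Hartogs in the first $n$ variables $z=(z_1,\dots,z_n)$; write points as $(z,z')$ with $z'\in\mathbb C^m$. Let $\gamma=(\gamma_1,\dots,\gamma_n)$ with all $\gamma_j>0$ and put $$V^\gamma=\big\{(z,z',w)\in\mathbb C^{n+m}\times\mathbb C:\ (g_\gamma(z,w),z')\in\Omega\big\},\qquad g_\gamma(z,w)=\big(e^{\gamma_1|w|^2/2}z_1,\dots,e^{\gamma_n|w|^2/2}z_n\big).$$ For $\eta\in\mathbb C$ let $V^\gamma_\eta=\{(z,z')\in\mathbb C^{n+m}:(z,z',\eta)\in V^\gamma\}$ with Bergman kernel $K_{V^\gamma_\eta}$. Define $$l(z,w,\eta)=\big(z_1e^{\gamma_1(w\bar\eta-|\eta|^2)},\dots,z_ne^{\gamma_n(w\bar\eta-|\eta|^2)}\big),\qquad D_{V^\gamma}=\frac{e^{(\gamma\cdot\mathbf 1)(w\bar\eta-|\eta|^2)}}{\pi}\Big(\sum_{j=1}^n\gamma_j\Big(I+z_j\frac{\partial}{\partial z_j}\Big)\Big),$$ where $I$ is the identity and $\gamma\cdot\mathbf 1=\sum_j\gamma_j$. Then for all $(z,z',w;\zeta,\zeta',\eta)\in V^\gamma\times V^\gamma$, $$K_{V^\gamma}(z,z',w;\bar\zeta,\bar\zeta',\bar\eta)=D_{V^\gamma}\Big[K_{V^\gamma_\eta}\big(l(z,w,\eta),z';\bar\zeta,\bar\zeta'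\big)\Big].$$
   Context: A domain $\Omega\subseteq\mathbb C^{n+m}$ is called $n$-star-shaped Hartogs in $(z_1,\dots,z_n)$ if $(z_1,\dots,z_n,\zeta)\in\Omega$ implies $(\lambda_1z_1,\dots,\lambda_nz_n,\zeta)\in\Omega$ for all $\lambda_j\in\mathbb C$ with $|\lambda_j|\le1$. The Bergman kernel of a domain $D$ is the reproducing kernel of $A^2(D)$, the square-integrable holomorphic functions on $D$ (possibly the zero space). The differential operator acts on the function $(z,z',w)\mapsto K_{V^\gamma_\eta}(l(z,w,\eta),z';\bar\zeta,\bar\zeta')$, with $\partial/\partial z_j$ differentiating in $z_j$. *)

theory Defs
  imports "HOL-Analysis.Analysis"
begin

text \<open>Holomorphy on an open set of a finite-dimensional complex space, given the
  multiplication-by-i map J of that space: f is (Frechet) differentiable with a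
  complex-linear derivative at every point.\<close>
definition cholo_on :: "('a::euclidean_space \<Rightarrow> 'a) \<Rightarrow> ('a \<Rightarrow> complex) \<Rightarrow> 'a set \<Rightarrow> bool" where
  "cholo_on J f D \<longleftrightarrow> (\<forall>x\<in>D. \<exists>L. (f has_derivative L) (at x) \<and> (\<forall>v. L (J v) = \<i> * L v))"

definition A2 :: "('a::euclidean_space \<Rightarrow> 'a) \<Rightarrow> 'a set \<Rightarrow> ('a \<Rightarrow> complex) set" where
  "A2 J D = {f. cholo_on J f D \<and> set_integrable lebesgue D (\<lambda>x. (cmod (f x))\<^sup>2)}"

text \<open>Bergman kernel K(x,y) (holomorphic in x, antiholomorphic in y), i.e. the
  reproducing kernel: K(.,y) in A2 and f(y) = integral of f(x) * conj(K(x,y)).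
  Normalised to 0 outside D x D.\<close>
definition bergman_gen :: "('a::euclidean_space \<Rightarrow> 'a) \<Rightarrow> 'a set \<Rightarrow> 'a \<Rightarrow> 'a \<Rightarrow> complex" where
  "bergman_gen J D = (THE K. (\<forall>x y. (x \<notin> D \<or> y \<notin> D) \<longrightarrow> K x y = 0) \<and>
      (\<forall>y\<in>D. (\<lambda>x. K x y) \<in> A2 J D \<and>
         (\<forall>f\<in>A2 J D. f y = (LINT x:D|lebesgue. f x * cnj (K x y)))))"

definition bergman_vec :: "(complex^'n) set \<Rightarrow> complex^'n \<Rightarrow> complex^'n \<Rightarrow> complex" where
  "bergman_vec D = bergman_gen (\<lambda>v. \<i> *s v) D"

definition bergman_prod :: "((complex^'n) \<times> complex) set \<Rightarrow> (complex^'n) \<times> complex \<Rightarrow> (complex^'n) \<times> complex \<Rightarrow> complex" where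
  "bergman_prod D = bergman_gen (\<lambda>(v,t). (\<i> *s v, \<i> * t)) D"

text \<open>C^(n+m) is complex^'N; the set S of indices are the coordinates z_1..z_n, the
  remaining ones (possibly none) are z'.\<close>
definition star_hartogs :: "'N set \<Rightarrow> (complex^'N) set \<Rightarrow> bool" where
  "star_hartogs S \<Omega> \<longleftrightarrow> (\<forall>x\<in>\<Omega>. \<forall>c::'N \<Rightarrow> complex. (\<forall>j\<in>S. cmod (c j) \<le> 1) \<longrightarrow>
       (\<chi> j. if j \<in> S then c j * x$j else x$j) \<in> \<Omega>)"

definition g_gamma :: "'N set \<Rightarrow> ('N \<Rightarrow> real) \<Rightarrow> complex^'N \<Rightarrow> complex \<Rightarrow> complex^'N" where
  "g_gamma S \<gamma> x w = (\<chi> j. if j \<in> S then exp (complex_of_real (\<gamma> j * (cmod w)\<^sup>2 / 2)) * x$j else x$j)"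

definition V_gamma :: "'N set \<Rightarrow> ('N \<Rightarrow> real) \<Rightarrow> (complex^'N) set \<Rightarrow> ((complex^'N) \<times> complex) set" where
  "V_gamma S \<gamma> \<Omega> = {(x, w). g_gamma S \<gamma> x w \<in> \<Omega>}"

definition V_slice :: "'N set \<Rightarrow> ('N \<Rightarrow> real) \<Rightarrow> (complex^'N) set \<Rightarrow> complex \<Rightarrow> (complex^'N) set" where
  "V_slice S \<gamma> \<Omega> \<eta> = {x. (x, \<eta>) \<in> V_gamma S \<gamma> \<Omega>}"

definition l_map :: "'N set \<Rightarrow> ('N \<Rightarrow> real) \<Rightarrow> complex^'N \<Rightarrow> complex \<Rightarrow> complex \<Rightarrow> complex^'N" where
  "l_map S \<gamma> x w \<eta> = (\<chi> j. if j \<in> S then x$j * exp (complex_of_real (\<gamma> j) * (w * cnj \<eta> - complex_of_real ((cmod \<eta>)\<^sup>2))) else x$j)"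

definition pderiv_z :: "((complex^'N) \<times> complex \<Rightarrow> complex) \<Rightarrow> 'N \<Rightarrow> (complex^'N) \<times> complex \<Rightarrow> complex" where
  "pderiv_z F j p = deriv (\<lambda>t. F ((\<chi> k. if k = j then t else (fst p)$k), snd p)) ((fst p)$j)"

definition D_op :: "'N set \<Rightarrow> ('N \<Rightarrow> real) \<Rightarrow> complex \<Rightarrow> ((complex^'N) \<times> complex \<Rightarrow> complex) \<Rightarrow> (complex^'N) \<times> complex \<Rightarrow> complex" where
  "D_op S \<gamma> \<eta> F p =
     exp (complex_of_real (\<Sum>j\<in>S. \<gamma> j) * (snd p * cnj \<eta> - complex_of_real ((cmod \<eta>)\<^sup>2))) / complex_of_real pi *
     (\<Sum>j\<in>S. complex_of_real (\<gamma> j) * (F p + (fst p)$j * pderiv_z F j p))"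

end

theory Submission
  imports Defs "HOL-Complex_Analysis.Cauchy_Integral_Formula"
begin

text \<open>
  Rescaling the fibre over \<open>w\<close> turns integration over \<open>V = V_gamma S \<gamma> \<Omega>\<close> into integration over
  \<open>\<Omega>\<close> and \<open>w\<close>, and brings in the semigroup \<open>T s f x = e^(-G s) f (e^(-\<gamma> s) x)\<close>, where \<open>G\<close> is the sum
  of the \<open>\<gamma> j\<close>. Circle averaging in each coordinate shows that \<open>T s\<close> is self-adjoint on \<open>A2(\<Omega>)\<close>.

  The automorphisms \<open>(x, w) \<mapsto> (e^(\<gamma> (w cnj \<eta> - |\<eta>|^2/2)) x, w - \<eta>)\<close> of \<open>V\<close> reduce the formula to
  \<open>\<eta> = 0\<close>, and rotations of \<open>w\<close> show that \<open>k x = K_V((x, w), (\<zeta>, 0))\<close> does not depend on \<open>w\<close>. The kernel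
  \<open>K_\<Omega>(-, x)\<close>, regarded as a function on \<open>V\<close>, is square integrable, because its squared norm on the fibre over
  \<open>w\<close> is \<open>T (|w|^2) K_\<Omega>(-, x)\<close> evaluated at \<open>x\<close>. Reproducing it on \<open>V\<close>, using self-adjointness and
  polar coordinates in \<open>w\<close>, gives \<open>K_\<Omega>(x, \<zeta>) = pi * (integral of T s k x over s \<ge> 0)\<close>. Replacing \<open>x\<close>
  by \<open>e^(-\<gamma> a) x\<close> and differentiating at \<open>a = 0\<close> gives \<open>pi * k = (\<Sum>j\<in>S. \<gamma> j (I + x_j \<partial>_j)) K_\<Omega>(-, \<zeta>)\<close>.
\<close>

section \<open>Linear isometries and Lebesgue measure\<close>

text \<open>Formally T s = exp(-s A) with A = sum of \<gamma> j (I + x_j d/dx_j), so integrating T s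
  over s \<ge> 0 inverts A: the orbit integral says K_\<Omega> = pi A^(-1) k, and this is where the
  first order operator comes from. The constant pi arises because |w|^2 carries area measure to pi
  ds. Fubini gives it for the rescalings of k by almost every w, which is enough under an integral
  over w. This is why the kernel of \<Omega> is lifted to V and k enters only through its
  rescalings. Self-adjointness of T s takes the place of an expansion into monomials in the first
  coordinates. Holomorphy means Frechet differentiability with complex linear derivative, so
  function theory is reduced to one variable along complex lines, and changes of variables rest on
  isometries and diagonal maps.\<close>

lemma nn_integral_lborel_translate:
  fixes f :: "'a::euclidean_space \<Rightarrow> ennreal"
  assumes [measurable]: "f \<in> borel_measurable borel"
  shows "(\<integral>\<^sup>+x. f (a + x) \<partial>lborel) = (\<integral>\<^sup>+x. f x \<partial>lborel)"
proof -
  have "(\<integral>\<^sup>+x. f x \<partial>lborel) = (\<integral>\<^sup>+x. f x \<partial>distr lborel borel ((+) a))"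
    by (simp add: lborel_distr_plus)
  also have "\<dots> = (\<integral>\<^sup>+x. f (a + x) \<partial>lborel)"
    by (subst nn_integral_distr) auto
  finally show ?thesis by simp
qed

lemma nn_integral_lborel_reflect:
  fixes f :: "'a::euclidean_space \<Rightarrow> ennreal"
  assumes [measurable]: "f \<in> borel_measurable borel"
  shows "(\<integral>\<^sup>+x. f (a - x) \<partial>lborel) = (\<integral>\<^sup>+x. f x \<partial>lborel)"
proof -
  have eq: "lborel = distr lborel borel (\<lambda>x::'a. a + (-1) *\<^sub>R x)"
    using lborel_affine[of "-1" a] by (simp add: density_1)
  have "(\<integral>\<^sup>+x. f x \<partial>lborel) = (\<integral>\<^sup>+x. f x \<partial>distr lborel borel (\<lambda>x::'a. a + (-1) *\<^sub>R x))"
    using eq by simp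
  also have "\<dots> = (\<integral>\<^sup>+x. f (a - x) \<partial>lborel)"
    by (subst nn_integral_distr) auto
  finally show ?thesis by simp
qed

text \<open>The uniqueness argument for Haar measure: the double integral of 1_A(x) 1_B(x + y) is
  evaluated in both orders. The cross-multiplied form avoids division by measures that may be 0 or
  infinite.\<close>

lemma translation_invariant_proportional:
  fixes M :: "'a::euclidean_space measure"
  assumes sets_M[measurable_cong]: "sets M = sets borel"
    and sf: "sigma_finite_measure M"
    and inv: "\<And>a. distr M borel ((+) a) = M"
    and [measurable]: "A \<in> sets borel" "B \<in> sets borel"
  shows "emeasure M A * emeasure lborel B = emeasure M B * emeasure lborel A"
proof -
  interpret M: sigma_finite_measure M by fact
  interpret P: pair_sigma_finite M "lborel :: 'a measure" ..
  have M_translate: "(\<integral>\<^sup>+x. f (a + x) \<partial>M) = (\<integral>\<^sup>+x. f x \<partial>M)"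
    if [measurable]: "f \<in> borel_measurable borel" for f :: "'a \<Rightarrow> ennreal" and a
  proof -
    have "(\<integral>\<^sup>+x. f x \<partial>M) = (\<integral>\<^sup>+x. f x \<partial>distr M borel ((+) a))" by (simp add: inv)
    also have "\<dots> = (\<integral>\<^sup>+x. f (a + x) \<partial>M)" by (subst nn_integral_distr) (auto simp: sets_M)
    finally show ?thesis by simp
  qed
  have "emeasure M A * emeasure lborel B = (\<integral>\<^sup>+x. indicator A x * (\<integral>\<^sup>+y. indicator B (x + y) \<partial>lborel) \<partial>M)"
    using nn_integral_lborel_translate[of "indicator B"]
    by (simp add: nn_integral_multc sets_M)
  also have "\<dots> = (\<integral>\<^sup>+x. \<integral>\<^sup>+y. indicator A x * indicator B (x + y) \<partial>lborel \<partial>M)"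
    by (intro nn_integral_cong nn_integral_cmult[symmetric]) auto
  also have "\<dots> = (\<integral>\<^sup>+y. \<integral>\<^sup>+x. indicator A x * indicator B (x + y) \<partial>M \<partial>lborel)"
    by (rule P.Fubini'[symmetric]) measurable
  also have "\<dots> = (\<integral>\<^sup>+y. \<integral>\<^sup>+x. indicator A (x - y) * indicator B x \<partial>M \<partial>lborel)"
  proof (rule nn_integral_cong)
    fix y :: 'a
    show "(\<integral>\<^sup>+x. indicator A x * indicator B (x + y) \<partial>M) = (\<integral>\<^sup>+x. indicator A (x - y) * indicator B x \<partial>M)"
      using M_translate[of "\<lambda>x. indicator A (x - y) * indicator B x" y] by (simp add: add.commute)
  qed
  also have "\<dots> = (\<integral>\<^sup>+x. \<integral>\<^sup>+y. indicator A (x - y) * indicator B x \<partial>lborel \<partial>M)"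
    by (rule P.Fubini') measurable
  also have "\<dots> = (\<integral>\<^sup>+x. (\<integral>\<^sup>+y. indicator A (x - y) \<partial>lborel) * indicator B x \<partial>M)"
    by (intro nn_integral_cong nn_integral_multc) auto
  also have "\<dots> = emeasure M B * emeasure lborel A"
    using nn_integral_lborel_reflect[of "indicator A"]
    by (simp add: nn_integral_cmult nn_integral_multc sets_M mult.commute)
  finally show ?thesis .
qed

text \<open>The image measure is translation invariant because U is onto, hence proportional to
  Lebesgue measure. Since U preserves the unit ball, whose measure is positive and finite, the
  factor is 1.\<close>

lemma lborel_distr_linear_isometry:
  fixes U :: "'a::euclidean_space \<Rightarrow> 'a"
  assumes "linear U" and norm_U: "\<And>x. norm (U x) = norm x"
  shows "distr lborel borel U = lborel"
proof -
  interpret U: linear U by fact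
  have [measurable]: "U \<in> borel_measurable borel"
    using linear_continuous_on[OF \<open>linear U\<close>[unfolded linear_conv_bounded_linear]]
    by (rule borel_measurable_continuous_onI)
  define M where "M = distr lborel borel U"
  have sets_M: "sets M = sets borel" by (simp add: M_def)
  have "inj U" by (metis linear_injective_0[OF \<open>linear U\<close>] norm_U norm_eq_zero)
  then have "surj U" by (simp add: linear_injective_imp_surjective[OF \<open>linear U\<close>])
  have M_cball: "emeasure M (cball 0 r) = emeasure lborel (cball (0::'a) r)" for r
  proof -
    have "U -` cball 0 r = cball 0 r" by (auto simp: norm_U)
    then show ?thesis by (simp add: M_def emeasure_distr)
  qed
  have sf: "sigma_finite_measure M"
  proof
    have "(\<Union>n::nat. cball (0::'a) (real n)) = UNIV"
      using real_arch_simple by (fastforce simp: dist_norm)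
    moreover have "emeasure M (cball 0 r) \<noteq> top" for r
      using emeasure_lborel_cball_finite[of "0::'a" r] by (simp add: M_cball less_top)
    moreover have "space M = UNIV" by (simp add: M_def)
    ultimately show "\<exists>A. countable A \<and> A \<subseteq> sets M \<and> \<Union> A = space M \<and> (\<forall>a\<in>A. emeasure M a \<noteq> \<infinity>)"
      by (intro exI[of _ "range (\<lambda>n::nat. cball (0::'a) (real n))"])
        (auto simp: sets_M)
  qed
  have inv: "distr M borel ((+) a) = M" for a
  proof -
    obtain b where b: "a = U b" using \<open>surj U\<close> by (metis surjD)
    have "distr M borel ((+) a) = distr lborel borel (\<lambda>x. U (b + x))"
      unfolding M_def by (subst distr_distr) (auto simp: o_def b U.add)
    also have "\<dots> = distr (distr lborel borel ((+) b)) borel U"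
      by (subst distr_distr) (auto simp: o_def)
    finally show ?thesis by (simp add: M_def lborel_distr_plus)
  qed
  show ?thesis
  proof (rule measure_eqI)
    fix A :: "'a set" assume "A \<in> sets (distr lborel borel U)"
    then have A: "A \<in> sets borel" by simp
    let ?b = "emeasure lborel (cball (0::'a) 1)"
    have "emeasure M A * ?b = emeasure lborel A * ?b"
      using translation_invariant_proportional[OF sets_M sf inv A, of "cball 0 1"]
      by (simp add: M_cball mult.commute)
    moreover have "?b \<noteq> 0"
      using content_ball_pos[of 1 "0::'a"] by (simp add: emeasure_cball less_imp_neq[symmetric])
    moreover have "?b < \<infinity>"
      using emeasure_lborel_cball_finite[of "0::'a" 1] by simp
    ultimately show "emeasure (distr lborel borel U) A = emeasure lborel A"
      unfolding M_def by (metis ennreal_mult_cancel_left infinity_ennreal_def less_irrefl mult.commute)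
  qed simp
qed

section \<open>Diagonal scalings of complex coordinate space\<close>

definition dscale :: "('N \<Rightarrow> complex) \<Rightarrow> complex^'N \<Rightarrow> complex^'N::finite" where
  "dscale c x = (\<chi> j. c j * x$j)"

lemma dscale_nth [simp]: "dscale c x $ j = c j * x $ j"
  by (simp add: dscale_def)

lemma dscale_one [simp]: "dscale (\<lambda>j. 1) x = x"
  by (simp add: vec_eq_iff)

lemma linear_dscale: "linear (dscale c)"
  by (rule linearI) (simp_all add: vec_eq_iff algebra_simps)

lemma dscale_smult: "dscale c (k *s x) = k *s dscale c x"
  by (simp add: vec_eq_iff)

lemma continuous_on_dscale [continuous_intros]:
  assumes "\<And>j. continuous_on A (\<lambda>p. c p j)" "continuous_on A f"
  shows "continuous_on A (\<lambda>p. dscale (c p) (f p))"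
  unfolding dscale_def
  using assms by (intro continuous_intros) auto

lemma borel_measurable_dscale [measurable]: "dscale c \<in> borel_measurable borel"
  by (intro borel_measurable_continuous_onI continuous_intros)

lemma norm_dscale_eq:
  assumes "\<And>j. cmod (c j) = 1"
  shows "norm (dscale c x) = norm x"
  by (simp add: norm_vec_def norm_mult assms)

lemma prod_Basis_vec:
  fixes h :: "complex^'N::finite \<Rightarrow> real"
  shows "(\<Prod>b\<in>Basis. h b) = (\<Prod>j\<in>UNIV. \<Prod>b\<in>Basis. h (axis j b))"
proof -
  have inj: "inj_on (\<lambda>(j, b). axis j b :: complex^'N) (UNIV \<times> Basis)"
    by (auto simp: inj_on_def axis_eq_axis)
  have "Basis = (\<lambda>(j, b). axis j b :: complex^'N) ` (UNIV \<times> Basis)"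
    by (auto simp: Basis_vec_def)
  then have "(\<Prod>b\<in>Basis. h b) = (\<Prod>p\<in>UNIV \<times> Basis. h (case p of (j, b) \<Rightarrow> axis j b))"
    using prod.reindex[OF inj, of h] by (simp add: o_def)
  then show ?thesis
    by (simp add: prod.cartesian_product split_def)
qed

text \<open>Each factor is split into a phase and a modulus: the phases form an isometry, the moduli
  a real diagonal map. Each modulus is squared in the Jacobian because a complex coordinate has two
  real dimensions.\<close>

lemma nn_integral_dscale:
  fixes F :: "complex^'N::finite \<Rightarrow> ennreal"
  assumes nz: "\<And>j. c j \<noteq> 0" and [measurable]: "F \<in> borel_measurable borel"
  shows "(\<integral>\<^sup>+x. F (dscale c x) * ennreal (\<Prod>j\<in>UNIV. (cmod (c j))\<^sup>2) \<partial>lborel) = (\<integral>\<^sup>+x. F x \<partial>lborel)"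
proof -
  define r where "r j = complex_of_real (cmod (c j))" for j
  define s where "s j = c j / r j" for j
  have r_nz: "r j \<noteq> 0" for j using nz by (simp add: r_def)
  have s1: "cmod (s j) = 1" for j using nz by (simp add: s_def r_def norm_divide)
  have c: "dscale c x = dscale s (dscale r x)" for x
    using r_nz by (simp add: vec_eq_iff s_def)
  \<comment> \<open>A basis vector has exactly one nonzero coordinate, so the sum picks the modulus
    belonging to that coordinate without naming its index.\<close>
  define d :: "complex^'N \<Rightarrow> real" where "d b = (\<Sum>j\<in>UNIV. if b $ j \<noteq> 0 then cmod (c j) else 0)" for b
  have d_axis: "d (axis j b) = cmod (c j)" if "b \<noteq> 0" for j b
  proof -
    have "d (axis j b) = (\<Sum>i\<in>UNIV. if i = j then cmod (c i) else 0)"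
      unfolding d_def by (rule sum.cong) (auto simp: axis_def that)
    then show ?thesis by simp
  qed
  have dr: "(\<Sum>b\<in>Basis. (d b * (x \<bullet> b)) *\<^sub>R b) = dscale r x" for x
  proof (rule euclidean_eqI)
    fix b :: "complex^'N" assume b: "b \<in> Basis"
    then obtain j b' where jb: "b = axis j b'" "b' \<in> Basis" by (auto simp: Basis_vec_def)
    then have "b' \<noteq> 0" by auto
    have "(\<Sum>b\<in>Basis. (d b * (x \<bullet> b)) *\<^sub>R b) \<bullet> b = d b * (x \<bullet> b)"
      using b by (simp add: inner_sum_left inner_Basis if_distrib cong: if_cong)
    also have "\<dots> = dscale r x \<bullet> b"
      using jb \<open>b' \<noteq> 0\<close> by (simp add: d_axis inner_axis r_def inner_mult_right scaleR_conv_of_real[symmetric])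
    finally show "(\<Sum>b\<in>Basis. (d b * (x \<bullet> b)) *\<^sub>R b) \<bullet> b = dscale r x \<bullet> b" .
  qed
  have d_pos: "d b \<noteq> 0" if "b \<in> Basis" for b
    using that nz by (auto simp: Basis_vec_def d_axis nonzero_Basis)
  have prod_d: "(\<Prod>b\<in>Basis. \<bar>d b\<bar>) = (\<Prod>j\<in>UNIV. (cmod (c j))\<^sup>2)"
    by (simp add: prod_Basis_vec d_axis Basis_complex_def power2_eq_square)
  have "(\<integral>\<^sup>+x. F x \<partial>lborel) = (\<integral>\<^sup>+x. F x \<partial>distr lborel borel (dscale s))"
    by (simp add: lborel_distr_linear_isometry linear_dscale norm_dscale_eq s1)
  also have "\<dots> = (\<integral>\<^sup>+x. F (dscale s x) \<partial>lborel)"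
    by (simp add: nn_integral_distr)
  also have "\<dots> = (\<integral>\<^sup>+x. F (dscale s x) \<partial>density (distr lborel borel (dscale r)) (\<lambda>_. ennreal (\<Prod>j\<in>UNIV. (cmod (c j))\<^sup>2)))"
    using lborel_affine_euclidean[of d 0] d_pos by (simp add: dr prod_d)
  also have "\<dots> = (\<integral>\<^sup>+x. F (dscale c x) * ennreal (\<Prod>j\<in>UNIV. (cmod (c j))\<^sup>2) \<partial>lborel)"
    by (simp add: nn_integral_density nn_integral_distr c mult.commute)
  finally show ?thesis by simp
qed

section \<open>Circle averages of holomorphic functions\<close>

lemma Cauchy_coefficient_circle:
  assumes u: "u holomorphic_on A" and A: "cball 0 1 \<subseteq> A" and c: "0 < c" "c \<le> 1"
  shows "((\<lambda>t. cis (- (real n * t)) * u (of_real c * cis t)) has_integral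
           (of_real (2 * pi) * of_real c ^ n * ((deriv ^^ n) u 0 / fact n))) {0..2 * pi}"
proof -
  have sub: "cball 0 c \<subseteq> A" using A c by auto
  have "((\<lambda>z. u z / (z - 0) ^ Suc n) has_contour_integral (2 * pi * \<i>) / fact n * (deriv ^^ n) u 0) (circlepath 0 c)"
    using c sub ball_subset_cball[of 0 c]
    by (intro Cauchy_has_contour_integral_higher_derivative_circlepath holomorphic_on_imp_continuous_on
          holomorphic_on_subset[OF u]) auto
  then have "((\<lambda>t. u (0 + of_real c * cis t) / (0 + of_real c * cis t - 0) ^ Suc n * of_real c * \<i> * cis t)
      has_integral (2 * pi * \<i>) / fact n * (deriv ^^ n) u 0) {0..2*pi}"
    unfolding circlepath_def by (subst (asm) has_contour_integral_part_circlepath_iff) auto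
  \<comment> \<open>This factor turns the Cauchy kernel into the character
    \<open>cis (- (n * t))\<close>, so that Fourier coefficients on the circle become Taylor
    coefficients times \<open>c ^ n\<close>.\<close>
  then have "((\<lambda>t. (of_real c ^ n / \<i>) * (u (0 + of_real c * cis t) / (0 + of_real c * cis t - 0) ^ Suc n * of_real c * \<i> * cis t))
      has_integral (of_real c ^ n / \<i>) * ((2 * pi * \<i>) / fact n * (deriv ^^ n) u 0)) {0..2*pi}"
    by (rule has_integral_mult_right)
  moreover have "(of_real c ^ n / \<i>) * (u (0 + of_real c * cis t) / (0 + of_real c * cis t - 0) ^ Suc n * of_real c * \<i> * cis t)
     = cis (- (real n * t)) * u (of_real c * cis t)" for t
  proof -
    have cisn: "cis (- (real n * t)) = 1 / cis t ^ n"
      using cis_inverse[of "real n * t"] by (simp only: Complex.DeMoivre inverse_eq_divide)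
    have gen: "(X / I) * (U / (X * Y * (C * E)) * C * I * E) = 1 / Y * U"
      if "X \<noteq> 0" "Y \<noteq> 0" "C \<noteq> 0" "E \<noteq> 0" "I \<noteq> 0" for X Y C E I U :: complex
      using that by (simp add: divide_simps)
    have pow: "(of_real c * cis t) ^ Suc n = of_real c ^ n * cis t ^ n * (of_real c * cis t)"
      by (simp add: power_mult_distrib)
    show ?thesis
      unfolding add_0 diff_zero pow cisn by (rule gen) (use c in auto)
  qed
  ultimately show ?thesis by (simp add: mult_ac)
qed

lemma mean_value_circle:
  assumes "u holomorphic_on A" and "cball 0 1 \<subseteq> A"
  shows "((\<lambda>t. u (cis t)) has_integral of_real (2 * pi) * u 0) {0..2 * pi}"
  using Cauchy_coefficient_circle[OF assms, of 1 0] by simp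

text \<open>By Parseval both sides are 2 pi times the sum of a_n c^n conj(b_n) over the Taylor
  coefficients; the factor c^n is real and may be attached to either function. Only u is expanded,
  and integration against v produces the b_n.\<close>

lemma circle_average_symmetric:
  assumes u: "u holomorphic_on A" and v: "v holomorphic_on A"
    and "open A" and A: "cball 0 1 \<subseteq> A" and c: "0 < c" "c \<le> 1"
  shows "integral {0..2 * pi} (\<lambda>t. u (of_real c * cis t) * cnj (v (cis t))) =
         integral {0..2 * pi} (\<lambda>t. u (cis t) * cnj (v (of_real c * cis t)))"
proof -
  define a where "a n = (deriv ^^ n) u 0 / fact n" for n
  define b where "b n = (deriv ^^ n) v 0 / fact n" for n
  obtain e where e: "e > 0" "(\<Union>x\<in>cball 0 1. cball x e) \<subseteq> A"
    using compact_subset_open_imp_cball_epsilon_subset[of "cball (0::complex) 1" A] A \<open>open A\<close> by auto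
  have ball: "ball 0 (1 + e) \<subseteq> A"
  proof
    fix x :: complex assume x: "x \<in> ball 0 (1 + e)"
    show "x \<in> A"
    proof (cases "norm x \<le> 1")
      case True then show ?thesis using A by auto
    next
      case False
      then have "sgn x \<in> cball 0 1" "dist (sgn x) x \<le> e"
      proof -
        have "sgn x - x = (1 - norm x) *\<^sub>R sgn x"
          using False by (cases "x = 0") (auto simp: sgn_div_norm algebra_simps)
        then have "dist (sgn x) x = \<bar>1 - norm x\<bar>"
          using False by (auto simp: dist_norm norm_sgn)
        then show "dist (sgn x) x \<le> e" using x False by auto
      qed (simp add: norm_sgn)
      then show ?thesis using e(2) by (meson UN_I mem_cball subsetD)
    qed
  qed
  have sums: "(\<lambda>n. a n * z ^ n) sums u z" if "z \<in> ball 0 (1 + e)" for z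
    using holomorphic_power_series[OF holomorphic_on_subset[OF u ball] that] by (simp add: a_def)
  \<comment> \<open>Convergence at a radius beyond 1 gives absolute summability on the unit circle,
    which is the majorant for the Weierstrass test below.\<close>
  have "summable (\<lambda>n. a n * of_real (1 + e / 2) ^ n)"
    using sums[of "of_real (1 + e / 2)"] e by (auto simp del: of_real_add simp: sums_iff)
  then have "summable (\<lambda>n. norm (a n * 1 ^ n))"
    by (rule powser_insidea) (use e in \<open>simp del: of_real_add\<close>)
  then have suma: "summable (\<lambda>n. norm (a n))" by simp
  have cball_mem: "of_real r * cis t \<in> cball 0 1" if "0 < r" "r \<le> 1" for r t
    using that by (simp add: norm_mult)
  have cont_v: "continuous_on B (\<lambda>t. cnj (v (of_real r * cis t)))" if "0 < r" "r \<le> 1" for r B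
    using that A cball_mem
    by (intro continuous_intros continuous_on_compose2[OF holomorphic_on_imp_continuous_on[OF v]])
       (auto simp: cis_conv_exp intro!: continuous_intros)
  have main: "(\<lambda>N. \<Sum>n<N. a n * of_real r ^ n * (of_real (2 * pi) * of_real s ^ n * cnj (b n)))
      \<longlonglongrightarrow> integral {0..2 * pi} (\<lambda>t. u (of_real r * cis t) * cnj (v (of_real s * cis t)))"
    if r: "0 < r" "r \<le> 1" and s: "0 < s" "s \<le> 1" for r s
  proof -
    let ?P = "\<lambda>N t. (\<Sum>n<N. a n * (of_real r * cis t) ^ n) * cnj (v (of_real s * cis t))"
    have "bounded ((\<lambda>t. cnj (v (of_real s * cis t))) ` {0..2*pi})"
      by (intro compact_imp_bounded compact_continuous_image cont_v s) auto
    then obtain B where B: "\<And>t. t \<in> {0..2*pi} \<Longrightarrow> norm (v (of_real s * cis t)) \<le> B"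
      unfolding bounded_iff by (metis (no_types, lifting) complex_mod_cnj imageI)
    have "uniform_limit {0..2 * pi} (\<lambda>N t. \<Sum>n<N. a n * (of_real r * cis t) ^ n * cnj (v (of_real s * cis t)))
        (\<lambda>t. \<Sum>n. a n * (of_real r * cis t) ^ n * cnj (v (of_real s * cis t))) sequentially"
    proof (rule Weierstrass_m_test)
      show "summable (\<lambda>n. norm (a n) * B)" using suma by (rule summable_mult2)
      show "norm (a n * (of_real r * cis t) ^ n * cnj (v (of_real s * cis t))) \<le> norm (a n) * B"
        if "t \<in> {0..2*pi}" for n t
        using B[OF that] r
        by (auto simp: norm_mult norm_power intro!: mult_mono mult_left_le power_le_one)
    qed
    also have "(\<lambda>N t. \<Sum>n<N. a n * (of_real r * cis t) ^ n * cnj (v (of_real s * cis t))) = ?P"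
      by (simp add: sum_distrib_right)
    also have "(\<lambda>t. \<Sum>n. a n * (of_real r * cis t) ^ n * cnj (v (of_real s * cis t))) =
        (\<lambda>t. u (of_real r * cis t) * cnj (v (of_real s * cis t)))"
    proof
      fix t
      have "of_real r * cis t \<in> ball 0 (1 + e)" using r e by (simp add: norm_mult)
      from sums[OF this] have "(\<lambda>n. a n * (of_real r * cis t) ^ n * cnj (v (of_real s * cis t))) sums
          (u (of_real r * cis t) * cnj (v (of_real s * cis t)))" by (rule sums_mult2)
      then show "(\<Sum>n. a n * (of_real r * cis t) ^ n * cnj (v (of_real s * cis t))) =
          u (of_real r * cis t) * cnj (v (of_real s * cis t))" by (simp add: sums_iff)
    qed
    finally have ul: "uniform_limit {0..2 * pi} ?P (\<lambda>t. u (of_real r * cis t) * cnj (v (of_real s * cis t))) sequentially" .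
    have cont: "continuous_on {0..2*pi} (?P N)" for N
      by (rule continuous_on_mult[OF _ cont_v[OF s]]) (auto simp: cis_conv_exp intro!: continuous_intros)
    obtain I L where IL: "\<And>N. (?P N has_integral I N) {0..2*pi}"
      "((\<lambda>t. u (of_real r * cis t) * cnj (v (of_real s * cis t))) has_integral L) {0..2*pi}" "I \<longlonglongrightarrow> L"
      using uniform_limit_integral[OF ul cont] by auto
    have "(?P N has_integral (\<Sum>n<N. a n * of_real r ^ n * (of_real (2 * pi) * of_real s ^ n * cnj (b n)))) {0..2*pi}" for N
    proof -
      have "((\<lambda>t. \<Sum>n<N. a n * of_real r ^ n * cnj (cis (- (real n * t)) * v (of_real s * cis t))) has_integral
          (\<Sum>n<N. a n * of_real r ^ n * cnj (of_real (2 * pi) * of_real s ^ n * b n))) {0..2*pi}"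
        using has_integral_cnj[THEN iffD2, OF Cauchy_coefficient_circle[OF v A s]]
        by (intro has_integral_sum has_integral_mult_right) (auto simp: o_def b_def)
      then show ?thesis
        by (simp add: sum_distrib_right power_mult_distrib Complex.DeMoivre cis_cnj mult.assoc)
    qed
    then have "I = (\<lambda>N. \<Sum>n<N. a n * of_real r ^ n * (of_real (2 * pi) * of_real s ^ n * cnj (b n)))"
      using IL(1) has_integral_unique by blast
    with IL show ?thesis by (simp add: integral_unique)
  qed
  have "(\<lambda>N. \<Sum>n<N. a n * of_real c ^ n * (of_real (2 * pi) * of_real 1 ^ n * cnj (b n))) =
        (\<lambda>N. \<Sum>n<N. a n * of_real 1 ^ n * (of_real (2 * pi) * of_real c ^ n * cnj (b n)))"
    by (simp add: mult_ac)
  with main[OF c, of 1] main[of 1, OF _ _ c] show ?thesis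
    by (simp add: LIMSEQ_unique)
qed

text \<open>Each \<open>R t\<close> preserves D and Lebesgue measure, so integrating H(R t x) over t
  and x gives 2 pi times the integral of H. Fubini lets the t-integral, which vanishes, be taken
  first. The lemma serves both the mean value property (rotations of the whole space) and
  self-adjointness (rotations of one coordinate).\<close>

lemma integral_eq_0_if_circle_averages_0:
  fixes R :: "real \<Rightarrow> 'a::euclidean_space \<Rightarrow> 'a" and H :: "'a \<Rightarrow> complex"
  assumes lin: "\<And>t. linear (R t)" and iso: "\<And>t x. norm (R t x) = norm x"
    and cont_R: "continuous_on UNIV (\<lambda>p. R (fst p) (snd p))"
    and "open D" and inv: "\<And>t x. R t x \<in> D \<longleftrightarrow> x \<in> D"
    and cont: "continuous_on D H" and int: "set_integrable lborel D H"
    and avg: "\<And>x. x \<in> D \<Longrightarrow> integral {0..2 * pi} (\<lambda>t. H (R t x)) = 0"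
  shows "(LINT x:D|lborel. H x) = 0"
proof -
  define h where "h x = indicator D x *\<^sub>R H x" for x
  have h_int: "integrable lborel h" using int by (simp add: h_def[abs_def] set_integrable_def)
  then have [measurable]: "h \<in> borel_measurable borel" by auto
  have R_meas[measurable]: "(\<lambda>p. R (fst p) (snd p)) \<in> borel_measurable borel"
    using cont_R by (rule borel_measurable_continuous_onI)
  have Rt_meas[measurable]: "R t \<in> borel_measurable borel" for t
    using lin[of t] by (intro borel_measurable_continuous_onI linear_continuous_on)
      (simp add: linear_conv_bounded_linear)
  define p :: "real \<times> 'a \<Rightarrow> complex" where "p = (\<lambda>(t, x). indicator {0..2*pi} t *\<^sub>R h (R t x))"
  have [measurable]: "p \<in> borel_measurable (lborel \<Otimes>\<^sub>M lborel)"
  proof -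
    have [measurable]: "(\<lambda>q. R (fst q) (snd q)) \<in> borel_measurable (lborel \<Otimes>\<^sub>M lborel)"
      using R_meas by (simp add: lborel_prod)
    show ?thesis unfolding p_def split_def by measurable
  qed
  have int_R: "integrable lborel (\<lambda>x. g (R t x))" "(LINT x|lborel. g (R t x)) = (LINT x|lborel. g x)"
    if "integrable lborel g" for g :: "'a \<Rightarrow> 'b::{banach, second_countable_topology}" and t
  proof -
    have eq: "distr lborel borel (R t) = lborel" by (rule lborel_distr_linear_isometry[OF lin iso])
    have [measurable]: "g \<in> borel_measurable borel" using that by auto
    show "integrable lborel (\<lambda>x. g (R t x))"
      using that eq integrable_distr_eq[of "R t" lborel borel g] by auto
    show "(LINT x|lborel. g (R t x)) = (LINT x|lborel. g x)"
      using eq integral_distr[of "R t" lborel borel g] by auto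
  qed
  have p_int: "integrable (lborel \<Otimes>\<^sub>M lborel) p"
  proof (rule lborel_pair.Fubini_integrable)
    have "(LINT x|lborel. norm (p (t, x))) = indicator {0..2*pi} t * (LINT x|lborel. norm (h x))" for t
      using int_R(2)[OF integrable_norm[OF h_int], of t] by (simp add: p_def)
    then show "integrable lborel (\<lambda>t. LINT x|lborel. norm (p (t, x)))"
      by (simp add: integrable_mult_left)
    show "AE t in lborel. integrable lborel (\<lambda>x. p (t, x))"
      using int_R(1)[OF h_int] by (simp add: p_def)
  qed measurable
  have inner_t: "(LINT t|lborel. p (t, x)) = 0" for x
  proof (cases "x \<in> D")
    case True
    have "continuous_on UNIV (\<lambda>t. R t x)"
      using continuous_on_compose2[OF cont_R, of UNIV "\<lambda>t. (t, x)"] by (simp add: continuous_intros)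
    then have "continuous_on {0..2*pi} (\<lambda>t. H (R t x))"
      using True inv by (intro continuous_on_compose2[OF cont]) (auto intro: continuous_on_subset)
    then have "set_integrable lborel {0..2*pi} (\<lambda>t. H (R t x))"
      by (rule borel_integrable_atLeastAtMost')
    then have "(LINT t:{0..2*pi}|lborel. H (R t x)) = 0"
      by (simp add: set_borel_integral_eq_integral avg True)
    then show ?thesis
      using True inv by (simp add: p_def h_def set_lebesgue_integral_def)
  next
    case False
    then show ?thesis using inv by (simp add: p_def h_def)
  qed
  have "(LINT x|lborel. LINT t|lborel. p (t, x)) = (LINT t|lborel. LINT x|lborel. p (t, x))"
    using lborel_pair.Fubini_integral[of "\<lambda>t x. p (t, x)"] p_int by simp
  moreover have "(LINT x|lborel. p (t, x)) = indicator {0..2*pi} t *\<^sub>R (LINT x|lborel. h x)" for t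
    using int_R(2)[OF h_int, of t] by (simp add: p_def)
  ultimately have "of_real (2 * pi) * (LINT x|lborel. h x) = 0"
    by (simp add: inner_t scaleR_conv_of_real)
  then show ?thesis by (simp add: h_def[abs_def] set_lebesgue_integral_def)
qed

lemma integral_cong_circle_averages:
  fixes R :: "real \<Rightarrow> 'a::euclidean_space \<Rightarrow> 'a" and F G :: "'a \<Rightarrow> complex"
  assumes lin: "\<And>t. linear (R t)" and iso: "\<And>t x. norm (R t x) = norm x"
    and cont_R: "continuous_on UNIV (\<lambda>p. R (fst p) (snd p))"
    and "open D" and inv: "\<And>t x. R t x \<in> D \<longleftrightarrow> x \<in> D"
    and cont: "continuous_on D F" "continuous_on D G"
    and int: "set_integrable lborel D F" "set_integrable lborel D G"
    and avg: "\<And>x. x \<in> D \<Longrightarrow> integral {0..2 * pi} (\<lambda>t. F (R t x)) = integral {0..2 * pi} (\<lambda>t. G (R t x))"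
  shows "(LINT x:D|lborel. F x) = (LINT x:D|lborel. G x)"
proof -
  have cont_Rx: "continuous_on UNIV (\<lambda>t. R t x)" for x
    using continuous_on_compose2[OF cont_R, of UNIV "\<lambda>t. (t, x)"] by (simp add: continuous_intros)
  have "(LINT x:D|lborel. F x - G x) = 0"
  proof (rule integral_eq_0_if_circle_averages_0[OF lin iso cont_R \<open>open D\<close> inv])
    fix x assume "x \<in> D"
    then have "(\<lambda>t. f (R t x)) integrable_on {0..2*pi}" if "continuous_on D f" for f :: "'a \<Rightarrow> complex"
      using inv cont_Rx by (intro integrable_continuous_interval continuous_on_compose2[OF that])
        (auto intro: continuous_on_subset)
    then show "integral {0..2 * pi} (\<lambda>t. F (R t x) - G (R t x)) = 0"
      using avg[OF \<open>x \<in> D\<close>] cont by (simp add: integral_diff)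
  qed (use cont int in \<open>auto intro!: continuous_intros set_integral_diff\<close>)
  then show ?thesis using int by (simp add: set_integral_diff)
qed

section \<open>Holomorphic functions and the mean value property\<close>

text \<open>An orthogonal complex structure. The abstraction covers multiplication by \<i> both on
  \<open>complex^'N\<close> and on its product with \<open>complex\<close>, so the theory of Bergman
  spaces is developed once for \<Omega> and V.\<close>

definition complex_structure :: "('a::euclidean_space \<Rightarrow> 'a) \<Rightarrow> bool" where
  "complex_structure J \<longleftrightarrow> linear J \<and> (\<forall>v. J (J v) = - v) \<and> (\<forall>v. norm (J v) = norm v)"

definition cscale :: "('a::euclidean_space \<Rightarrow> 'a) \<Rightarrow> complex \<Rightarrow> 'a \<Rightarrow> 'a" where
  "cscale J \<mu> v = Re \<mu> *\<^sub>R v + Im \<mu> *\<^sub>R J v"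

context
  fixes J :: "'a::euclidean_space \<Rightarrow> 'a"
  assumes J: "complex_structure J"
begin

lemma linear_J: "linear J" and J_J: "J (J v) = - v" and norm_J: "norm (J v) = norm v"
  using J by (auto simp: complex_structure_def)

lemma bounded_linear_J: "bounded_linear J"
  using linear_J by (simp add: linear_conv_bounded_linear)

lemma inner_J_self: "v \<bullet> J v = 0"
proof -
  have "orthogonal_transformation J"
    using linear_J norm_J by (simp add: orthogonal_transformation)
  then have "J v \<bullet> J (J v) = v \<bullet> J v" by (simp add: orthogonal_transformation_def)
  then show ?thesis by (simp add: J_J inner_commute)
qed

lemma norm_cscale: "norm (cscale J \<mu> v) = cmod \<mu> * norm v"
proof -
  have "(norm (cscale J \<mu> v))\<^sup>2 = (Re \<mu>)\<^sup>2 * (norm v)\<^sup>2 + (Im \<mu>)\<^sup>2 * (norm (J v))\<^sup>2"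
    unfolding cscale_def power2_norm_eq_inner
    by (simp add: inner_add_left inner_add_right inner_J_self inner_commute[of "J v" v] power2_eq_square)
  also have "\<dots> = (cmod \<mu> * norm v)\<^sup>2"
    by (simp add: norm_J cmod_def power_mult_distrib algebra_simps)
  finally show ?thesis by (simp add: power2_eq_iff_nonneg)
qed

lemma linear_cscale: "linear (cscale J \<mu>)"
  using linear_J by (intro linearI) (auto simp: cscale_def linear_add linear_scale algebra_simps)

lemma bounded_linear_cscale_left: "bounded_linear (\<lambda>\<mu>. cscale J \<mu> v)"
  unfolding linear_conv_bounded_linear[symmetric]
  by (intro linearI) (auto simp: cscale_def algebra_simps)

lemma continuous_on_cscale [continuous_intros]:
  assumes "continuous_on A f" "continuous_on A g"
  shows "continuous_on A (\<lambda>p. cscale J (f p) (g p))"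
  unfolding cscale_def
  using assms by (intro continuous_intros continuous_on_compose2[OF linear_continuous_on[OF bounded_linear_J, of UNIV]]) auto

lemma has_field_derivative_cscale_slice:
  assumes L: "(f has_derivative L) (at (x + cscale J \<mu> v))" and LJ: "\<And>v. L (J v) = \<i> * L v"
  shows "((\<lambda>\<mu>. f (x + cscale J \<mu> v)) has_field_derivative L v) (at \<mu>)"
proof -
  interpret L: linear L using has_derivative_linear[OF L] .
  have d: "((\<lambda>\<mu>. x + cscale J \<mu> v) has_derivative (\<lambda>t. 0 + cscale J t v)) (at \<mu>)"
    by (intro has_derivative_add has_derivative_const bounded_linear.has_derivative[OF bounded_linear_cscale_left] has_derivative_ident)
  have "L (0 + cscale J t v) = L v * t" for t
    by (simp add: cscale_def L.add L.scale LJ complex_eq_iff)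
  then show ?thesis
    using has_derivative_compose[OF d L] by (simp add: has_field_derivative_def)
qed

lemma cholo_slice_holomorphic:
  assumes "cholo_on J f D" and "\<And>\<mu>. \<mu> \<in> A \<Longrightarrow> x + cscale J \<mu> v \<in> D" and "open A"
  shows "(\<lambda>\<mu>. f (x + cscale J \<mu> v)) holomorphic_on A"
  using assms has_field_derivative_cscale_slice unfolding holomorphic_on_open[OF \<open>open A\<close>] cholo_on_def
  by metis

end

lemma cholo_on_subset: "cholo_on J f D \<Longrightarrow> E \<subseteq> D \<Longrightarrow> cholo_on J f E"
  by (auto simp: cholo_on_def)

lemma cholo_on_imp_continuous_on: "cholo_on J f D \<Longrightarrow> continuous_on D f"
  by (meson cholo_on_def continuous_at_imp_continuous_on has_derivative_continuous)

lemma cholo_on_const [simp]: "cholo_on J (\<lambda>x. c) D"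
  unfolding cholo_on_def by (intro ballI exI[of _ "\<lambda>x. 0"]) auto

lemma cholo_on_add: "cholo_on J f D \<Longrightarrow> cholo_on J g D \<Longrightarrow> cholo_on J (\<lambda>x. f x + g x) D"
  unfolding cholo_on_def
proof
  fix x assume f: "\<forall>x\<in>D. \<exists>L. (f has_derivative L) (at x) \<and> (\<forall>v. L (J v) = \<i> * L v)"
    and g: "\<forall>x\<in>D. \<exists>L. (g has_derivative L) (at x) \<and> (\<forall>v. L (J v) = \<i> * L v)" and "x \<in> D"
  then obtain L M where L: "(f has_derivative L) (at x)" "\<forall>v. L (J v) = \<i> * L v"
    and M: "(g has_derivative M) (at x)" "\<forall>v. M (J v) = \<i> * M v" by blast
  show "\<exists>L. ((\<lambda>x. f x + g x) has_derivative L) (at x) \<and> (\<forall>v. L (J v) = \<i> * L v)"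
    by (rule exI, rule conjI, rule has_derivative_add[OF L(1) M(1)]) (use L M in \<open>simp add: algebra_simps\<close>)
qed

lemma cholo_on_mult: 
  assumes "cholo_on J f D" "cholo_on J g D" 
  shows "cholo_on J (\<lambda>x. f x * g x) D"
  unfolding cholo_on_def
proof
  fix x assume "x \<in> D"
  then obtain L M where L: "(f has_derivative L) (at x)" "\<forall>v. L (J v) = \<i> * L v"
    and M: "(g has_derivative M) (at x)" "\<forall>v. M (J v) = \<i> * M v"
    using assms unfolding cholo_on_def by blast
  show "\<exists>L. ((\<lambda>x. f x * g x) has_derivative L) (at x) \<and> (\<forall>v. L (J v) = \<i> * L v)"
    by (rule exI, rule conjI, rule has_derivative_mult[OF L(1) M(1)]) (use L M in \<open>simp add: algebra_simps\<close>)
qed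

lemma cholo_on_cmult: "cholo_on J f D \<Longrightarrow> cholo_on J (\<lambda>x. c * f x) D"
  by (intro cholo_on_mult) auto

lemma cholo_on_compose:
  assumes f: "cholo_on J' f D'" and \<Phi>: "\<And>x. x \<in> D \<Longrightarrow> \<Phi> x \<in> D'"
    and d: "\<And>x. x \<in> D \<Longrightarrow> (\<Phi> has_derivative \<Phi>' x) (at x)" "\<And>x v. x \<in> D \<Longrightarrow> \<Phi>' x (J v) = J' (\<Phi>' x v)"
  shows "cholo_on J (\<lambda>x. f (\<Phi> x)) D"
  unfolding cholo_on_def
proof
  fix x assume x: "x \<in> D"
  then obtain L where L: "(f has_derivative L) (at (\<Phi> x))" "\<And>v. L (J' v) = \<i> * L v"
    using f \<Phi> unfolding cholo_on_def by blast
  show "\<exists>L. ((\<lambda>x. f (\<Phi> x)) has_derivative L) (at x) \<and> (\<forall>v. L (J v) = \<i> * L v)"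
    by (rule exI, rule conjI, rule has_derivative_compose[OF d(1)[OF x] L(1)]) (simp add: d x L)
qed

lemma cholo_on_cong: 
  assumes "open D" "\<And>x. x \<in> D \<Longrightarrow> f x = g x" "cholo_on J f D" 
  shows "cholo_on J g D"
  using assms unfolding cholo_on_def by (metis has_derivative_transform_within_open)

text \<open>The rotations e^(it) about x preserve the ball. On the complex line through x and x + v
  the function is holomorphic past the closed unit disc, because v lies in the open ball, so its
  circle average is f x, the same as for the constant function.\<close>

lemma cholo_mean_value_ball:
  fixes J :: "'a::euclidean_space \<Rightarrow> 'a"
  assumes J: "complex_structure J" and f: "cholo_on J f (ball x r)"
    and int: "set_integrable lborel (ball x r) f"
  shows "(LINT y:ball x r|lborel. f y) = of_real (measure lborel (ball x r)) * f x"
proof -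
  have ind: "indicator (ball x r) (x + v) = (indicator (ball 0 r) v :: real)" for v
    by (auto simp: indicator_def dist_norm)
  have eq: "(LINT y:ball x r|lborel. f y) = (LINT v:ball 0 r|lborel. f (x + v))"
    and int': "set_integrable lborel (ball 0 r) (\<lambda>v. f (x + v))"
  proof -
    let ?g = "\<lambda>y. indicator (ball x r) y *\<^sub>R f y"
    have [measurable]: "?g \<in> borel_measurable borel" 
      using int unfolding set_integrable_def by auto
    show "(LINT y:ball x r|lborel. f y) = (LINT v:ball 0 r|lborel. f (x + v))"
      using integral_distr[of "(+) x" lborel borel ?g]
      by (simp add: lborel_distr_plus set_lebesgue_integral_def ind)
    show "set_integrable lborel (ball 0 r) (\<lambda>v. f (x + v))"
      using integrable_distr_eq[of "(+) x" lborel borel ?g] int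
      by (simp add: lborel_distr_plus set_integrable_def ind)
  qed
  have "(LINT v:ball 0 r|lborel. f (x + v)) = (LINT v:ball (0::'a) r|lborel. f x)"
  proof (rule integral_cong_circle_averages[where R = "\<lambda>t. cscale J (cis t)"])
    show "continuous_on UNIV (\<lambda>p. cscale J (cis (fst p)) (snd p))"
      using J by (auto simp: cis_conv_exp intro!: continuous_intros)
    show "continuous_on (ball 0 r) (\<lambda>v. f (x + v))"
      by (rule continuous_on_compose2[OF cholo_on_imp_continuous_on[OF f]])
        (auto intro!: continuous_intros simp: dist_norm)
    show "set_integrable lborel (ball (0::'a) r) (\<lambda>v. f x)"
      unfolding set_integrable_def
      using emeasure_lborel_ball_finite[of "0::'a" r]
      by (intro integrable_scaleR_left integrable_real_indicator) auto
    fix v :: 'a assume v: "v \<in> ball 0 r"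
    let ?A = "{\<mu>. cmod \<mu> * norm v < r}"
    have "open ?A" by (intro open_Collect_less continuous_intros)
    then have hol: "(\<lambda>\<mu>. f (x + cscale J \<mu> v)) holomorphic_on ?A"
      using J by (intro cholo_slice_holomorphic[OF J f]) (auto simp: dist_norm norm_cscale)
    have "cball 0 1 \<subseteq> ?A"
    proof
      fix \<mu> :: complex assume "\<mu> \<in> cball 0 1"
      then have "cmod \<mu> * norm v \<le> 1 * norm v" by (intro mult_right_mono) auto
      then show "\<mu> \<in> ?A" using v by auto
    qed
    from integral_unique[OF mean_value_circle[OF hol this]]
    show "integral {0..2 * pi} (\<lambda>t. f (x + cscale J (cis t) v)) = integral {0..2 * pi} (\<lambda>t. f x)"
      by (simp add: cscale_def scaleR_conv_of_real)
  qed (use J int' in \<open>auto simp: norm_cscale linear_cscale\<close>)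
  also have "\<dots> = of_real (measure lborel (ball x r)) * f x"
  proof -
    have "emeasure lborel (ball (0::'a) r) \<noteq> \<infinity>"
      using emeasure_lborel_ball_finite[of "0::'a" r] by auto
    moreover have "measure lborel (ball (0::'a) r) = measure lborel (ball x r)"
      by (cases "r \<ge> 0") (auto simp: content_ball ball_empty)
    ultimately show ?thesis
      by (subst set_integral_const) (auto simp: scaleR_conv_of_real)
  qed
  finally show ?thesis using eq by simp
qed

section \<open>The Bergman space and its reproducing kernel\<close>

text \<open>This and \<open>ip\<close> integrate over \<open>lborel\<close>, the measure for which
  products and Fubini are used below. For continuous integrands on open sets the values agree with
  the \<open>lebesgue\<close> integrals in the definition of the kernel.\<close>

definition norm2 :: "'a::euclidean_space set \<Rightarrow> ('a \<Rightarrow> complex) \<Rightarrow> real" where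
  "norm2 D f = (LINT x:D|lborel. (cmod (f x))\<^sup>2)"

definition ip :: "'a::euclidean_space set \<Rightarrow> ('a \<Rightarrow> complex) \<Rightarrow> ('a \<Rightarrow> complex) \<Rightarrow> complex" where
  "ip D f g = (LINT x:D|lborel. f x * cnj (g x))"

lemma borel_measurable_on_open:
  fixes f :: "'a::euclidean_space \<Rightarrow> 'b::real_normed_vector"
  assumes "open D" "continuous_on D f"
  shows "(\<lambda>x. indicator D x *\<^sub>R f x) \<in> borel_measurable borel"
  using assms by (intro borel_measurable_continuous_on_indicator) auto

lemma set_integrable_lebesgue_iff_lborel:
  fixes f :: "'a::euclidean_space \<Rightarrow> 'b::{banach, second_countable_topology}"
  assumes "open D" "continuous_on D f"
  shows "set_integrable lebesgue D f \<longleftrightarrow> set_integrable lborel D f"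
  unfolding set_integrable_def
  by (intro integrable_completion) (use borel_measurable_on_open[OF assms] in simp)

lemma set_integral_lebesgue_eq_lborel:
  fixes f :: "'a::euclidean_space \<Rightarrow> 'b::{banach, second_countable_topology}"
  assumes "open D" "continuous_on D f"
  shows "(LINT x:D|lebesgue. f x) = (LINT x:D|lborel. f x)"
  unfolding set_lebesgue_integral_def
  by (intro integral_completion) (use borel_measurable_on_open[OF assms] in simp)

text \<open>Cauchy's inequality on complex lines makes the derivatives uniformly Cauchy on a ball of
  half the radius. The limit is then differentiable, and complex linearity of the derivative
  survives the limit.\<close>

lemma cholo_locally_uniform_limit:
  assumes J: "complex_structure J" and "open D"
    and F: "\<And>n. cholo_on J (F n) D"
    and unif: "\<And>x. x \<in> D \<Longrightarrow> \<exists>r>0. ball x r \<subseteq> D \<and>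
      (\<forall>e>0. \<exists>N. \<forall>m\<ge>N. \<forall>n\<ge>N. \<forall>y\<in>ball x r. cmod (F m y - F n y) \<le> e)"
  shows "\<exists>g. cholo_on J g D \<and> (\<forall>x\<in>D. (\<lambda>n. F n x) \<longlonglongrightarrow> g x)"
proof -
  have Cauchy_F: "Cauchy (\<lambda>n. F n x)" if x: "x \<in> D" for x
  proof (rule metric_CauchyI)
    fix e :: real assume "e > 0"
    then have "e / 2 > 0" by simp
    moreover obtain r where r: "r > 0" "\<forall>e>0. \<exists>N. \<forall>m\<ge>N. \<forall>n\<ge>N. \<forall>y\<in>ball x r. cmod (F m y - F n y) \<le> e"
      using unif[OF x] by blast
    ultimately obtain N where "\<forall>m\<ge>N. \<forall>n\<ge>N. \<forall>y\<in>ball x r. cmod (F m y - F n y) \<le> e / 2" by meson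
    moreover have "x \<in> ball x r" using r by simp
    ultimately have "\<forall>m\<ge>N. \<forall>n\<ge>N. cmod (F m x - F n x) \<le> e / 2" by meson
    then show "\<exists>N. \<forall>m\<ge>N. \<forall>n\<ge>N. dist (F m x) (F n x) < e"
      using \<open>e > 0\<close> by (intro exI[of _ N]) (force simp: dist_norm)
  qed
  define g where "g x = lim (\<lambda>n. F n x)" for x
  have g: "(\<lambda>n. F n x) \<longlonglongrightarrow> g x" if "x \<in> D" for x
    using Cauchy_F[OF that] unfolding g_def by (simp add: Cauchy_convergent_iff convergent_LIMSEQ_iff)
  define L where "L n x = (SOME L. (F n has_derivative L) (at x) \<and> (\<forall>v. L (J v) = \<i> * L v))" for n x
  have L_spec: "(F n has_derivative L n x) (at x) \<and> (\<forall>v. L n x (J v) = \<i> * L n x v)" if "x \<in> D" for n x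
  proof -
    have "\<exists>L. (F n has_derivative L) (at x) \<and> (\<forall>v. L (J v) = \<i> * L v)"
      using F[of n] that unfolding cholo_on_def by blast
    from someI_ex[OF this] show ?thesis unfolding L_def .
  qed
  have L: "\<And>n x. x \<in> D \<Longrightarrow> (F n has_derivative L n x) (at x)"
    "\<And>n x v. x \<in> D \<Longrightarrow> L n x (J v) = \<i> * L n x v" using L_spec by auto
  have "cholo_on J g D"
    unfolding cholo_on_def
  proof
    fix x0 assume x0: "x0 \<in> D"
    obtain r where r: "r > 0" "ball x0 r \<subseteq> D" and
      unif_r: "\<And>e. e > 0 \<Longrightarrow> \<exists>N. \<forall>m\<ge>N. \<forall>n\<ge>N. \<forall>y\<in>ball x0 r. cmod (F m y - F n y) \<le> e"
      using unif[OF x0] by blast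
    define S where "S = ball x0 (r / 2)"
    have S: "convex S" "open S" "x0 \<in> S" "S \<subseteq> D" using r by (auto simp: S_def)
    have est: "cmod (L m x v - L n x v) \<le> 4 * B / r * norm v"
      if B: "\<And>y. y \<in> ball x0 r \<Longrightarrow> cmod (F m y - F n y) \<le> B" and x: "x \<in> S" for B x v m n
    proof (cases "v = 0")
      case True
      then show ?thesis using L(1)[THEN has_derivative_linear] x S(4)
        by (simp add: linear_0 subsetD)
    next
      case False
      \<comment> \<open>For |\<mu>| < 2 \<rho> the point moves by less than r / 2 and so stays in
        the ball around x0. Cauchy's inequality on the circle of radius \<rho> then yields the
        constant 4 / r.\<close>
      define \<rho> where "\<rho> = r / (4 * norm v)"
      have "\<rho> > 0" using r False by (simp add: \<rho>_def)
      define h where "h \<mu> = F m (x + cscale J \<mu> v) - F n (x + cscale J \<mu> v)" for \<mu>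
      have mem: "x + cscale J \<mu> v \<in> ball x0 r" if "cmod \<mu> < 2 * \<rho>" for \<mu>
      proof -
        have "norm (cscale J \<mu> v) < r / 2"
          using that False r by (simp add: norm_cscale[OF J] \<rho>_def field_simps)
        moreover have "norm (x - x0) < r / 2" using x by (simp add: S_def dist_norm norm_minus_commute)
        ultimately have "norm ((x - x0) + cscale J \<mu> v) < r" by (smt (verit) norm_triangle_ineq field_sum_of_halves)
        then show ?thesis by (simp add: dist_norm norm_minus_commute algebra_simps)
      qed
      have hol: "h holomorphic_on ball 0 (2 * \<rho>)"
        unfolding h_def using mem r(2)
        by (intro holomorphic_on_diff cholo_slice_holomorphic[OF J F]) auto
      have "norm ((deriv ^^ 1) h 0) \<le> fact 1 * B / \<rho> ^ 1"
      proof (rule Cauchy_inequality)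
        show "h holomorphic_on ball 0 \<rho>" "continuous_on (cball 0 \<rho>) h"
          using \<open>\<rho> > 0\<close> by (auto intro!: holomorphic_on_imp_continuous_on intro: holomorphic_on_subset[OF hol])
        show "cmod (h \<mu>) \<le> B" if "cmod (0 - \<mu>) = \<rho>" for \<mu>
          using B mem[of \<mu>] that \<open>\<rho> > 0\<close> by (simp add: h_def)
      qed fact
      moreover have "deriv h 0 = L m x v - L n x v"
      proof (rule DERIV_imp_deriv)
        have "((\<lambda>\<mu>. F k (x + cscale J \<mu> v)) has_field_derivative L k x v) (at 0)" for k
          using L[of x] x S(4)
          by (intro has_field_derivative_cscale_slice[OF J]) (auto simp: cscale_def)
        then show "(h has_field_derivative L m x v - L n x v) (at 0)"
          unfolding h_def[abs_def] by (intro DERIV_diff)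
      qed
      ultimately show ?thesis using False r by (simp add: \<rho>_def field_simps)
    qed
    have L_Cauchy: "\<exists>N. \<forall>m\<ge>N. \<forall>n\<ge>N. \<forall>x\<in>S. \<forall>v. cmod (L m x v - L n x v) \<le> e * norm v" if e: "e > 0" for e
    proof -
      obtain N where N: "\<forall>m\<ge>N. \<forall>n\<ge>N. \<forall>y\<in>ball x0 r. cmod (F m y - F n y) \<le> e * r / 4"
        using unif_r[of "e * r / 4"] e r by auto
      then have "cmod (L m x v - L n x v) \<le> e * norm v" if "m \<ge> N" "n \<ge> N" "x \<in> S" for m n x v
        using est[of m n "e * r / 4" x v] that r by simp
      then show ?thesis by blast
    qed
    define g' where "g' x v = lim (\<lambda>n. L n x v)" for x v
    have g': "(\<lambda>n. L n x v) \<longlonglongrightarrow> g' x v" if xS: "x \<in> S" for x v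
    proof -
      have "Cauchy (\<lambda>n. L n x v)"
      proof (rule metric_CauchyI)
        fix e :: real assume "e > 0"
        define e' where "e' = e / (norm v + 1)"
        have nv: "norm v + 1 > 0" by (simp add: add_nonneg_pos)
        then have "e' > 0" using \<open>e > 0\<close> by (simp add: e'_def)
        moreover have "e' * norm v < e" using \<open>e > 0\<close> nv by (simp add: e'_def field_simps)
        moreover obtain N where "\<forall>m\<ge>N. \<forall>n\<ge>N. cmod (L m x v - L n x v) \<le> e' * norm v"
          using L_Cauchy[OF \<open>e' > 0\<close>] xS by blast
        ultimately show "\<exists>N. \<forall>m\<ge>N. \<forall>n\<ge>N. dist (L m x v) (L n x v) < e"
          unfolding dist_norm by (meson le_less_trans)
      qed
      then show ?thesis
        unfolding g'_def by (simp add: Cauchy_convergent_iff convergent_LIMSEQ_iff)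
    qed
    have "\<exists>G. \<forall>x\<in>S. (\<lambda>n. F n x) \<longlonglongrightarrow> G x \<and> (G has_derivative g' x) (at x within S)"
    proof (rule has_derivative_sequence[OF S(1)])
      show "(F n has_derivative L n x) (at x within S)" if "x \<in> S" for n x
        using L(1) that S by (blast intro: has_derivative_at_withinI)
      show "(\<lambda>n. F n x0) \<longlonglongrightarrow> g x0" using g x0 by blast
      fix e :: real assume "e > 0"
      then obtain N where N: "\<forall>m\<ge>N. \<forall>n\<ge>N. \<forall>x\<in>S. \<forall>v. cmod (L m x v - L n x v) \<le> e * norm v"
        using L_Cauchy by blast
      have "norm (L n x h - g' x h) \<le> e * norm h" if "n \<ge> N" "x \<in> S" for n x h
      proof (rule tendsto_upperbound)
        show "(\<lambda>m. norm (L n x h - L m x h)) \<longlonglongrightarrow> norm (L n x h - g' x h)"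
          using that by (intro tendsto_intros g')
        show "\<forall>\<^sub>F m in sequentially. norm (L n x h - L m x h) \<le> e * norm h"
          using N that unfolding eventually_sequentially by blast
      qed simp
      then show "\<forall>\<^sub>F n in sequentially. \<forall>x\<in>S. \<forall>h. norm (L n x h - g' x h) \<le> e * norm h"
        unfolding eventually_sequentially by blast
    qed (use S in auto)
    then obtain G where G: "\<And>x. x \<in> S \<Longrightarrow> (\<lambda>n. F n x) \<longlonglongrightarrow> G x"
      "\<And>x. x \<in> S \<Longrightarrow> (G has_derivative g' x) (at x within S)" by blast
    have "G x = g x" if "x \<in> S" for x
      using G(1)[OF that] g[of x] that S(4) LIMSEQ_unique by blast
    then have "(g has_derivative g' x0) (at x0)"
      using G(2)[OF S(3)] S by (metis at_within_open has_derivative_transform_within_open)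
    moreover have "g' x0 (J v) = \<i> * g' x0 v" for v
    proof (rule LIMSEQ_unique[OF g'[OF S(3)]])
      show "(\<lambda>n. L n x0 (J v)) \<longlonglongrightarrow> \<i> * g' x0 v"
        unfolding L(2)[OF x0] by (intro tendsto_intros g' S)
    qed
    ultimately show "\<exists>L. (g has_derivative L) (at x0) \<and> (\<forall>v. L (J v) = \<i> * L v)" by blast
  qed
  with g show ?thesis by blast
qed

context
  fixes D :: "'a::euclidean_space set" and J :: "'a \<Rightarrow> 'a"
  assumes D: "open D"
begin

lemma A2_cholo: "f \<in> A2 J D \<Longrightarrow> cholo_on J f D"
  by (simp add: A2_def)

lemma A2_continuous: "f \<in> A2 J D \<Longrightarrow> continuous_on D f"
  using A2_cholo cholo_on_imp_continuous_on by blast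

lemma A2_iff: "f \<in> A2 J D \<longleftrightarrow> cholo_on J f D \<and> set_integrable lborel D (\<lambda>x. (cmod (f x))\<^sup>2)"
proof (cases "cholo_on J f D")
  case True
  then have "continuous_on D (\<lambda>x. (cmod (f x))\<^sup>2)"
    by (intro continuous_intros cholo_on_imp_continuous_on)
  with True show ?thesis
    unfolding A2_def using set_integrable_lebesgue_iff_lborel[OF D] by blast
qed (simp add: A2_def)

lemma A2_iff_nn: "f \<in> A2 J D \<longleftrightarrow> cholo_on J f D \<and> (\<integral>\<^sup>+x. ennreal (indicator D x * (cmod (f x))\<^sup>2) \<partial>lborel) < \<infinity>"
proof (cases "cholo_on J f D")
  case True
  then have "(\<lambda>x. indicator D x *\<^sub>R (cmod (f x))\<^sup>2) \<in> borel_measurable borel"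
    by (intro borel_measurable_on_open[OF D] continuous_intros cholo_on_imp_continuous_on)
  then show ?thesis
    using True by (simp add: A2_iff set_integrable_def integrable_iff_bounded)
qed (simp add: A2_iff)

lemma A2_integrable_mult:
  assumes f: "f \<in> A2 J D" and g: "g \<in> A2 J D"
  shows "set_integrable lborel D (\<lambda>x. f x * cnj (g x))"
proof (rule set_integrable_bound)
  show "set_integrable lborel D (\<lambda>x. (cmod (f x))\<^sup>2 + (cmod (g x))\<^sup>2)"
    using f g by (auto simp: A2_iff)
  show "set_borel_measurable lborel D (\<lambda>x. f x * cnj (g x))"
    unfolding set_borel_measurable_def using A2_continuous[OF f] A2_continuous[OF g]
    by (auto intro!: borel_measurable_on_open[OF D] continuous_intros)
  have "cmod (f x) * cmod (g x) \<le> (cmod (f x))\<^sup>2 + (cmod (g x))\<^sup>2" for x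
    using sum_squares_bound[of "cmod (f x)" "cmod (g x)"] mult_nonneg_nonneg[OF norm_ge_zero norm_ge_zero, of "f x" "g x"]
    by linarith
  then show "AE x in lborel. x \<in> D \<longrightarrow> norm (f x * cnj (g x)) \<le> norm ((cmod (f x))\<^sup>2 + (cmod (g x))\<^sup>2)"
    by (auto simp: norm_mult)
qed

lemma A2_cmult: "f \<in> A2 J D \<Longrightarrow> (\<lambda>x. c * f x) \<in> A2 J D"
  by (auto simp: A2_iff cholo_on_cmult norm_mult power_mult_distrib)

lemma A2_add:
  assumes f: "f \<in> A2 J D" and g: "g \<in> A2 J D"
  shows "(\<lambda>x. f x + g x) \<in> A2 J D"
proof -
  have cont: "continuous_on D f" "continuous_on D g" using f g A2_continuous by auto
  have "set_integrable lborel D (\<lambda>x. (cmod (f x + g x))\<^sup>2)"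
  proof (rule set_integrable_bound)
    show "set_integrable lborel D (\<lambda>x. 2 * (cmod (f x))\<^sup>2 + 2 * (cmod (g x))\<^sup>2)"
      using f g by (auto simp: A2_iff)
    show "set_borel_measurable lborel D (\<lambda>x. (cmod (f x + g x))\<^sup>2)"
      unfolding set_borel_measurable_def measurable_lborel2 using cont
      by (intro borel_measurable_on_open[OF D] continuous_intros)
    have "(cmod (f x + g x))\<^sup>2 \<le> 2 * (cmod (f x))\<^sup>2 + 2 * (cmod (g x))\<^sup>2" for x
    proof -
      have "(cmod (f x + g x))\<^sup>2 \<le> (cmod (f x) + cmod (g x))\<^sup>2"
        by (intro power_mono norm_triangle_ineq) auto
      also have "\<dots> \<le> 2 * (cmod (f x))\<^sup>2 + 2 * (cmod (g x))\<^sup>2"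
        using sum_squares_bound[of "cmod (f x)" "cmod (g x)"] by (simp add: power2_sum)
      finally show ?thesis .
    qed
    then show "AE x in lborel. x \<in> D \<longrightarrow> norm ((cmod (f x + g x))\<^sup>2) \<le> norm (2 * (cmod (f x))\<^sup>2 + 2 * (cmod (g x))\<^sup>2)"
      by auto
  qed
  then show ?thesis using f g by (simp add: A2_iff cholo_on_add)
qed

lemma A2_diff: "f \<in> A2 J D \<Longrightarrow> g \<in> A2 J D \<Longrightarrow> (\<lambda>x. f x - g x) \<in> A2 J D"
  using A2_add[of f "\<lambda>x. (-1) * g x"] A2_cmult[of g "-1"] by simp

lemma zero_A2 [simp]: "(\<lambda>x. 0) \<in> A2 J D"
  by (simp add: A2_iff set_integrable_def)

lemma norm2_nonneg: "norm2 D f \<ge> 0"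
  unfolding norm2_def set_lebesgue_integral_def by (intro integral_nonneg_AE) auto

lemma ip_self: "ip D f f = of_real (norm2 D f)"
proof -
  have "indicator D x *\<^sub>R (f x * cnj (f x)) = complex_of_real (indicator D x *\<^sub>R (cmod (f x))\<^sup>2)" for x
    by (cases "x \<in> D") (simp_all add: complex_norm_square del: of_real_power)
  then show ?thesis
    unfolding ip_def norm2_def set_lebesgue_integral_def by (simp only: integral_complex_of_real)
qed

lemma ip_cnj: "cnj (ip D f g) = ip D g f"
  unfolding ip_def set_lebesgue_integral_def by (simp flip: Bochner_Integration.integral_cnj add: mult.commute)

lemma ip_add_left:
  "f \<in> A2 J D \<Longrightarrow> g \<in> A2 J D \<Longrightarrow> h \<in> A2 J D \<Longrightarrow> ip D (\<lambda>x. f x + g x) h = ip D f h + ip D g h"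
  unfolding ip_def by (simp add: ring_distribs set_integral_add A2_integrable_mult)

lemma ip_cmult_left: "ip D (\<lambda>x. c * f x) g = c * ip D f g"
  unfolding ip_def by (simp add: mult.assoc)

lemma ip_cmult_right: "ip D f (\<lambda>x. c * g x) = cnj c * ip D f g"
  using ip_cmult_left[of c g f] by (metis complex_cnj_mult ip_cnj)

text \<open>Used with c = 1 and c = -1 for the parallelogram argument, and with a small c to vary
  the minimiser.\<close>

lemma norm2_add_cmult:
  assumes f: "f \<in> A2 J D" and g: "g \<in> A2 J D"
  shows "norm2 D (\<lambda>x. f x + c * g x) = norm2 D f + 2 * Re (c * ip D g f) + (cmod c)\<^sup>2 * norm2 D g"
proof -
  have cg: "(\<lambda>x. c * g x) \<in> A2 J D" and s: "(\<lambda>x. f x + c * g x) \<in> A2 J D"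
    using f g by (auto intro: A2_add A2_cmult)
  have fs: "ip D f (\<lambda>x. f x + c * g x) = ip D f f + cnj c * ip D f g"
    using ip_add_left[OF f cg f] by (metis complex_cnj_add ip_cnj ip_cmult_right)
  have gs: "ip D g (\<lambda>x. f x + c * g x) = ip D g f + cnj c * ip D g g"
    using ip_add_left[OF f cg g] by (metis complex_cnj_add ip_cnj ip_cmult_right)
  have "of_real (norm2 D (\<lambda>x. f x + c * g x)) = ip D (\<lambda>x. f x + c * g x) (\<lambda>x. f x + c * g x)"
    by (simp add: ip_self)
  also have "\<dots> = ip D f (\<lambda>x. f x + c * g x) + c * ip D g (\<lambda>x. f x + c * g x)"
    using ip_add_left[OF f cg s] by (simp add: ip_cmult_left)
  also have "\<dots> = of_real (norm2 D f) + (c * ip D g f + cnj (c * ip D g f)) + c * cnj c * of_real (norm2 D g)"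
    by (simp add: fs gs ip_self ip_cnj algebra_simps)
  also have "\<dots> = of_real (norm2 D f + 2 * Re (c * ip D g f) + (cmod c)\<^sup>2 * norm2 D g)"
    by (simp add: complex_add_cnj complex_norm_square[symmetric] del: complex_cnj_mult)
  finally show ?thesis using of_real_eq_iff by blast
qed

text \<open>The mean value property is applied to the square of \<open>f\<close>, which is integrable.\<close>
lemma A2_eval_bound:
  assumes J: "complex_structure J" and f: "f \<in> A2 J D" and ball: "ball x r \<subseteq> D"
  shows "(cmod (f x))\<^sup>2 * measure lborel (ball x r) \<le> norm2 D f"
proof -
  have f2: "set_integrable lborel D (\<lambda>x. (cmod (f x))\<^sup>2)" using f by (simp add: A2_iff)
  then have f2b: "set_integrable lborel (ball x r) (\<lambda>x. (cmod (f x))\<^sup>2)"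
    by (rule set_integrable_subset) (use ball in auto)
  have ch: "cholo_on J (\<lambda>x. f x * f x) (ball x r)"
    using f ball by (intro cholo_on_mult cholo_on_subset[OF A2_cholo])
  have int: "set_integrable lborel (ball x r) (\<lambda>x. f x * f x)"
  proof (rule set_integrable_bound[OF f2b])
    show "set_borel_measurable lborel (ball x r) (\<lambda>x. f x * f x)"
      unfolding set_borel_measurable_def
      using borel_measurable_on_open[OF open_ball cholo_on_imp_continuous_on[OF ch]] by simp
  qed (simp add: norm_mult power2_eq_square)
  have "(cmod (f x))\<^sup>2 * measure lborel (ball x r) = cmod (LINT y:ball x r|lborel. f y * f y)"
    by (subst cholo_mean_value_ball[OF J ch int]) (simp add: norm_mult power2_eq_square)
  also have "\<dots> \<le> (LINT y:ball x r|lborel. cmod (f y * f y))"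
    by (rule set_integral_norm_bound[OF int])
  also have "\<dots> = (LINT y:ball x r|lborel. (cmod (f y))\<^sup>2)"
    by (simp add: norm_mult power2_eq_square)
  also have "\<dots> \<le> norm2 D f"
    unfolding norm2_def using f2 f2b ball unfolding set_lebesgue_integral_def set_integrable_def
    by (intro integral_mono) (auto simp: indicator_def)
  finally show ?thesis .
qed

lemma nn_integral_A2: "f \<in> A2 J D \<Longrightarrow> (\<integral>\<^sup>+x. ennreal (indicator D x * (cmod (f x))\<^sup>2) \<partial>lborel) = ennreal (norm2 D f)"
  unfolding norm2_def set_lebesgue_integral_def A2_iff set_integrable_def
  by (subst nn_integral_eq_integral) auto

text \<open>The pointwise bound by the norm turns norm-Cauchy into locally uniformly Cauchy, so the
  limit is holomorphic. Fatou's lemma bounds its norm, as the minimisation requires.\<close>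

lemma A2_Cauchy_limit:
  assumes J: "complex_structure J" and F: "\<And>n. F n \<in> A2 J D"
    and Cauchy: "\<And>e. e > 0 \<Longrightarrow> \<exists>N. \<forall>m\<ge>N. \<forall>n\<ge>N. norm2 D (\<lambda>x. F m x - F n x) \<le> e"
    and le: "\<And>n. norm2 D (F n) \<le> d + e n" and e: "e \<longlonglongrightarrow> 0" 
  shows "\<exists>g\<in>A2 J D. (\<forall>x\<in>D. (\<lambda>n. F n x) \<longlonglongrightarrow> g x) \<and> norm2 D g \<le> d"
proof -
  have "\<exists>g. cholo_on J g D \<and> (\<forall>x\<in>D. (\<lambda>n. F n x) \<longlonglongrightarrow> g x)"
  proof (rule cholo_locally_uniform_limit[OF J D])
    show "cholo_on J (F n) D" for n using F A2_cholo by blast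
    fix x assume "x \<in> D"
    then obtain r where r: "r > 0" "ball x r \<subseteq> D" using D open_contains_ball by blast
    \<comment> \<open>All balls of radius r / 2 with centre in \<open>ball x (r / 2)\<close> lie in
      D and have the same volume, so one constant serves every y.\<close>
    define c where "c = measure lborel (ball (0::'a) (r / 2))"
    have c: "c > 0" unfolding c_def using r content_ball_pos[of "r/2" "0::'a"] by simp
    have bd: "(cmod (F m y - F n y))\<^sup>2 * c \<le> norm2 D (\<lambda>x. F m x - F n x)" if "y \<in> ball x (r / 2)" for y m n
    proof -
      have "ball y (r / 2) \<subseteq> D"
      proof -
        have "ball y (r / 2) \<subseteq> ball x r"
          using that by (intro ball_subset_ball_iff[THEN iffD2] disjI1) (simp add: dist_commute)
        with r show ?thesis by blast
      qed
      moreover have "measure lborel (ball y (r / 2)) = c"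
        using r unfolding c_def by (simp add: content_ball)
      ultimately show ?thesis
        using A2_eval_bound[OF J A2_diff[OF F[of m] F[of n]], of y "r/2"] by simp
    qed
    have "\<exists>N. \<forall>m\<ge>N. \<forall>n\<ge>N. \<forall>y\<in>ball x (r / 2). cmod (F m y - F n y) \<le> e" if e0: "e > 0" for e
    proof -
      obtain N where N: "\<forall>m\<ge>N. \<forall>n\<ge>N. norm2 D (\<lambda>x. F m x - F n x) \<le> e\<^sup>2 * c"
        using Cauchy[of "e\<^sup>2 * c"] e0 c by auto
      have "cmod (F m y - F n y) \<le> e" if "m \<ge> N" "n \<ge> N" "y \<in> ball x (r / 2)" for m n y
      proof -
        have "(cmod (F m y - F n y))\<^sup>2 * c \<le> e\<^sup>2 * c"
          using bd[OF that(3), of m n] N that by (meson order_trans)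
        then show ?thesis using c \<open>e > 0\<close> by (simp add: power2_le_iff_abs_le)
      qed
      then show ?thesis by blast
    qed
    then show "\<exists>r>0. ball x r \<subseteq> D \<and>
      (\<forall>e>0. \<exists>N. \<forall>m\<ge>N. \<forall>n\<ge>N. \<forall>y\<in>ball x r. cmod (F m y - F n y) \<le> e)"
      using r by (intro exI[of _ "r / 2"]) (auto simp: subset_iff)
  qed
  then obtain g where g: "cholo_on J g D" "\<And>x. x \<in> D \<Longrightarrow> (\<lambda>n. F n x) \<longlonglongrightarrow> g x" by blast
  let ?u = "\<lambda>n x. ennreal (indicator D x * (cmod (F n x))\<^sup>2)"
  have lim: "(\<lambda>n. ?u n x) \<longlonglongrightarrow> ennreal (indicator D x * (cmod (g x))\<^sup>2)" for x
    using g(2)[of x] by (cases "x \<in> D") (auto intro!: tendsto_intros)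
  have "(\<integral>\<^sup>+x. ennreal (indicator D x * (cmod (g x))\<^sup>2) \<partial>lborel) = (\<integral>\<^sup>+x. liminf (\<lambda>n. ?u n x) \<partial>lborel)"
    using lim_imp_Liminf[OF _ lim] by (intro nn_integral_cong) auto
  also have "\<dots> \<le> liminf (\<lambda>n. \<integral>\<^sup>+x. ?u n x \<partial>lborel)"
  proof (rule nn_integral_liminf)
    fix n
    have "(\<lambda>x. indicator D x *\<^sub>R (cmod (F n x))\<^sup>2) \<in> borel_measurable borel"
      using F by (intro borel_measurable_on_open[OF D] continuous_intros A2_continuous)
    then show "?u n \<in> borel_measurable lborel" by simp
  qed
  also have "\<dots> \<le> liminf (\<lambda>n. ennreal (d + e n))"
    using le by (intro Liminf_mono always_eventually allI) (simp add: nn_integral_A2[OF F] ennreal_leI)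
  also have "\<dots> = ennreal d"
    using tendsto_ennrealI[OF tendsto_add[OF tendsto_const[of d] e]] by (intro lim_imp_Liminf) auto
  finally have fin: "(\<integral>\<^sup>+x. ennreal (indicator D x * (cmod (g x))\<^sup>2) \<partial>lborel) \<le> ennreal d" .
  then have gA: "g \<in> A2 J D" using g(1) by (auto simp: A2_iff_nn intro: le_less_trans)
  have "d \<ge> 0"
  proof (rule tendsto_lowerbound)
    show "(\<lambda>n. d + e n) \<longlonglongrightarrow> d" using tendsto_add[OF tendsto_const[of d] e] by simp
    show "\<forall>\<^sub>F n in sequentially. 0 \<le> d + e n"
      using le norm2_nonneg by (intro always_eventually allI) (meson order_trans)
  qed simp
  then have "norm2 D g \<le> d" using fin by (simp add: nn_integral_A2[OF gA] ennreal_le_iff)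
  with gA g show ?thesis by blast
qed

text \<open>The kernel is a multiple of the function of least norm among those with value \<open>1\<close> at \<open>y\<close>.\<close>
lemma A2_reproducing_exists:
  assumes J: "complex_structure J" and y: "y \<in> D"
  shows "\<exists>k\<in>A2 J D. \<forall>f\<in>A2 J D. f y = ip D f k"
proof (cases "\<forall>f\<in>A2 J D. f y = 0")
  \<comment> \<open>If all functions vanish at y, in particular if the space is zero, the zero
    function represents evaluation.\<close>
  case True
  then show ?thesis
    by (intro bexI[of _ "\<lambda>x. 0"]) (auto simp: ip_def)
next
  case False
  then obtain f1 where f1: "f1 \<in> A2 J D" "f1 y \<noteq> 0" by blast
  define C where "C = {f \<in> A2 J D. f y = 1}"
  have "(\<lambda>x. inverse (f1 y) * f1 x) \<in> C" using f1 by (simp add: C_def A2_cmult)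
  then have C_ne: "norm2 D ` C \<noteq> {}" by blast
  have bdd: "bdd_below (norm2 D ` C)" by (rule bdd_belowI[of _ 0]) (auto simp: norm2_nonneg)
  define d where "d = Inf (norm2 D ` C)"
  have d_le: "d \<le> norm2 D f" if "f \<in> C" for f
    unfolding d_def using bdd that by (intro cInf_lower) auto
  have "\<exists>f\<in>C. norm2 D f < d + 1 / real (Suc n)" for n
    using cInf_lessD[OF C_ne, of "d + 1 / real (Suc n)"] by (auto simp: d_def)
  then obtain F where F: "\<And>n. F n \<in> C" "\<And>n. norm2 D (F n) < d + 1 / real (Suc n)" by metis
  have FA: "F n \<in> A2 J D" for n using F(1)[of n] by (simp add: C_def)
  \<comment> \<open>The midpoint of two competitors is a competitor, so their sum has squared norm
    at least 4 d; the parallelogram law leaves only the excesses over d.\<close>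
  have parallelogram: "norm2 D (\<lambda>x. F m x - F n x) \<le> 2 / real (Suc m) + 2 / real (Suc n)" for m n
  proof -
    have eq1: "norm2 D (\<lambda>x. F m x - F n x) = norm2 D (F m) - 2 * Re (ip D (F n) (F m)) + norm2 D (F n)"
      using norm2_add_cmult[OF FA[of m] FA[of n], of "-1"] by simp
    have eq2: "norm2 D (\<lambda>x. F m x + F n x) = norm2 D (F m) + 2 * Re (ip D (F n) (F m)) + norm2 D (F n)"
      using norm2_add_cmult[OF FA[of m] FA[of n], of 1] by simp
    have "(\<lambda>x. 1/2 * (F m x + F n x)) \<in> C"
      using A2_cmult[OF A2_add[OF FA[of m] FA[of n]], of "1/2"] F(1)[of m] F(1)[of n] by (simp add: C_def)
    from d_le[OF this] have "4 * d \<le> norm2 D (\<lambda>x. F m x + F n x)"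
      by (simp add: norm2_def norm_divide norm_mult power_divide)
    then show ?thesis using eq1 eq2 F(2)[of m] F(2)[of n] by simp
  qed
  have "\<exists>g\<in>A2 J D. (\<forall>x\<in>D. (\<lambda>n. F n x) \<longlonglongrightarrow> g x) \<and> norm2 D g \<le> d"
  proof (rule A2_Cauchy_limit[OF J FA])
    fix e :: real assume "e > 0"
    then obtain N where N: "inverse (real (Suc N)) < e / 4" using reals_Archimedean[of "e/4"] by auto
    have "norm2 D (\<lambda>x. F m x - F n x) \<le> e" if "m \<ge> N" "n \<ge> N" for m n
    proof -
      have "1 / real (Suc m) \<le> inverse (real (Suc N))" "1 / real (Suc n) \<le> inverse (real (Suc N))"
        using that by (auto simp: field_simps)
      then show ?thesis using parallelogram[of m n] N by simp
    qed
    then show "\<exists>N. \<forall>m\<ge>N. \<forall>n\<ge>N. norm2 D (\<lambda>x. F m x - F n x) \<le> e" by blast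
  next
    show "norm2 D (F n) \<le> d + 1 / real (Suc n)" for n using F(2)[of n] by simp
    show "(\<lambda>n. 1 / real (Suc n)) \<longlonglongrightarrow> 0" by (rule LIMSEQ_Suc[OF lim_1_over_n])
  qed
  then obtain g where g: "g \<in> A2 J D" "\<And>x. x \<in> D \<Longrightarrow> (\<lambda>n. F n x) \<longlonglongrightarrow> g x" "norm2 D g \<le> d" by blast
  have "(\<lambda>n. F n y) \<longlonglongrightarrow> 1" using F(1) by (simp add: C_def)
  then have gy: "g y = 1" using g(2)[OF y] LIMSEQ_unique by blast
  have orth: "ip D h g = 0" if h: "h \<in> A2 J D" "h y = 0" for h
  proof (rule ccontr)
    assume p: "ip D h g \<noteq> 0"
    define p where "p = ip D h g"
    \<comment> \<open>With p the inner product of h and g, the step t = -\<epsilon> conj(p) changes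
      the squared norm by -2 \<epsilon> |p|^2 + \<epsilon>^2 |p|^2 |h|^2. Since \<epsilon> |h|^2 < 1
      the first term wins, contradicting minimality.\<close>
    define \<epsilon> where "\<epsilon> = 1 / (norm2 D h + 1)"
    have \<epsilon>: "\<epsilon> > 0" "\<epsilon> * norm2 D h < 1"
      using norm2_nonneg[of h] by (auto simp: \<epsilon>_def field_simps)
    define t where "t = - of_real \<epsilon> * cnj p"
    have "(\<lambda>x. g x + t * h x) \<in> C" using g h gy by (auto simp: C_def intro: A2_add A2_cmult)
    from d_le[OF this] g(3) have "0 \<le> 2 * Re (t * p) + (cmod t)\<^sup>2 * norm2 D h"
      by (simp add: norm2_add_cmult g(1) h(1) p_def)
    also have "t * p = - of_real (\<epsilon> * (cmod p)\<^sup>2)"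
      by (simp add: t_def complex_norm_square mult_ac del: of_real_power)
    also have "(cmod t)\<^sup>2 = \<epsilon>\<^sup>2 * (cmod p)\<^sup>2"
      by (simp add: t_def norm_mult power_mult_distrib)
    finally have "2 * (\<epsilon> * (cmod p)\<^sup>2) \<le> (\<epsilon> * norm2 D h) * (\<epsilon> * (cmod p)\<^sup>2)"
      by (simp add: power2_eq_square mult_ac)
    also have "\<dots> \<le> 1 * (\<epsilon> * (cmod p)\<^sup>2)" using \<epsilon> by (intro mult_right_mono) auto
    finally have "\<epsilon> * (cmod p)\<^sup>2 \<le> 0" by simp
    moreover have "\<epsilon> * (cmod p)\<^sup>2 > 0" using \<epsilon> p by (simp add: p_def)
    ultimately show False by simp
  qed
  obtain r where r: "r > 0" "ball y r \<subseteq> D" using D y open_contains_ball by blast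
  have "0 < measure lborel (ball y r)" by (rule content_ball_pos[OF r(1)])
  also have "\<dots> \<le> norm2 D g" using A2_eval_bound[OF J g(1) r(2)] gy by simp
  finally have "norm2 D g > 0" .
  \<comment> \<open>The function f - f(y) g vanishes at y, hence is orthogonal to g; dividing g by
    its squared norm turns this into the reproducing property.\<close>
  define k where "k x = of_real (1 / norm2 D g) * g x" for x
  have "f y = ip D f k" if f: "f \<in> A2 J D" for f
  proof -
    have fy: "(\<lambda>x. (- f y) * g x) \<in> A2 J D" using g by (intro A2_cmult)
    have "0 = ip D (\<lambda>x. f x + (- f y) * g x) g"
      using orth[OF A2_add[OF f fy]] gy by simp
    also have "\<dots> = ip D f g - f y * of_real (norm2 D g)"
      using ip_add_left[OF f fy g(1)] ip_cmult_left[of "- f y" g g] by (simp add: ip_self)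
    finally have "ip D f g = f y * of_real (norm2 D g)" by simp
    then show ?thesis using \<open>norm2 D g > 0\<close> unfolding k_def by (subst ip_cmult_right) simp
  qed
  moreover have "k \<in> A2 J D" unfolding k_def[abs_def] using g by (intro A2_cmult)
  ultimately show ?thesis by blast
qed

end

lemma A2_cong:
  assumes D: "open D" and eq: "\<And>x. x \<in> D \<Longrightarrow> f x = g x" and f: "f \<in> A2 J D"
  shows "g \<in> A2 J D"
proof -
  have "cholo_on J g D" using cholo_on_cong[OF D eq A2_cholo[OF D f]] by simp
  moreover have "(\<lambda>x. ennreal (indicator D x * (cmod (f x))\<^sup>2)) = (\<lambda>x. ennreal (indicator D x * (cmod (g x))\<^sup>2))"
    using eq by (auto simp: indicator_def)
  ultimately show ?thesis using f by (simp add: A2_iff_nn[OF D])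
qed

lemma ip_cong:
  assumes "\<And>x. x \<in> D \<Longrightarrow> f x = f' x" "\<And>x. x \<in> D \<Longrightarrow> g x = g' x"
  shows "ip D f g = ip D f' g'"
  unfolding ip_def set_lebesgue_integral_def
  by (intro Bochner_Integration.integral_cong) (auto simp: assms indicator_def)

context
  fixes D :: "'a::euclidean_space set" and J :: "'a \<Rightarrow> 'a"
  assumes D: "open D" and J: "complex_structure J"
begin

lemma ip_lebesgue:
  assumes "f \<in> A2 J D" "g \<in> A2 J D"
  shows "(LINT x:D|lebesgue. f x * cnj (g x)) = ip D f g"
  unfolding ip_def using assms A2_continuous[OF D]
  by (intro set_integral_lebesgue_eq_lborel[OF D] continuous_intros) auto

text \<open>Each representer is tested against the other. This one identity yields uniqueness of the
  kernel, its Hermitian symmetry and the criterion \<open>bergman_gen_eqI\<close>.\<close>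

lemma reproducing_kernels_agree:
  assumes "x \<in> D" "y \<in> D"
    and k: "k \<in> A2 J D" "\<And>f. f \<in> A2 J D \<Longrightarrow> f y = ip D f k"
    and l: "l \<in> A2 J D" "\<And>f. f \<in> A2 J D \<Longrightarrow> f x = ip D f l"
  shows "k x = cnj (l y)"
  using k(2)[OF l(1)] l(2)[OF k(1)] ip_cnj[OF D, of l k] by metis

text \<open>The definite description is meaningful once existence and uniqueness are shown.
  Reproduction fixes K on D x D, and the normalisation to 0 fixes it elsewhere.\<close>

lemma bergman_gen_spec:
  "(\<forall>x y. (x \<notin> D \<or> y \<notin> D) \<longrightarrow> bergman_gen J D x y = 0) \<and>
      (\<forall>y\<in>D. (\<lambda>x. bergman_gen J D x y) \<in> A2 J D \<and>
         (\<forall>f\<in>A2 J D. f y = (LINT x:D|lebesgue. f x * cnj (bergman_gen J D x y))))" (is "?P (bergman_gen J D)")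
proof -
  obtain k where k: "\<And>y. y \<in> D \<Longrightarrow> k y \<in> A2 J D" "\<And>y f. y \<in> D \<Longrightarrow> f \<in> A2 J D \<Longrightarrow> f y = ip D f (k y)"
    using A2_reproducing_exists[OF D J] by metis
  have "\<exists>!K. ?P K"
  proof (rule ex1I)
    let ?K = "\<lambda>x y. if x \<in> D \<and> y \<in> D then k y x else 0"
    have A: "(\<lambda>x. ?K x y) \<in> A2 J D" if "y \<in> D" for y
      using that by (intro A2_cong[OF D _ k(1)[OF that]]) auto
    have "f y = (LINT x:D|lebesgue. f x * cnj (?K x y))" if "y \<in> D" "f \<in> A2 J D" for f y
    proof -
      have "f y = ip D f (k y)" using k(2) that by blast
      also have "\<dots> = ip D f (\<lambda>x. ?K x y)" using that by (intro ip_cong) auto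
      finally show ?thesis using ip_lebesgue[OF that(2) A[OF that(1)]] by simp
    qed
    with A show "?P ?K" by auto
  next
    fix K assume K: "?P K"
    have "K x y = (if x \<in> D \<and> y \<in> D then k y x else 0)" for x y
    proof (cases "x \<in> D \<and> y \<in> D")
      case True
      have rep: "f y = ip D f (\<lambda>x. K x y)" if "f \<in> A2 J D" "y \<in> D" for f y
      proof -
        have "(\<lambda>x. K x y) \<in> A2 J D" "f y = (LINT x:D|lebesgue. f x * cnj (K x y))" using K that by blast+
        with ip_lebesgue[OF that(1)] show ?thesis by metis
      qed
      have "K x y = cnj (k x y)" "k y x = cnj (k x y)"
        using reproducing_kernels_agree[of x y "\<lambda>x. K x y" "k x"] reproducing_kernels_agree[of x y "k y" "k x"]
          True K rep k by auto
      then show ?thesis using True by simp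
    qed (use K in auto)
    then show "K = (\<lambda>x y. if x \<in> D \<and> y \<in> D then k y x else 0)" by blast
  qed
  from theI'[OF this] show ?thesis unfolding bergman_gen_def .
qed

lemma bergman_gen_outside: "x \<notin> D \<or> y \<notin> D \<Longrightarrow> bergman_gen J D x y = 0"
  using bergman_gen_spec by blast

lemma bergman_gen_A2: "y \<in> D \<Longrightarrow> (\<lambda>x. bergman_gen J D x y) \<in> A2 J D"
  using bergman_gen_spec by blast

lemma bergman_gen_reproducing:
  "y \<in> D \<Longrightarrow> f \<in> A2 J D \<Longrightarrow> f y = ip D f (\<lambda>x. bergman_gen J D x y)"
  using bergman_gen_spec ip_lebesgue[of f "\<lambda>x. bergman_gen J D x y"] bergman_gen_A2[of y] by auto

lemma bergman_gen_hermitian: "x \<in> D \<Longrightarrow> y \<in> D \<Longrightarrow> bergman_gen J D x y = cnj (bergman_gen J D y x)"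
  by (rule reproducing_kernels_agree[OF _ _ bergman_gen_A2 bergman_gen_reproducing bergman_gen_A2 bergman_gen_reproducing])

lemma bergman_gen_eqI:
  assumes "x \<in> D" "y \<in> D" "g \<in> A2 J D" "\<And>f. f \<in> A2 J D \<Longrightarrow> f y = ip D f g"
  shows "bergman_gen J D x y = g x"
  unfolding bergman_gen_hermitian[OF assms(1,2)]
  by (rule reproducing_kernels_agree[OF assms bergman_gen_A2 bergman_gen_reproducing, symmetric]) (use assms in auto)

end

section \<open>Change of variables and the transformation rule for kernels\<close>

lemma integral_transform:
  fixes \<Phi> :: "'a::euclidean_space \<Rightarrow> 'a" and w :: "'a \<Rightarrow> real" and g :: "'a \<Rightarrow> complex"
  assumes [measurable]: "\<Phi> \<in> borel_measurable borel" "w \<in> borel_measurable borel" "g \<in> borel_measurable borel"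
    and w: "\<And>x. w x \<ge> 0"
    and meas: "\<And>F :: 'a \<Rightarrow> ennreal. F \<in> borel_measurable borel \<Longrightarrow>
      (\<integral>\<^sup>+x. F (\<Phi> x) * ennreal (w x) \<partial>lborel) = (\<integral>\<^sup>+x. F x \<partial>lborel)"
  shows "(LINT x|lborel. g x) = (LINT x|lborel. w x *\<^sub>R g (\<Phi> x))"
proof -
  let ?M = "density lborel (\<lambda>x. ennreal (w x))"
  \<comment> \<open>The hypothesis on nonnegative functions, applied to indicators, says that \<Phi>
    carries the measure with density w to Lebesgue measure. Complex integrals then follow through
    the image measure.\<close>
  have "distr ?M borel \<Phi> = lborel"
  proof (rule measure_eqI)
    fix A assume "A \<in> sets (distr ?M borel \<Phi>)"
    then have [measurable]: "A \<in> sets borel" by simp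
    have "emeasure (distr ?M borel \<Phi>) A = (\<integral>\<^sup>+x. indicator A x \<partial>distr ?M borel \<Phi>)" by simp
    also have "\<dots> = (\<integral>\<^sup>+x. indicator A (\<Phi> x) \<partial>?M)" by (subst nn_integral_distr) auto
    also have "\<dots> = (\<integral>\<^sup>+x. indicator A (\<Phi> x) * ennreal (w x) \<partial>lborel)"
      by (subst nn_integral_density) (auto simp: mult.commute)
    also have "\<dots> = emeasure lborel A" by (subst meas) auto
    finally show "emeasure (distr ?M borel \<Phi>) A = emeasure lborel A" .
  qed simp
  then have "(LINT x|lborel. g x) = (LINT x|distr ?M borel \<Phi>. g x)" by simp
  also have "\<dots> = (LINT x|?M. g (\<Phi> x))" by (subst integral_distr) auto
  also have "\<dots> = (LINT x|lborel. w x *\<^sub>R g (\<Phi> x))" using w by (subst integral_density) auto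
  finally show ?thesis .
qed

text \<open>The map sending f to u times f o \<Phi> is unitary from A2 of D' onto A2 of D, and
  unitary maps carry reproducing kernels to reproducing kernels. Here u plays the complex Jacobian
  determinant, entering through \<open>jac\<close>, and u' its reciprocal on D'.\<close>

lemma bergman_gen_transform:
  fixes \<Phi> \<Psi> J :: "'a::euclidean_space \<Rightarrow> 'a"
  assumes J: "complex_structure J" and D: "open D" "open D'"
    and mem: "\<And>x. \<Phi> x \<in> D' \<longleftrightarrow> x \<in> D" "\<And>x. x \<in> D' \<Longrightarrow> \<Psi> x \<in> D"
    and inv: "\<And>x. x \<in> D \<Longrightarrow> \<Psi> (\<Phi> x) = x" 
    and meas [measurable]: "\<Phi> \<in> borel_measurable borel" "u \<in> borel_measurable borel"
    and d\<Phi>: "\<And>x. x \<in> D \<Longrightarrow> (\<Phi> has_derivative \<Phi>' x) (at x)" "\<And>x v. x \<in> D \<Longrightarrow> \<Phi>' x (J v) = J (\<Phi>' x v)"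
    and d\<Psi>: "\<And>x. x \<in> D' \<Longrightarrow> (\<Psi> has_derivative \<Psi>' x) (at x)" "\<And>x v. x \<in> D' \<Longrightarrow> \<Psi>' x (J v) = J (\<Psi>' x v)"
    and u: "cholo_on J u D" and u': "cholo_on J u' D'" and uu: "\<And>x. x \<in> D \<Longrightarrow> u x * u' (\<Phi> x) = 1"
    and jac: "\<And>F :: 'a \<Rightarrow> ennreal. F \<in> borel_measurable borel \<Longrightarrow>
      (\<integral>\<^sup>+x. F (\<Phi> x) * ennreal ((cmod (u x))\<^sup>2) \<partial>lborel) = (\<integral>\<^sup>+x. F x \<partial>lborel)"
    and xy: "x \<in> D" "y \<in> D"
  shows "bergman_gen J D x y = u x * bergman_gen J D' (\<Phi> x) (\<Phi> y) * cnj (u y)"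
proof -
  have ind: "indicator D' (\<Phi> x) = (indicator D x :: real)" for x by (simp add: indicator_def mem)
  have nn: "(\<integral>\<^sup>+x. ennreal (indicator D x * (cmod (u x * f (\<Phi> x)))\<^sup>2) \<partial>lborel) =
      (\<integral>\<^sup>+x. ennreal (indicator D' x * (cmod (f x))\<^sup>2) \<partial>lborel)" if "continuous_on D' f" for f
  proof -
    have "(\<lambda>x. indicator D' x *\<^sub>R (cmod (f x))\<^sup>2) \<in> borel_measurable borel"
      using that by (intro borel_measurable_on_open[OF D(2)] continuous_intros)
    then have "(\<lambda>x. ennreal (indicator D' x * (cmod (f x))\<^sup>2)) \<in> borel_measurable borel" by simp
    from jac[OF this] show ?thesis
      by (simp add: ind norm_mult power_mult_distrib ennreal_mult[symmetric] mult_ac)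
  qed
  have pull: "(\<lambda>x. u x * f (\<Phi> x)) \<in> A2 J D" if f: "f \<in> A2 J D'" for f
  proof -
    have "cholo_on J (\<lambda>x. u x * f (\<Phi> x)) D"
      by (intro cholo_on_mult u cholo_on_compose[OF A2_cholo[OF D(2) f], where \<Phi>' = \<Phi>']) (auto simp: d\<Phi> mem)
    then show ?thesis
      using f nn[OF A2_continuous[OF D(2) f]] by (simp add: A2_iff_nn[OF D(1)] A2_iff_nn[OF D(2)])
  qed
  have ip_pull: "ip D (\<lambda>x. u x * f (\<Phi> x)) (\<lambda>x. u x * g (\<Phi> x)) = ip D' f g"
    if "f \<in> A2 J D'" "g \<in> A2 J D'" for f g
  proof -
    have "(\<lambda>x. indicator D' x *\<^sub>R (f x * cnj (g x))) \<in> borel_measurable borel"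
      using that by (intro borel_measurable_on_open[OF D(2)] continuous_intros A2_continuous[OF D(2)])
    then have "ip D' f g = (LINT x|lborel. (cmod (u x))\<^sup>2 *\<^sub>R (indicator D' (\<Phi> x) *\<^sub>R (f (\<Phi> x) * cnj (g (\<Phi> x)))))"
      unfolding ip_def set_lebesgue_integral_def by (intro integral_transform jac) auto
    also have "\<dots> = ip D (\<lambda>x. u x * f (\<Phi> x)) (\<lambda>x. u x * g (\<Phi> x))"
      unfolding ip_def set_lebesgue_integral_def
      by (intro Bochner_Integration.integral_cong refl)
        (simp only: ind scaleR_conv_of_real complex_norm_square complex_cnj_mult, simp only: mult_ac)
    finally show ?thesis by simp
  qed
  let ?k = "\<lambda>z. bergman_gen J D' z (\<Phi> y)"
  have k: "?k \<in> A2 J D'" using xy mem by (intro bergman_gen_A2[OF D(2) J]) auto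
  define h where "h x = cnj (u y) * (u x * ?k (\<Phi> x))" for x
  have h: "h \<in> A2 J D" unfolding h_def[abs_def] by (intro A2_cmult[OF D(1)] pull k)
  have "f y = ip D f h" if f: "f \<in> A2 J D" for f
  proof -
    \<comment> \<open>The preimage of f under that unitary map; u' makes it holomorphic on
      D'.\<close>
    define g where "g x = u' x * f (\<Psi> x)" for x
    have ug: "u x * g (\<Phi> x) = f x" if "x \<in> D" for x
      using uu[OF that] inv[OF that] by (simp add: g_def mult.assoc[symmetric])
    have ch: "cholo_on J g D'"
      unfolding g_def[abs_def]
      by (intro cholo_on_mult u' cholo_on_compose[OF A2_cholo[OF D(1) f], where \<Phi>' = \<Psi>']) (auto simp: d\<Psi> mem)
    have "(\<lambda>x. ennreal (indicator D x * (cmod (u x * g (\<Phi> x)))\<^sup>2)) = (\<lambda>x. ennreal (indicator D x * (cmod (f x))\<^sup>2))"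
      by (rule ext) (simp add: indicator_def ug)
    then have g: "g \<in> A2 J D'"
      using f ch nn[OF cholo_on_imp_continuous_on[OF ch]]
      by (simp add: A2_iff_nn[OF D(1)] A2_iff_nn[OF D(2)])
    have "f y = u y * g (\<Phi> y)" using ug xy by simp
    also have "g (\<Phi> y) = ip D' g ?k"
      using xy mem by (intro bergman_gen_reproducing[OF D(2) J] g) auto
    also have "\<dots> = ip D (\<lambda>x. u x * g (\<Phi> x)) (\<lambda>x. u x * ?k (\<Phi> x))"
      using ip_pull[OF g k] by simp
    also have "\<dots> = ip D f (\<lambda>x. u x * ?k (\<Phi> x))" using ug by (intro ip_cong) auto
    also have "u y * \<dots> = ip D f h" unfolding h_def[abs_def] by (simp add: ip_cmult_right[OF D(1)])
    finally show ?thesis .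
  qed
  from bergman_gen_eqI[OF D(1) J xy h this] show ?thesis by (simp add: h_def mult_ac)
qed

section \<open>Scalings of the first coordinates\<close>

lemma norm_cmult_vec: "norm (c *s (x :: complex^'n)) = cmod c * norm x"
proof -
  have "(norm (c *s x))\<^sup>2 = (cmod c * norm x)\<^sup>2"
    unfolding norm_vec_def L2_set_def
    by (simp add: norm_mult power_mult_distrib sum_nonneg sum_distrib_left)
  then show ?thesis by (simp add: power2_eq_iff_nonneg)
qed

lemma complex_structure_vec: "complex_structure (\<lambda>v::complex^'n. \<i> *s v)"
  unfolding complex_structure_def
  by (auto simp: norm_cmult_vec vec_eq_iff algebra_simps intro!: linearI)

lemma complex_structure_prod: "complex_structure (\<lambda>(v::complex^'n, t::complex). (\<i> *s v, \<i> * t))"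
  unfolding complex_structure_def
  by (auto simp: norm_cmult_vec vec_eq_iff algebra_simps norm_Pair norm_mult intro!: linearI)

lemma cscale_vec: "cscale (\<lambda>v::complex^'n. \<i> *s v) \<mu> v = \<mu> *s v"
  by (auto simp: cscale_def vec_eq_iff complex_eq_iff)

lemma cscale_prod: "cscale (\<lambda>(v::complex^'n, t::complex). (\<i> *s v, \<i> * t)) \<mu> (v, t) = (\<mu> *s v, \<mu> * t)"
  by (auto simp: cscale_def vec_eq_iff complex_eq_iff)

lemma has_derivative_vecI:
  fixes f :: "'a::euclidean_space \<Rightarrow> complex^'n"
  assumes "\<And>j. ((\<lambda>x. f x $ j) has_derivative (\<lambda>h. f' h $ j)) (at a within A)"
  shows "(f has_derivative f') (at a within A)"
  unfolding has_derivative_componentwise_within[of f]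
proof
  fix i :: "complex^'n" assume "i \<in> Basis"
  then obtain j b where i: "i = axis j b" by (auto simp: Basis_vec_def)
  show "((\<lambda>x. f x \<bullet> i) has_derivative (\<lambda>x. f' x \<bullet> i)) (at a within A)"
    unfolding i inner_axis by (intro has_derivative_inner_left assms)
qed

definition coord_scale :: "'N \<Rightarrow> complex \<Rightarrow> 'N \<Rightarrow> complex" where
  "coord_scale j \<mu> i = (if i = j then \<mu> else 1)"

text \<open>The flow of the weighted Euler field sum of \<gamma> j x_j d/dx_j at complex time a.
  Time |w|^2 / 2 gives \<open>g_gamma\<close>, time w cnj \<eta> - |\<eta>|^2 gives
  \<open>l_map\<close>, and negative real times give the contractions behind T s.\<close>

definition expscale :: "'N set \<Rightarrow> ('N \<Rightarrow> real) \<Rightarrow> complex \<Rightarrow> complex^'N::finite \<Rightarrow> complex^'N" where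
  "expscale S \<gamma> a = dscale (\<lambda>j. if j \<in> S then exp (of_real (\<gamma> j) * a) else 1)"

lemma expscale_nth: "expscale S \<gamma> a x $ j = (if j \<in> S then exp (of_real (\<gamma> j) * a) * x $ j else x $ j)"
  by (simp add: expscale_def)

lemma expscale_add: "expscale S \<gamma> a (expscale S \<gamma> b x) = expscale S \<gamma> (a + b) x"
  by (simp add: vec_eq_iff expscale_nth exp_add ring_distribs)

lemma expscale_0 [simp]: "expscale S \<gamma> 0 x = x"
  by (simp add: vec_eq_iff expscale_nth)

lemma linear_expscale: "linear (expscale S \<gamma> a)"
  by (simp add: expscale_def linear_dscale)

lemma continuous_on_expscale [continuous_intros]:
  assumes "continuous_on A a" "continuous_on A f"
  shows "continuous_on A (\<lambda>p. expscale S \<gamma> (a p) (f p))"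
  unfolding expscale_def
proof (intro continuous_on_dscale)
  show "continuous_on A (\<lambda>p. if j \<in> S then exp (of_real (\<gamma> j) * a p) else 1)" for j
    using assms by (cases "j \<in> S") (auto intro!: continuous_intros)
qed fact

text \<open>The complex Jacobian is the product of the e^(\<gamma> j a), that is e^(G a) with G the
  sum of the \<gamma> j. Keeping it as the squared modulus of an exponential matches the holomorphic
  factor u of \<open>bergman_gen_transform\<close>.\<close>

lemma nn_integral_expscale:
  assumes "F \<in> borel_measurable borel"
  shows "(\<integral>\<^sup>+x. F (expscale S \<gamma> a x) * ennreal ((cmod (exp (of_real (sum \<gamma> S) * a)))\<^sup>2) \<partial>lborel) = (\<integral>\<^sup>+x. F x \<partial>lborel)"
proof -
  have "(\<Prod>j\<in>UNIV. (cmod (if j \<in> S then exp (of_real (\<gamma> j) * a) else 1))\<^sup>2) = (\<Prod>j\<in>S. (cmod (exp (of_real (\<gamma> j) * a)))\<^sup>2)"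
    by (rule prod.mono_neutral_cong_right) auto
  also have "\<dots> = (cmod (\<Prod>j\<in>S. exp (of_real (\<gamma> j) * a)))\<^sup>2"
    by (simp only: prod_power_distrib prod_norm[symmetric])
  also have "(\<Prod>j\<in>S. exp (of_real (\<gamma> j) * a)) = exp (of_real (sum \<gamma> S) * a)"
    by (simp add: exp_sum[symmetric] sum_distrib_right)
  finally show ?thesis
    using nn_integral_dscale[of "\<lambda>j. if j \<in> S then exp (of_real (\<gamma> j) * a) else 1" F] assms
    by (simp add: expscale_def)
qed

abbreviation JV :: "complex^'n \<Rightarrow> complex^'n" where "JV \<equiv> \<lambda>v. \<i> *s v"

abbreviation JP :: "(complex^'n) \<times> complex \<Rightarrow> (complex^'n) \<times> complex" where
  "JP \<equiv> \<lambda>(v, t). (\<i> *s v, \<i> * t)"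

locale hartogs =
  fixes S :: "'N::finite set" and \<gamma> :: "'N \<Rightarrow> real" and \<Omega> :: "(complex^'N) set"
  assumes open_\<Omega>: "open \<Omega>" and star: "star_hartogs S \<Omega>" and \<gamma>_pos: "\<And>j. j \<in> S \<Longrightarrow> \<gamma> j > 0"
    and S_ne: "S \<noteq> {}"
begin

lemma dscale_mem:
  assumes "x \<in> \<Omega>" "\<And>j. j \<in> S \<Longrightarrow> cmod (c j) \<le> 1" "\<And>j. j \<notin> S \<Longrightarrow> c j = 1"
  shows "dscale c x \<in> \<Omega>"
proof -
  have "dscale c x = (\<chi> j. if j \<in> S then c j * x $ j else x $ j)"
    using assms by (simp add: vec_eq_iff)
  then show ?thesis using star assms by (auto simp: star_hartogs_def)
qed

lemma expscale_mem: "x \<in> \<Omega> \<Longrightarrow> Re a \<le> 0 \<Longrightarrow> expscale S \<gamma> a x \<in> \<Omega>"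
  unfolding expscale_def by (rule dscale_mem) (auto simp: mult_nonneg_nonpos less_imp_le[OF \<gamma>_pos])

text \<open>Times with equal real part differ by an imaginary time, which only rotates coordinates
  and therefore preserves \<Omega> in both directions.\<close>

lemma expscale_mem_Re: 
  assumes "Re a = Re b"
  shows "expscale S \<gamma> a x \<in> \<Omega> \<longleftrightarrow> expscale S \<gamma> b x \<in> \<Omega>"
  using assms expscale_mem[of "expscale S \<gamma> a x" "b - a"] expscale_mem[of "expscale S \<gamma> b x" "a - b"]
  by (auto simp: expscale_add)

text \<open>Such a scaling maps \<Omega> into itself, so by change of variables the squared norm
  grows at most by the reciprocal of the Jacobian, which is positive because no factor is 0.\<close>

lemma A2_dscale:
  assumes f: "f \<in> A2 JV \<Omega>"
    and c: "\<And>j. j \<in> S \<Longrightarrow> cmod (c j) \<le> 1" "\<And>j. j \<notin> S \<Longrightarrow> c j = 1" "\<And>j. c j \<noteq> 0"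
  shows "(\<lambda>x. f (dscale c x)) \<in> A2 JV \<Omega>"
proof -
  have ch: "cholo_on JV (\<lambda>x. f (dscale c x)) \<Omega>"
    using c(1,2)
    by (intro cholo_on_compose[OF A2_cholo[OF open_\<Omega> f], where \<Phi>' = "\<lambda>_. dscale c"])
      (auto intro: dscale_mem simp: linear_imp_has_derivative linear_dscale dscale_smult)
  let ?h = "\<lambda>x. ennreal (indicator \<Omega> x * (cmod (f x))\<^sup>2)"
  let ?d = "\<Prod>j\<in>UNIV. (cmod (c j))\<^sup>2"
  have h: "?h \<in> borel_measurable borel"
  proof -
    have "(\<lambda>x. indicator \<Omega> x *\<^sub>R (cmod (f x))\<^sup>2) \<in> borel_measurable borel"
      by (intro borel_measurable_on_open[OF open_\<Omega>] continuous_intros A2_continuous[OF open_\<Omega> f])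
    then show ?thesis by simp
  qed
  have "?d > 0" using c(3) by (intro prod_pos) auto
  have "(\<integral>\<^sup>+x. ennreal (indicator \<Omega> x * (cmod (f (dscale c x)))\<^sup>2) \<partial>lborel) * ennreal ?d
      \<le> (\<integral>\<^sup>+x. ?h (dscale c x) \<partial>lborel) * ennreal ?d"
    using dscale_mem[OF _ c(1,2)] by (intro mult_right_mono nn_integral_mono) (auto simp: indicator_def)
  also have "\<dots> = (\<integral>\<^sup>+x. ?h (dscale c x) * ennreal ?d \<partial>lborel)"
    using measurable_compose[OF borel_measurable_dscale h]
    by (intro nn_integral_multc[symmetric]) simp
  also have "\<dots> = (\<integral>\<^sup>+x. ?h x \<partial>lborel)" by (rule nn_integral_dscale[OF c(3) h])
  also have "\<dots> < \<infinity>" using f by (simp add: A2_iff_nn[OF open_\<Omega>])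
  finally have "(\<integral>\<^sup>+x. ennreal (indicator \<Omega> x * (cmod (f (dscale c x)))\<^sup>2) \<partial>lborel) < \<infinity>"
    using \<open>?d > 0\<close> c(3) by (auto simp: ennreal_mult_less_top ennreal_mult_eq_top_iff less_top)
  with ch show ?thesis by (simp add: A2_iff_nn[OF open_\<Omega>])
qed

text \<open>On each orbit of the rotations of one coordinate this is the symmetry of the circle averages,
  so scaling that coordinate is self-adjoint.\<close>
lemma ip_coord_scale:
  assumes f: "f \<in> A2 JV \<Omega>" and g: "g \<in> A2 JV \<Omega>" and j: "j \<in> S" and c: "0 < c" "c \<le> 1"
  shows "ip \<Omega> (\<lambda>x. f (dscale (coord_scale j (of_real c)) x)) g = ip \<Omega> f (\<lambda>x. g (dscale (coord_scale j (of_real c)) x))"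
proof -
  let ?c = "dscale (coord_scale j (of_real c)) :: complex^'N \<Rightarrow> complex^'N"
  have fc: "(\<lambda>x. f (?c x)) \<in> A2 JV \<Omega>" and gc: "(\<lambda>x. g (?c x)) \<in> A2 JV \<Omega>"
    using j c by (auto intro!: A2_dscale f g simp: coord_scale_def split: if_splits)
  have rot: "dscale (coord_scale j (cis t)) x \<in> \<Omega>" if "x \<in> \<Omega>" for t x
    using j that by (intro dscale_mem) (auto simp: coord_scale_def)
  have coord_mult: "dscale (coord_scale j a) (dscale (coord_scale j b) x) = dscale (coord_scale j (a * b)) x" for a b x
    by (simp add: vec_eq_iff coord_scale_def)
  have coord_one: "dscale (coord_scale j 1) x = x" for x
    by (simp add: vec_eq_iff coord_scale_def)
  note cont = A2_continuous[OF open_\<Omega>]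
  show ?thesis
    unfolding ip_def
  proof (rule integral_cong_circle_averages[where R = "\<lambda>t. dscale (coord_scale j (cis t))"])
    show "linear (dscale (coord_scale j (cis t)))" for t by (rule linear_dscale)
    show "norm (dscale (coord_scale j (cis t)) x) = norm x" for t x
      by (rule norm_dscale_eq) (simp add: coord_scale_def)
    show "continuous_on UNIV (\<lambda>p. dscale (coord_scale j (cis (fst p))) (snd p))"
    proof (intro continuous_on_dscale continuous_intros)
      show "continuous_on UNIV (\<lambda>p::real \<times> (complex^'N). coord_scale j (cis (fst p)) i)" for i
        by (cases "i = j") (auto simp: coord_scale_def cis_conv_exp intro!: continuous_intros)
    qed
    show "open \<Omega>" by (rule open_\<Omega>)
    show "dscale (coord_scale j (cis t)) x \<in> \<Omega> \<longleftrightarrow> x \<in> \<Omega>" for t x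
    proof
      assume "dscale (coord_scale j (cis t)) x \<in> \<Omega>"
      from rot[OF this, of "-t"] show "x \<in> \<Omega>"
        by (simp add: coord_mult cis_mult coord_one)
    qed (rule rot)
    show "continuous_on \<Omega> (\<lambda>x. f (?c x) * cnj (g x))"
      by (intro continuous_intros cont[OF fc] cont[OF g])
    show "continuous_on \<Omega> (\<lambda>x. f x * cnj (g (?c x)))"
      by (intro continuous_intros cont[OF f] cont[OF gc])
    show "set_integrable lborel \<Omega> (\<lambda>x. f (?c x) * cnj (g x))"
      by (rule A2_integrable_mult[OF open_\<Omega> fc g])
    show "set_integrable lborel \<Omega> (\<lambda>x. f x * cnj (g (?c x)))"
      by (rule A2_integrable_mult[OF open_\<Omega> f gc])
    fix x assume x: "x \<in> \<Omega>"
    \<comment> \<open>Clearing the j-th coordinate exhibits the scaled points as a complex line x0 +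
      \<mu> x_j e_j, so f and g become one-variable functions near the closed unit disc.\<close>
    define x0 where "x0 = dscale (coord_scale j 0) x"
    have eq: "dscale (coord_scale j \<mu>) x = x0 + cscale JV \<mu> (axis j (x $ j))" for \<mu>
      by (auto simp: x0_def cscale_vec vec_eq_iff coord_scale_def axis_def)
    let ?A = "{\<mu>. dscale (coord_scale j \<mu>) x \<in> \<Omega>}"
    have "?A = (\<lambda>\<mu>. dscale (coord_scale j \<mu>) x) -` \<Omega>" by auto
    moreover have "continuous_on UNIV (\<lambda>\<mu>. dscale (coord_scale j \<mu>) x)"
      unfolding eq by (intro continuous_intros continuous_on_cscale complex_structure_vec)
    ultimately have A: "open ?A" using open_vimage[OF open_\<Omega>] by metis
    have hol: "(\<lambda>\<mu>. h (dscale (coord_scale j \<mu>) x)) holomorphic_on ?A" if "h \<in> A2 JV \<Omega>" for h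
    proof -
      have "(\<lambda>\<mu>. h (x0 + cscale JV \<mu> (axis j (x $ j)))) holomorphic_on ?A"
        using A2_cholo[OF open_\<Omega> that] A
        by (intro cholo_slice_holomorphic[OF complex_structure_vec]) (auto simp flip: eq)
      then show ?thesis by (simp flip: eq)
    qed
    have "cball 0 1 \<subseteq> ?A"
      using j x by (auto intro!: dscale_mem simp: coord_scale_def)
    from circle_average_symmetric[OF hol[OF f] hol[OF g] A this c]
    show "integral {0..2 * pi} (\<lambda>t. f (?c (dscale (coord_scale j (cis t)) x)) * cnj (g (dscale (coord_scale j (cis t)) x))) =
        integral {0..2 * pi} (\<lambda>t. f (dscale (coord_scale j (cis t)) x) * cnj (g (?c (dscale (coord_scale j (cis t)) x))))"
      by (simp add: coord_mult)
  qed
qed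

text \<open>The coordinates are moved across one at a time. Diagonal maps commute, so the order in
  which the factors arrive on the right is immaterial; the two forms of \<open>eq\<close> record
  this.\<close>

lemma ip_dscale_partial:
  assumes r: "\<And>j. j \<in> S \<Longrightarrow> 0 < r j \<and> r j \<le> 1" and "finite A" "A \<subseteq> S"
    and "f \<in> A2 JV \<Omega>" "g \<in> A2 JV \<Omega>"
  shows "ip \<Omega> (\<lambda>x. f (dscale (\<lambda>i. if i \<in> A then of_real (r i) else 1) x)) g =
         ip \<Omega> f (\<lambda>x. g (dscale (\<lambda>i. if i \<in> A then of_real (r i) else 1) x))"
  using assms(2-)
proof (induction A arbitrary: f g rule: finite_induct)
  case (insert j A)
  let ?A = "dscale (\<lambda>i. if i \<in> A then complex_of_real (r i) else 1)"
  let ?j = "dscale (coord_scale j (complex_of_real (r j)))"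
  have eq: "dscale (\<lambda>i. if i \<in> insert j A then of_real (r i) else 1) x = ?A (?j x)"
    "dscale (\<lambda>i. if i \<in> insert j A then of_real (r i) else 1) x = ?j (?A x)" for x
    using insert by (auto simp: vec_eq_iff coord_scale_def)
  have r_nz: "r i \<noteq> 0" if "i \<in> S" for i using r[OF that] by simp
  have fA: "(\<lambda>x. f (?A x)) \<in> A2 JV \<Omega>" and gj: "(\<lambda>x. g (?j x)) \<in> A2 JV \<Omega>"
    using insert.prems r r_nz by (auto intro!: A2_dscale simp: coord_scale_def less_imp_le split: if_splits)
  have "ip \<Omega> (\<lambda>x. f (?A (?j x))) g = ip \<Omega> (\<lambda>x. f (?A x)) (\<lambda>x. g (?j x))"
    using ip_coord_scale[OF fA insert.prems(3), of j "r j"] insert.prems r by auto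
  also have "\<dots> = ip \<Omega> f (\<lambda>x. g (?j (?A x)))"
    using insert.IH[OF _ insert.prems(2) gj] insert.prems by simp
  finally show ?case unfolding eq(1)[symmetric] eq(2)[symmetric] .
qed simp

lemma A2_expscale:
  assumes "f \<in> A2 JV \<Omega>" "Re a \<le> 0"
  shows "(\<lambda>x. f (expscale S \<gamma> a x)) \<in> A2 JV \<Omega>"
  unfolding expscale_def using assms
  by (intro A2_dscale) (auto simp: mult_nonneg_nonpos less_imp_le[OF \<gamma>_pos])

lemma ip_expscale:
  assumes "f \<in> A2 JV \<Omega>" "g \<in> A2 JV \<Omega>" "s \<le> 0"
  shows "ip \<Omega> (\<lambda>x. f (expscale S \<gamma> (of_real s) x)) g = ip \<Omega> f (\<lambda>x. g (expscale S \<gamma> (of_real s) x))"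
proof -
  have "expscale S \<gamma> (of_real s) = dscale (\<lambda>i. if i \<in> S then of_real (exp (\<gamma> i * s)) else 1)"
    by (simp add: expscale_def exp_of_real[symmetric] cong: if_cong)
  then show ?thesis
    using ip_dscale_partial[of "\<lambda>i. exp (\<gamma> i * s)" S f g] assms \<gamma>_pos
    by (auto simp: mult_nonneg_nonpos less_imp_le)
qed

end

section \<open>Integration in the variable \<open>w\<close>\<close>

lemma nn_integral_complex_affine:
  fixes F :: "complex \<Rightarrow> ennreal"
  assumes \<omega>: "cmod \<omega> = 1" and [measurable]: "F \<in> borel_measurable borel"
  shows "(\<integral>\<^sup>+w. F (\<omega> * w + b) \<partial>lborel) = (\<integral>\<^sup>+w. F w \<partial>lborel)"
proof -
  have lin: "linear ((*) \<omega>)" by (rule linearI) (auto simp: algebra_simps)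
  have "(\<integral>\<^sup>+w. F w \<partial>lborel) = (\<integral>\<^sup>+w. F (b + w) \<partial>lborel)"
    by (simp add: nn_integral_lborel_translate)
  also have "\<dots> = (\<integral>\<^sup>+w. F (b + w) \<partial>distr lborel borel ((*) \<omega>))"
    using lborel_distr_linear_isometry[OF lin] by (simp add: norm_mult \<omega>)
  also have "\<dots> = (\<integral>\<^sup>+w. F (\<omega> * w + b) \<partial>lborel)"
    by (subst nn_integral_distr) (auto simp: add.commute)
  finally show ?thesis by simp
qed

text \<open>The disc |w|^2 \<le> a has area pi a, so the two measures agree on half-lines, which
  generate the Borel sets. The factor pi of the kernel formula originates here.\<close>

lemma distr_norm_square_complex:
  "distr lborel borel (\<lambda>w::complex. (cmod w)\<^sup>2) = density lborel (\<lambda>s. ennreal (pi * indicator {0..} s))"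
proof (rule measure_eqI_generator_eq[where E = "range (\<lambda>a::real. {..a})" and \<Omega> = UNIV and A = "\<lambda>i::nat. {..real i}"])
  show "Int_stable (range (\<lambda>a::real. {..a}))"
  proof (rule Int_stableI)
    fix X Y :: "real set" assume "X \<in> range atMost" "Y \<in> range atMost"
    then obtain a b where "X = {..a}" "Y = {..b}" by blast
    then have "X \<inter> Y = {..min a b}" by auto
    then show "X \<inter> Y \<in> range atMost" by blast
  qed
  have left: "emeasure (distr lborel borel (\<lambda>w::complex. (cmod w)\<^sup>2)) {..a} = ennreal (pi * max 0 a)" for a
  proof -
    have "emeasure (distr lborel borel (\<lambda>w::complex. (cmod w)\<^sup>2)) {..a} = emeasure lborel {w::complex. (cmod w)\<^sup>2 \<le> a}"
      by (subst emeasure_distr) (auto simp: vimage_def)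
    also have "\<dots> = ennreal (pi * max 0 a)"
    proof (cases "a \<ge> 0")
      case True
      then have "{w::complex. (cmod w)\<^sup>2 \<le> a} = cball 0 (sqrt a)"
        by (auto simp: real_le_rsqrt sqrt_le_D real_sqrt_le_iff) (metis norm_ge_zero real_le_lsqrt real_sqrt_pow2 power_mono)
      with True show ?thesis by (simp add: emeasure_cball unit_ball_vol_2)
    next
      case False
      then have "{w::complex. (cmod w)\<^sup>2 \<le> a} = {}"
        by (auto simp: not_le intro: less_le_trans)
      with False show ?thesis by simp
    qed
    finally show ?thesis .
  qed
  have right: "emeasure (density lborel (\<lambda>s. ennreal (pi * indicator {0..} s))) {..a} = ennreal (pi * max 0 a)" for a
  proof -
    have "emeasure (density lborel (\<lambda>s. ennreal (pi * indicator {0..} s))) {..a} =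
        (\<integral>\<^sup>+s. ennreal (pi * indicator {0..} s) * indicator {..a} s \<partial>lborel)"
      by (subst emeasure_density) auto
    also have "\<dots> = (\<integral>\<^sup>+s. ennreal pi * indicator {0..a} s \<partial>lborel)"
      by (intro nn_integral_cong) (auto simp: indicator_def)
    also have "\<dots> = ennreal pi * emeasure lborel {0..a}"
      by (subst nn_integral_cmult) auto
    also have "\<dots> = ennreal (pi * max 0 a)"
      by (cases "a \<ge> 0") (auto simp: ennreal_mult)
    finally show ?thesis .
  qed
  show "emeasure (distr lborel borel (\<lambda>w::complex. (cmod w)\<^sup>2)) X =
      emeasure (density lborel (\<lambda>s. ennreal (pi * indicator {0..} s))) X" if "X \<in> range (\<lambda>a::real. {..a})" for X
    using that left right by auto
  show "emeasure (distr lborel borel (\<lambda>w::complex. (cmod w)\<^sup>2)) {..real i} \<noteq> \<infinity>" for i :: nat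
    by (simp add: left)
  show "(\<Union>i::nat. {..real i}) = UNIV" using real_arch_simple by auto
qed (auto simp: borel_eq_atMost)

lemma integral_radial_complex:
  fixes \<phi> :: "real \<Rightarrow> complex"
  assumes [measurable]: "\<phi> \<in> borel_measurable borel"
  shows "(LINT w|lborel. \<phi> ((cmod w)\<^sup>2)) = of_real pi * (LINT s:{0..}|lborel. \<phi> s)"
proof -
  have "(LINT w|lborel. \<phi> ((cmod w)\<^sup>2)) = (LINT s|distr lborel borel (\<lambda>w::complex. (cmod w)\<^sup>2). \<phi> s)"
    by (subst integral_distr) auto
  also have "\<dots> = (LINT s|lborel. (pi * indicator {0..} s) *\<^sub>R \<phi> s)"
    unfolding distr_norm_square_complex by (subst integral_density) auto
  also have "\<dots> = of_real pi * (LINT s:{0..}|lborel. \<phi> s)"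
    unfolding set_lebesgue_integral_def by (simp add: scaleR_conv_of_real mult.assoc)
  finally show ?thesis .
qed

lemma nn_integral_radial_complex:
  fixes \<phi> :: "real \<Rightarrow> ennreal"
  assumes [measurable]: "\<phi> \<in> borel_measurable borel"
  shows "(\<integral>\<^sup>+w. \<phi> ((cmod w)\<^sup>2) \<partial>(lborel :: complex measure)) = (\<integral>\<^sup>+s. ennreal (pi * indicator {0..} s) * \<phi> s \<partial>lborel)"
proof -
  have "(\<integral>\<^sup>+w. \<phi> ((cmod w)\<^sup>2) \<partial>(lborel :: complex measure)) = (\<integral>\<^sup>+s. \<phi> s \<partial>distr lborel borel (\<lambda>w::complex. (cmod w)\<^sup>2))"
    by (subst nn_integral_distr) auto
  then show ?thesis
    unfolding distr_norm_square_complex by (simp add: nn_integral_density)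
qed

text \<open>For suitable parameters these are automorphisms of the Hartogs domain: the rotations of \<open>w\<close>,
  and Heisenberg-type shifts moving the fibre over \<open>\<eta>\<close> to the fibre over \<open>0\<close>.\<close>
definition vaff :: "'N set \<Rightarrow> ('N \<Rightarrow> real) \<Rightarrow> complex \<Rightarrow> complex \<Rightarrow> complex \<Rightarrow> complex \<Rightarrow>
    (complex^'N::finite) \<times> complex \<Rightarrow> (complex^'N) \<times> complex" where
  "vaff S \<gamma> p q \<omega> b = (\<lambda>(x, w). (expscale S \<gamma> (p * w + q) x, \<omega> * w + b))"

definition vaff_deriv :: "'N set \<Rightarrow> ('N \<Rightarrow> real) \<Rightarrow> complex \<Rightarrow> complex \<Rightarrow> complex \<Rightarrow>
    (complex^'N::finite) \<times> complex \<Rightarrow> (complex^'N) \<times> complex \<Rightarrow> (complex^'N) \<times> complex" where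
  "vaff_deriv S \<gamma> p q \<omega> = (\<lambda>(x, w) (h, k).
    (\<chi> j. if j \<in> S then exp (of_real (\<gamma> j) * (p * w + q)) * (h $ j + of_real (\<gamma> j) * (p * k) * x $ j) else h $ j, \<omega> * k))"

lemma has_derivative_exp_complex:
  fixes g :: "'a::real_normed_vector \<Rightarrow> complex"
  assumes "(g has_derivative g') (at x within A)"
  shows "((\<lambda>x. exp (g x)) has_derivative (\<lambda>h. exp (g x) * g' h)) (at x within A)"
  using has_derivative_compose[OF assms DERIV_exp[THEN has_field_derivative_imp_has_derivative]] .

lemma has_derivative_vaff: "(vaff S \<gamma> p q \<omega> b has_derivative vaff_deriv S \<gamma> p q \<omega> z) (at z)"
proof -
  obtain x w where z: "z = (x, w)" by fastforce
  have nth: "((\<lambda>y. fst y $ j) has_derivative (\<lambda>h. fst h $ j)) (at z)" for j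
    by (intro bounded_linear.has_derivative[OF bounded_linear_vec_nth] derivative_intros)
  have "((\<lambda>y. expscale S \<gamma> (p * snd y + q) (fst y)) has_derivative
      (\<lambda>h. \<chi> j. if j \<in> S then exp (of_real (\<gamma> j) * (p * w + q)) * (fst h $ j + of_real (\<gamma> j) * (p * snd h) * x $ j) else fst h $ j)) (at z)"
  proof (rule has_derivative_vecI)
    fix j
    show "((\<lambda>y. expscale S \<gamma> (p * snd y + q) (fst y) $ j) has_derivative (\<lambda>h. (\<chi> j. if j \<in> S then exp (of_real (\<gamma> j) * (p * w + q)) *
        (fst h $ j + of_real (\<gamma> j) * (p * snd h) * x $ j) else fst h $ j) $ j)) (at z)"
    proof (cases "j \<in> S")
      case True
      have "((\<lambda>y. exp (of_real (\<gamma> j) * (p * snd y + q)) * fst y $ j) has_derivative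
        (\<lambda>h. exp (of_real (\<gamma> j) * (p * w + q)) * (fst h $ j + of_real (\<gamma> j) * (p * snd h) * x $ j))) (at z)"
      proof (rule has_derivative_eq_rhs[OF has_derivative_mult[OF has_derivative_exp_complex nth]])
        show "((\<lambda>y. of_real (\<gamma> j) * (p * snd y + q)) has_derivative (\<lambda>h. of_real (\<gamma> j) * (p * snd h))) (at z)"
          by (auto intro!: derivative_eq_intros)
      qed (auto simp: z algebra_simps)
      then show ?thesis using True by (simp add: expscale_nth)
    next
      case False then show ?thesis using nth by (simp add: expscale_nth)
    qed
  qed
  moreover have "((\<lambda>y. \<omega> * snd y + b) has_derivative (\<lambda>h. \<omega> * snd h)) (at z)"
    by (auto intro!: derivative_eq_intros)
  ultimately have "((\<lambda>y. (expscale S \<gamma> (p * snd y + q) (fst y), \<omega> * snd y + b)) has_derivative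
      (\<lambda>h. (\<chi> j. if j \<in> S then exp (of_real (\<gamma> j) * (p * w + q)) * (fst h $ j + of_real (\<gamma> j) * (p * snd h) * x $ j) else fst h $ j, \<omega> * snd h))) (at z)"
    by (rule has_derivative_Pair)
  then show ?thesis unfolding vaff_def vaff_deriv_def z case_prod_beta' fst_conv snd_conv .
qed

lemma vaff_deriv_JP: "vaff_deriv S \<gamma> p q \<omega> z (JP v) = JP (vaff_deriv S \<gamma> p q \<omega> z v)"
  by (cases z; cases v) (auto simp: vaff_deriv_def vec_eq_iff algebra_simps)

lemma continuous_on_vaff: "continuous_on A (vaff S \<gamma> p q \<omega> b)"
  unfolding vaff_def case_prod_beta' by (intro continuous_intros)

lemma cholo_on_exp_snd: "cholo_on JP (\<lambda>z. exp (c * (p * snd z + q))) D"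
  unfolding cholo_on_def
proof
  fix z :: "(complex^'n) \<times> complex"
  have "((\<lambda>z. exp (c * (p * snd z + q))) has_derivative (\<lambda>h. exp (c * (p * snd z + q)) * (c * (p * snd h)))) (at z)"
    by (rule has_derivative_exp_complex) (auto intro!: derivative_eq_intros)
  moreover have "\<forall>v :: (complex^'n) \<times> complex. exp (c * (p * snd z + q)) * (c * (p * snd (JP v))) = \<i> * (exp (c * (p * snd z + q)) * (c * (p * snd v)))"
    by auto
  ultimately show "\<exists>L. ((\<lambda>z. exp (c * (p * snd z + q))) has_derivative L) (at z) \<and> (\<forall>v. L (JP v) = \<i> * L v)"
    by blast
qed

text \<open>For fixed w the first component is a diagonal scaling whose Jacobian depends on w alone,
  while w itself undergoes a rigid motion. So the x-integral is done first and the w-integral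
  afterwards.\<close>

lemma nn_integral_vaff:
  assumes \<omega>: "cmod \<omega> = 1" and F[measurable]: "F \<in> borel_measurable borel"
  shows "(\<integral>\<^sup>+z. F (vaff S \<gamma> p q \<omega> b z) * ennreal ((cmod (exp (of_real (sum \<gamma> S) * (p * snd z + q))))\<^sup>2) \<partial>lborel) = (\<integral>\<^sup>+z. F z \<partial>lborel)"
proof -
  have [measurable]: "vaff S \<gamma> p q \<omega> b \<in> borel_measurable borel"
    by (intro borel_measurable_continuous_onI continuous_on_vaff)
  have slice: "(\<lambda>x. F (x, w)) \<in> borel_measurable borel" for w
    by (rule measurable_compose[OF _ F]) (intro borel_measurable_continuous_onI continuous_intros)
  have Fprod: "F \<in> borel_measurable (lborel \<Otimes>\<^sub>M lborel)" using F by (simp add: lborel_prod)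
  let ?H = "\<lambda>z. F (vaff S \<gamma> p q \<omega> b z) * ennreal ((cmod (exp (of_real (sum \<gamma> S) * (p * snd z + q))))\<^sup>2)"
  have "(\<lambda>z. (cmod (exp (of_real (sum \<gamma> S) * (p * snd z + q))))\<^sup>2) \<in> borel_measurable (borel :: ((complex^'a) \<times> complex) measure)"
    by (intro borel_measurable_continuous_onI continuous_intros)
  then have "?H \<in> borel_measurable borel" by measurable
  then have Hprod: "?H \<in> borel_measurable (lborel \<Otimes>\<^sub>M lborel)" by (simp add: lborel_prod)
  have "(\<integral>\<^sup>+z. ?H z \<partial>lborel) = (\<integral>\<^sup>+w. \<integral>\<^sup>+x. ?H (x, w) \<partial>lborel \<partial>lborel)"
    using lborel_pair.nn_integral_snd[OF Hprod] by (simp add: lborel_prod)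
  also have "\<dots> = (\<integral>\<^sup>+w. (\<integral>\<^sup>+x. F (x, \<omega> * w + b) \<partial>lborel) \<partial>lborel)"
    by (simp only: vaff_def prod.case snd_conv nn_integral_expscale[OF slice])
  also have "\<dots> = (\<integral>\<^sup>+w. \<integral>\<^sup>+x. F (x, w) \<partial>lborel \<partial>lborel)"
  proof (rule nn_integral_complex_affine[OF \<omega>])
    show "(\<lambda>w. \<integral>\<^sup>+x. F (x, w) \<partial>lborel) \<in> borel_measurable borel"
    proof -
      have "(\<lambda>z. F (snd z, fst z)) \<in> borel_measurable borel"
        by (rule measurable_compose[OF _ F]) (intro borel_measurable_continuous_onI continuous_intros)
      then have "(\<lambda>(w, x). F (x, w)) \<in> borel_measurable (lborel \<Otimes>\<^sub>M lborel)"
        by (simp add: lborel_prod case_prod_beta')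
      from lborel.borel_measurable_nn_integral[OF this] show ?thesis by simp
    qed
  qed
  also have "\<dots> = (\<integral>\<^sup>+z. F z \<partial>lborel)"
    using lborel_pair.nn_integral_snd[OF Fprod] by (simp add: lborel_prod)
  finally show ?thesis .
qed

section \<open>Symmetries of \<open>V\<close> and of its kernel\<close>

context hartogs
begin

abbreviation V :: "((complex^'N) \<times> complex) set" where "V \<equiv> V_gamma S \<gamma> \<Omega>"

abbreviation G :: real where "G \<equiv> sum \<gamma> S"

lemma g_gamma_eq: "g_gamma S \<gamma> x w = expscale S \<gamma> (of_real ((cmod w)\<^sup>2 / 2)) x"
  by (simp add: g_gamma_def vec_eq_iff expscale_nth)

lemma mem_V: "(x, w) \<in> V \<longleftrightarrow> expscale S \<gamma> (of_real ((cmod w)\<^sup>2 / 2)) x \<in> \<Omega>"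
  by (simp add: V_gamma_def g_gamma_eq)

lemma open_V: "open V"
proof -
  have "V = (\<lambda>z. expscale S \<gamma> (of_real ((cmod (snd z))\<^sup>2 / 2)) (fst z)) -` \<Omega>"
    using mem_V by auto
  moreover have "open \<dots>"
    by (intro open_vimage open_\<Omega> continuous_intros) auto
  ultimately show ?thesis by simp
qed

lemma mem_V_0: "(x, 0) \<in> V \<longleftrightarrow> x \<in> \<Omega>"
  by (simp add: mem_V)

lemma mem_V_mono:
  assumes "(x, w) \<in> V" "cmod v \<le> cmod w"
  shows "(x, v) \<in> V"
proof -
  have "(cmod v)\<^sup>2 \<le> (cmod w)\<^sup>2" using assms by (intro power_mono) auto
  then show ?thesis
    using assms expscale_mem[of "expscale S \<gamma> (of_real ((cmod w)\<^sup>2 / 2)) x" "of_real ((cmod v)\<^sup>2 / 2 - (cmod w)\<^sup>2 / 2)"]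
    by (simp add: mem_V expscale_add)
qed

lemma mem_V_base: "(x, w) \<in> V \<Longrightarrow> x \<in> \<Omega>"
  using mem_V_mono[of x w 0] by (simp add: mem_V_0)

text \<open>A point belongs to V when flowing x for time |w|^2 / 2 lands in \<Omega>. The hypothesis
  says that the total flow time at the image has the same real part, and only that part decides
  membership.\<close>

lemma vaff_mem_V:
  assumes "\<And>w. (cmod (\<omega> * w + b))\<^sup>2 / 2 + Re (p * w + q) = (cmod w)\<^sup>2 / 2"
  shows "vaff S \<gamma> p q \<omega> b z \<in> V \<longleftrightarrow> z \<in> V"
proof (cases z)
  case (Pair x w)
  have "Re (of_real ((cmod (\<omega> * w + b))\<^sup>2 / 2) + (p * w + q)) = Re (of_real ((cmod w)\<^sup>2 / 2))"
    using assms[of w] by simp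
  from expscale_mem_Re[OF this] show ?thesis
    by (simp add: Pair vaff_def mem_V expscale_add)
qed

lemma bergman_prod_vaff:
  assumes \<omega>: "cmod \<omega> = 1"
    and pq: "\<And>w. (cmod (\<omega> * w + b))\<^sup>2 / 2 + Re (p * w + q) = (cmod w)\<^sup>2 / 2"
    and z: "z \<in> V" "z' \<in> V"
  shows "bergman_prod V z z' = exp (of_real G * (p * snd z + q)) *
    bergman_prod V (vaff S \<gamma> p q \<omega> b z) (vaff S \<gamma> p q \<omega> b z') * cnj (exp (of_real G * (p * snd z' + q)))"
  unfolding bergman_prod_def
\<comment> \<open>The inverse parameters come from solving v = \<omega> w + b as w = cnj \<omega> (v
  - b) and expanding -(p w + q) in terms of v.\<close>
proof (rule bergman_gen_transform[where \<Phi>' = "vaff_deriv S \<gamma> p q \<omega>"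
      and \<Psi> = "vaff S \<gamma> (- p * cnj \<omega>) (p * cnj \<omega> * b - q) (cnj \<omega>) (- cnj \<omega> * b)"
      and \<Psi>' = "vaff_deriv S \<gamma> (- p * cnj \<omega>) (p * cnj \<omega> * b - q) (cnj \<omega>)"
      and u' = "\<lambda>z. exp (of_real G * ((- p * cnj \<omega>) * snd z + (p * cnj \<omega> * b - q)))"])
  have \<omega>\<omega>: "cnj \<omega> * \<omega> = 1" "\<omega> * cnj \<omega> = 1"
    using \<omega> complex_norm_square[of \<omega>] by (simp_all add: mult.commute)
  have cancel: "cnj \<omega> * (\<omega> * t) = t" "\<omega> * (cnj \<omega> * t) = t" for t
    using \<omega>\<omega> by (metis mult.assoc mult_1)+
  show "complex_structure JP" by (rule complex_structure_prod)
  show "open V" "open V" by (rule open_V)+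
  show mem: "vaff S \<gamma> p q \<omega> b z \<in> V \<longleftrightarrow> z \<in> V" for z by (rule vaff_mem_V[OF pq])
  show inv: "vaff S \<gamma> (- p * cnj \<omega>) (p * cnj \<omega> * b - q) (cnj \<omega>) (- cnj \<omega> * b) (vaff S \<gamma> p q \<omega> b z) = z" for z
    by (cases z) (simp add: vaff_def expscale_add ring_distribs mult.assoc cancel)
  have inv': "vaff S \<gamma> p q \<omega> b (vaff S \<gamma> (- p * cnj \<omega>) (p * cnj \<omega> * b - q) (cnj \<omega>) (- cnj \<omega> * b) z) = z" for z
    by (cases z) (simp add: vaff_def expscale_add ring_distribs mult.assoc cancel)
  show "vaff S \<gamma> (- p * cnj \<omega>) (p * cnj \<omega> * b - q) (cnj \<omega>) (- cnj \<omega> * b) z \<in> V" if "z \<in> V" for z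
    using mem[of "vaff S \<gamma> (- p * cnj \<omega>) (p * cnj \<omega> * b - q) (cnj \<omega>) (- cnj \<omega> * b) z"] that
    by (simp only: inv')
  show "vaff S \<gamma> p q \<omega> b \<in> borel_measurable borel"
    by (intro borel_measurable_continuous_onI continuous_on_vaff)
  show "(\<lambda>z. exp (of_real G * (p * snd z + q))) \<in> borel_measurable borel"
    by (intro borel_measurable_continuous_onI continuous_intros)
  show "exp (of_real G * (p * snd z + q)) * exp (of_real G * ((- p * cnj \<omega>) * snd (vaff S \<gamma> p q \<omega> b z) + (p * cnj \<omega> * b - q))) = 1" for z
    by (cases z) (simp add: vaff_def ring_distribs mult.assoc cancel flip: exp_add)
  show "(\<integral>\<^sup>+z. F (vaff S \<gamma> p q \<omega> b z) * ennreal ((cmod (exp (of_real G * (p * snd z + q))))\<^sup>2) \<partial>lborel) = (\<integral>\<^sup>+z. F z \<partial>lborel)"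
    if "F \<in> borel_measurable borel" for F :: "(complex^'N) \<times> complex \<Rightarrow> ennreal"
    by (rule nn_integral_vaff[OF \<omega> that])
qed (rule z has_derivative_vaff vaff_deriv_JP cholo_on_exp_snd)+

text \<open>Rotations of w fix (\<zeta>, 0), so the kernel is constant on the circle |\<mu>| = 1 in
  the disc of points (x, \<mu> w). It is holomorphic across that closed disc, and the mean value
  property identifies the constant with the value at the centre.\<close>

lemma bergman_prod_indep:
  assumes x: "(x, w) \<in> V" and \<zeta>: "\<zeta> \<in> \<Omega>"
  shows "bergman_prod V (x, w) (\<zeta>, 0) = bergman_prod V (x, 0) (\<zeta>, 0)"
proof -
  let ?u = "\<lambda>\<mu>. bergman_prod V (x, \<mu> * w) (\<zeta>, 0)"
  have rot: "?u (cis t) = bergman_prod V (x, w) (\<zeta>, 0)" for t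
    using bergman_prod_vaff[of "cis t" 0 0 0 "(x, w)" "(\<zeta>, 0)"] x \<zeta>
    by (simp add: vaff_def mem_V_0 norm_mult)
  let ?A = "{\<mu>. (x, \<mu> * w) \<in> V}"
  have "?A = (\<lambda>\<mu>. (x, \<mu> * w)) -` V" by auto
  then have A: "open ?A" by (simp add: open_vimage open_V continuous_intros)
  have "(\<lambda>z. bergman_prod V z (\<zeta>, 0)) \<in> A2 JP V"
    unfolding bergman_prod_def using \<zeta> by (intro bergman_gen_A2 open_V complex_structure_prod) (simp add: mem_V_0)
  then have ch: "cholo_on JP (\<lambda>z. bergman_prod V z (\<zeta>, 0)) V" by (rule A2_cholo[OF open_V])
  have "(\<lambda>\<mu>. bergman_prod V ((x, 0) + cscale JP \<mu> (0, w)) (\<zeta>, 0)) holomorphic_on ?A"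
    using A by (intro cholo_slice_holomorphic[OF complex_structure_prod ch]) (auto simp: cscale_prod)
  then have hol: "?u holomorphic_on ?A" by (simp add: cscale_prod)
  have "cball 0 1 \<subseteq> ?A"
    using mem_V_mono[OF x] by (auto simp: norm_mult mult_left_le_one_le)
  from integral_unique[OF mean_value_circle[OF hol this]]
  show ?thesis by (simp add: rot scaleR_conv_of_real)
qed

text \<open>The shift has p = cnj \<eta> and q = -|\<eta>|^2 / 2, chosen from the expansion of |w -
  \<eta>|^2. The flow times at (z, w) and (\<zeta>, \<eta>) are w cnj \<eta> - |\<eta>|^2 / 2 and
  |\<eta>|^2 / 2; the two Jacobian factors multiply to e^(G w cnj \<eta>).\<close>

lemma bergman_prod_shift:
  assumes z: "(z, w) \<in> V" and \<zeta>: "(\<zeta>, \<eta>) \<in> V"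
  shows "bergman_prod V (z, w) (\<zeta>, \<eta>) = exp (of_real G * (w * cnj \<eta>)) *
    bergman_prod V (expscale S \<gamma> (w * cnj \<eta> - of_real ((cmod \<eta>)\<^sup>2 / 2)) z, w - \<eta>)
      (expscale S \<gamma> (of_real ((cmod \<eta>)\<^sup>2 / 2)) \<zeta>, 0)"
proof -
  let ?q = "- of_real ((cmod \<eta>)\<^sup>2 / 2) :: complex"
  have \<eta>\<eta>: "\<eta> * cnj \<eta> = of_real ((cmod \<eta>)\<^sup>2)" by (simp add: complex_norm_square del: of_real_power)
  have pq: "(cmod (1 * w + (- \<eta>)))\<^sup>2 / 2 + Re (cnj \<eta> * w + ?q) = (cmod w)\<^sup>2 / 2" for w
    by (simp add: cmod_power2) (simp add: power2_eq_square field_simps)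
  have "bergman_prod V (z, w) (\<zeta>, \<eta>) = exp (of_real G * (cnj \<eta> * w + ?q)) *
      bergman_prod V (vaff S \<gamma> (cnj \<eta>) ?q 1 (- \<eta>) (z, w)) (vaff S \<gamma> (cnj \<eta>) ?q 1 (- \<eta>) (\<zeta>, \<eta>)) *
      cnj (exp (of_real G * (cnj \<eta> * \<eta> + ?q)))"
    using bergman_prod_vaff[OF _ pq z \<zeta>] by simp
  also have "cnj \<eta> * \<eta> + ?q = of_real ((cmod \<eta>)\<^sup>2 / 2)"
    using \<eta>\<eta> by (simp add: mult.commute)
  also have "vaff S \<gamma> (cnj \<eta>) ?q 1 (- \<eta>) (\<zeta>, \<eta>) = (expscale S \<gamma> (of_real ((cmod \<eta>)\<^sup>2 / 2)) \<zeta>, 0)"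
    using \<open>cnj \<eta> * \<eta> + ?q = of_real ((cmod \<eta>)\<^sup>2 / 2)\<close> by (simp add: vaff_def)
  also have "vaff S \<gamma> (cnj \<eta>) ?q 1 (- \<eta>) (z, w) = (expscale S \<gamma> (w * cnj \<eta> - of_real ((cmod \<eta>)\<^sup>2 / 2)) z, w - \<eta>)"
    by (simp add: vaff_def mult.commute)
  also have "exp (of_real G * (cnj \<eta> * w + ?q)) * K * cnj (exp (of_real G * of_real ((cmod \<eta>)\<^sup>2 / 2))) =
      exp (of_real G * (w * cnj \<eta>)) * K" for K
  proof -
    have "cnj (exp (of_real G * of_real ((cmod \<eta>)\<^sup>2 / 2))) = exp (of_real G * of_real ((cmod \<eta>)\<^sup>2 / 2))"
      by (simp only: exp_cnj complex_cnj_mult complex_cnj_complex_of_real)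
    then have "exp (of_real G * (cnj \<eta> * w + ?q)) * cnj (exp (of_real G * of_real ((cmod \<eta>)\<^sup>2 / 2))) =
        exp (of_real G * (w * cnj \<eta>))"
      by (simp only: exp_add[symmetric] ring_distribs) (simp add: mult.commute)
    moreover have "U * K * C = U * C * K" for U C by (simp only: mult_ac)
    ultimately show ?thesis by (simp only:)
  qed
  finally show ?thesis .
qed

lemma V_slice_eq: "V_slice S \<gamma> \<Omega> \<eta> = expscale S \<gamma> (of_real ((cmod \<eta>)\<^sup>2 / 2)) -` \<Omega>"
  by (auto simp: V_slice_def mem_V)

text \<open>The slice is the preimage of \<Omega> under a linear scaling with constant real Jacobian
  e^(G |\<eta>|^2 / 2), which the transformation rule uses once in each argument.\<close>

lemma bergman_vec_slice:
  assumes "x \<in> V_slice S \<gamma> \<Omega> \<eta>" "y \<in> V_slice S \<gamma> \<Omega> \<eta>"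
  shows "bergman_vec (V_slice S \<gamma> \<Omega> \<eta>) x y = exp (of_real (G * (cmod \<eta>)\<^sup>2)) *
    bergman_vec \<Omega> (expscale S \<gamma> (of_real ((cmod \<eta>)\<^sup>2 / 2)) x) (expscale S \<gamma> (of_real ((cmod \<eta>)\<^sup>2 / 2)) y)"
proof -
  let ?a = "of_real ((cmod \<eta>)\<^sup>2 / 2) :: complex"
  let ?u = "exp (of_real G * ?a)"
  let ?V = "expscale S \<gamma> ?a -` \<Omega>"
  have meas: "expscale S \<gamma> ?a \<in> borel_measurable borel"
    by (intro borel_measurable_continuous_onI continuous_intros)
  have Vo: "open ?V" by (intro open_vimage open_\<Omega> continuous_intros)
  have smult: "expscale S \<gamma> a (\<i> *s v) = \<i> *s expscale S \<gamma> a v" for a v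
    by (simp add: expscale_def dscale_smult)
  have "bergman_gen JV ?V x y = ?u * bergman_gen JV \<Omega> (expscale S \<gamma> ?a x) (expscale S \<gamma> ?a y) * cnj ?u"
  proof (rule bergman_gen_transform[OF complex_structure_vec Vo open_\<Omega>, where \<Psi> = "expscale S \<gamma> (- ?a)"
        and \<Phi>' = "\<lambda>_. expscale S \<gamma> ?a" and \<Psi>' = "\<lambda>_. expscale S \<gamma> (- ?a)" and u = "\<lambda>_. ?u" and u' = "\<lambda>_. inverse ?u"])
    show "(\<integral>\<^sup>+x. F (expscale S \<gamma> ?a x) * ennreal ((cmod ?u)\<^sup>2) \<partial>lborel) = (\<integral>\<^sup>+x. F x \<partial>lborel)"
      if "F \<in> borel_measurable borel" for F :: "complex^'N \<Rightarrow> ennreal"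
      by (rule nn_integral_expscale[OF that])
  qed (use assms meas in \<open>auto simp: V_slice_eq expscale_add smult linear_imp_has_derivative linear_expscale\<close>)
  moreover have "?u * K * cnj ?u = exp (of_real (G * (cmod \<eta>)\<^sup>2)) * K" for K
  proof -
    have "cnj ?u = ?u" by (simp only: exp_cnj complex_cnj_mult complex_cnj_complex_of_real)
    then have "?u * cnj ?u = exp (of_real (G * (cmod \<eta>)\<^sup>2))"
      by (simp only: exp_add[symmetric]) (simp add: field_simps)
    moreover have "U * K * C = U * C * K" for U C by (simp only: mult_ac)
    ultimately show ?thesis by (simp only:)
  qed
  ultimately show ?thesis by (simp add: bergman_vec_def V_slice_eq)
qed

end

lemma nn_integral_exp_decay:
  assumes "c > 0"
  shows "(\<integral>\<^sup>+s. ennreal (exp (- (c * s))) * indicator {0..} s \<partial>lborel) = ennreal (1 / c)"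
proof -
  have "((\<lambda>s. - exp (- (c * s)) / c) \<longlongrightarrow> - 0 / c) at_top"
    using assms by (intro tendsto_intros filterlim_compose[OF exp_at_bot] filterlim_tendsto_pos_mult_at_top
        filterlim_uminus_at_bot_at_top[THEN filterlim_compose]) (auto intro: filterlim_ident)
  then have "(\<integral>\<^sup>+s. ennreal (exp (- (c * s))) * indicator {0..} s \<partial>lborel) = ennreal (- 0 / c - (- exp (- (c * 0)) / c))"
    using assms by (intro nn_integral_FTC_atLeast) (auto intro!: derivative_eq_intros)
  then show ?thesis by simp
qed

lemma complex_linear_smult:
  fixes L :: "complex^'n \<Rightarrow> complex"
  assumes "linear L" "\<And>v. L (\<i> *s v) = \<i> * L v"
  shows "L (c *s v) = c * L v"
proof -
  have "L (c *s v) = L (Re c *\<^sub>R v + Im c *\<^sub>R (\<i> *s v))"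
    using cscale_vec[of c v] by (simp add: cscale_def)
  also have "\<dots> = c * L v"
    using assms by (simp add: linear_add linear_scale complex_eq_iff)
  finally show ?thesis .
qed

section \<open>Orbits of the contractions and integration over \<open>V\<close>\<close>

context hartogs
begin

lemma G_pos: "G > 0"
  using S_ne \<gamma>_pos by (intro sum_pos) auto

lemma orbit_mem: "x \<in> \<Omega> \<Longrightarrow> s \<ge> 0 \<Longrightarrow> expscale S \<gamma> (- of_real s) x \<in> \<Omega>"
  by (rule expscale_mem) auto

text \<open>The orbit over s \<ge> 0 need not be compact, but it lies in the image of a cube of
  scaling factors in [0, 1]. That image is compact and, since \<Omega> is star-shaped, stays in
  \<Omega> even where factors are 0.\<close>

lemma bounded_on_orbit:
  fixes f :: "complex^'N \<Rightarrow> complex"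
  assumes f: "continuous_on \<Omega> f" and x: "x \<in> \<Omega>"
  shows "\<exists>B. \<forall>s\<ge>0. cmod (f (expscale S \<gamma> (- of_real s) x)) \<le> B"
proof -
  let ?m = "\<lambda>c::real^'N. dscale (\<lambda>j. if j \<in> S then of_real (c $ j) else 1) x"
  have "continuous_on (cbox 0 1) ?m"
  proof (intro continuous_on_dscale continuous_intros)
    show "continuous_on (cbox 0 1) (\<lambda>c::real^'N. if j \<in> S then complex_of_real (c $ j) else 1)" for j
      by (cases "j \<in> S") (auto intro!: continuous_intros)
  qed
  then have comp: "compact (?m ` cbox 0 1)" by (rule compact_continuous_image) simp
  have sub: "?m ` cbox 0 1 \<subseteq> \<Omega>"
    using x by (auto intro!: dscale_mem simp: mem_box_cart)
  have "bounded (f ` ?m ` cbox 0 1)"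
    by (rule compact_imp_bounded[OF compact_continuous_image[OF continuous_on_subset[OF f sub] comp]])
  then obtain B where B: "\<And>y. y \<in> f ` ?m ` cbox 0 1 \<Longrightarrow> cmod y \<le> B"
    unfolding bounded_iff by blast
  have "cmod (f (expscale S \<gamma> (- of_real s) x)) \<le> B" if "s \<ge> 0" for s
  proof (rule B)
    let ?c = "(\<chi> j. if j \<in> S then exp (- (\<gamma> j * s)) else 1) :: real^'N"
    have "?c \<in> cbox 0 1" using that \<gamma>_pos by (auto simp: mem_box_cart less_imp_le)
    moreover have "expscale S \<gamma> (- of_real s) x = ?m ?c"
      by (auto simp: vec_eq_iff expscale_nth exp_of_real[symmetric])
    ultimately show "f (expscale S \<gamma> (- of_real s) x) \<in> f ` ?m ` cbox 0 1" by blast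
  qed
  then show ?thesis by blast
qed

text \<open>The map sending the slice of \<open>V\<close> over \<open>0\<close>, which is \<open>\<Omega>\<close>, onto the slice over \<open>w\<close>.\<close>
definition orb :: "complex \<Rightarrow> complex^'N \<Rightarrow> complex^'N" where
  "orb w = expscale S \<gamma> (- of_real ((cmod w)\<^sup>2 / 2))"

lemma orb_orb: "orb w (orb w x) = expscale S \<gamma> (- of_real ((cmod w)\<^sup>2)) x"
  by (simp add: orb_def expscale_add)

lemma orb_mem: "x \<in> \<Omega> \<Longrightarrow> orb w x \<in> \<Omega>"
  unfolding orb_def by (rule expscale_mem) auto

lemma orb_mem_V: "(orb w y, w) \<in> V \<longleftrightarrow> y \<in> \<Omega>"
  by (simp add: orb_def mem_V expscale_add)

lemma indicator_V_orb: "indicator V (orb w y, w) = indicator \<Omega> y"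
  by (simp add: indicator_def orb_mem_V)

lemma continuous_on_orb [continuous_intros]:
  "continuous_on A f \<Longrightarrow> continuous_on A g \<Longrightarrow> continuous_on A (\<lambda>p. orb (f p) (g p))"
  unfolding orb_def by (intro continuous_intros) auto

lemma has_derivative_orb: "(orb w has_derivative orb w) (at x)"
  unfolding orb_def by (intro linear_imp_has_derivative linear_expscale)

lemma orb_smult: "orb w (c *s x) = c *s orb w x"
  by (simp add: orb_def expscale_def dscale_smult)

lemma nn_integral_orb:
  assumes "F \<in> borel_measurable borel"
  shows "(\<integral>\<^sup>+x. F (orb w x) * ennreal (exp (- (G * (cmod w)\<^sup>2))) \<partial>lborel) = (\<integral>\<^sup>+x. F x \<partial>lborel)"
proof -
  have "(cmod (exp (of_real G * - of_real ((cmod w)\<^sup>2 / 2))))\<^sup>2 = exp (- (G * (cmod w)\<^sup>2))"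
    by (simp add: power2_eq_square[of "exp _"] field_simps flip: exp_add)
  with nn_integral_expscale[OF assms, of S \<gamma> "- of_real ((cmod w)\<^sup>2 / 2)"] show ?thesis
    by (simp only: orb_def)
qed

lemma
  fixes F :: "(complex^'N) \<times> complex \<Rightarrow> ennreal"
  assumes F[measurable]: "F \<in> borel_measurable borel"
  shows nn_integral_V: "(\<integral>\<^sup>+z. indicator V z * F z \<partial>lborel) =
      (\<integral>\<^sup>+w. \<integral>\<^sup>+y. indicator \<Omega> y * F (orb w y, w) * ennreal (exp (- (G * (cmod w)\<^sup>2))) \<partial>lborel \<partial>lborel)"
    and measurable_nn_integral_V:
      "(\<lambda>w. \<integral>\<^sup>+y. indicator \<Omega> y * F (orb w y, w) * ennreal (exp (- (G * (cmod w)\<^sup>2))) \<partial>lborel) \<in> borel_measurable borel"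
proof -
  let ?H = "\<lambda>z. indicator V z * F z"
  have Hm: "?H \<in> borel_measurable borel"
    by (rule borel_measurable_times_ennreal) (use F open_V in auto)
  then have Hprod: "?H \<in> borel_measurable (lborel \<Otimes>\<^sub>M lborel)" by (simp add: lborel_prod)
  have inner: "(\<integral>\<^sup>+x. ?H (x, w) \<partial>lborel) = (\<integral>\<^sup>+y. indicator \<Omega> y * F (orb w y, w) * ennreal (exp (- (G * (cmod w)\<^sup>2))) \<partial>lborel)" for w
  proof -
    have "(\<lambda>x. ?H (x, w)) \<in> borel_measurable borel"
      by (rule measurable_compose[OF _ Hm]) (intro borel_measurable_continuous_onI continuous_intros)
    from nn_integral_orb[OF this, of w, symmetric]
    show ?thesis by (simp only: indicator_V_orb)
  qed
  show "(\<integral>\<^sup>+z. ?H z \<partial>lborel) =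
      (\<integral>\<^sup>+w. \<integral>\<^sup>+y. indicator \<Omega> y * F (orb w y, w) * ennreal (exp (- (G * (cmod w)\<^sup>2))) \<partial>lborel \<partial>lborel)"
    using lborel_pair.nn_integral_snd[OF Hprod] inner by (simp add: lborel_prod)
  have "(\<lambda>z. ?H (snd z, fst z)) \<in> borel_measurable borel"
    by (rule measurable_compose[OF _ Hm]) (intro borel_measurable_continuous_onI continuous_intros)
  then have "(\<lambda>(w, x). ?H (x, w)) \<in> borel_measurable (lborel \<Otimes>\<^sub>M lborel)"
    by (simp add: lborel_prod case_prod_beta')
  from lborel.borel_measurable_nn_integral[OF this]
  show "(\<lambda>w. \<integral>\<^sup>+y. indicator \<Omega> y * F (orb w y, w) * ennreal (exp (- (G * (cmod w)\<^sup>2))) \<partial>lborel) \<in> borel_measurable borel"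
    unfolding inner[symmetric] by simp
qed

lemma
  fixes F :: "(complex^'N) \<times> complex \<Rightarrow> complex"
  assumes int: "set_integrable lborel V F"
  shows integral_V: "(LINT z:V|lborel. F z) =
      (LINT w|lborel. of_real (exp (- (G * (cmod w)\<^sup>2))) * (LINT y:\<Omega>|lborel. F (orb w y, w)))"
    and integrable_V: "integrable lborel (\<lambda>w. of_real (exp (- (G * (cmod w)\<^sup>2))) * (LINT y:\<Omega>|lborel. F (orb w y, w)))"
proof -
  let ?H = "\<lambda>z. indicator V z *\<^sub>R F z"
  have Hi: "integrable lborel ?H" using int by (simp add: set_integrable_def)
  then have Hm: "?H \<in> borel_measurable borel" by auto
  have Hprod: "integrable (lborel \<Otimes>\<^sub>M lborel) (case_prod (\<lambda>x w. ?H (x, w)))"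
    using Hi by (simp add: lborel_prod case_prod_beta')
  have inner: "(LINT x|lborel. ?H (x, w)) = of_real (exp (- (G * (cmod w)\<^sup>2))) * (LINT y:\<Omega>|lborel. F (orb w y, w))" for w
  proof -
    have "(\<lambda>x. ?H (x, w)) \<in> borel_measurable borel"
      by (rule measurable_compose[OF _ Hm]) (intro borel_measurable_continuous_onI continuous_intros)
    then have "(LINT x|lborel. ?H (x, w)) = (LINT x|lborel. exp (- (G * (cmod w)\<^sup>2)) *\<^sub>R ?H (orb w x, w))"
    proof (rule integral_transform[rotated 2])
      show "orb w \<in> borel_measurable borel" by (intro borel_measurable_continuous_onI continuous_intros)
      show "(\<integral>\<^sup>+x. F (orb w x) * ennreal (exp (- (G * (cmod w)\<^sup>2))) \<partial>lborel) = (\<integral>\<^sup>+x. F x \<partial>lborel)"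
        if "F \<in> borel_measurable borel" for F :: "complex^'N \<Rightarrow> ennreal"
        by (rule nn_integral_orb[OF that])
    qed auto
    also have "\<dots> = of_real (exp (- (G * (cmod w)\<^sup>2))) * (LINT y:\<Omega>|lborel. F (orb w y, w))"
      unfolding set_lebesgue_integral_def
      by (simp add: indicator_V_orb scaleR_conv_of_real)
    finally show ?thesis .
  qed
  show "(LINT z:V|lborel. F z) =
      (LINT w|lborel. of_real (exp (- (G * (cmod w)\<^sup>2))) * (LINT y:\<Omega>|lborel. F (orb w y, w)))"
    using lborel_pair.integral_snd[OF Hprod] unfolding inner set_lebesgue_integral_def[of lborel V]
    by (simp add: lborel_prod case_prod_beta')
  show "integrable lborel (\<lambda>w. of_real (exp (- (G * (cmod w)\<^sup>2))) * (LINT y:\<Omega>|lborel. F (orb w y, w)))"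
    using lborel_pair.integrable_snd[OF Hprod] unfolding inner .
qed

lemma bergman_vec_A2: "x \<in> \<Omega> \<Longrightarrow> (\<lambda>y. bergman_vec \<Omega> y x) \<in> A2 JV \<Omega>"
  unfolding bergman_vec_def by (rule bergman_gen_A2[OF open_\<Omega> complex_structure_vec])

lemma bergman_vec_reproducing: "x \<in> \<Omega> \<Longrightarrow> f \<in> A2 JV \<Omega> \<Longrightarrow> f x = ip \<Omega> f (\<lambda>y. bergman_vec \<Omega> y x)"
  unfolding bergman_vec_def by (rule bergman_gen_reproducing[OF open_\<Omega> complex_structure_vec])

lemma A2_orb: "f \<in> A2 JV \<Omega> \<Longrightarrow> (\<lambda>y. f (orb w y)) \<in> A2 JV \<Omega>"
  unfolding orb_def by (rule A2_expscale) auto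

text \<open>Two half steps along the orbit, one moved to the other side of the inner product by
  self-adjointness, make a full step, which the kernel evaluates at the point \<open>x\<close>.\<close>
lemma ip_kernel_orb:
  assumes x: "x \<in> \<Omega>" and f: "(\<lambda>y. f (orb w y)) \<in> A2 JV \<Omega>"
  shows "ip \<Omega> (\<lambda>y. bergman_vec \<Omega> (orb w y) x) (\<lambda>y. f (orb w y)) = cnj (f (expscale S \<gamma> (- of_real ((cmod w)\<^sup>2)) x))"
proof -
  have "ip \<Omega> (\<lambda>y. bergman_vec \<Omega> (orb w y) x) (\<lambda>y. f (orb w y)) = ip \<Omega> (\<lambda>y. bergman_vec \<Omega> y x) (\<lambda>y. f (orb w (orb w y)))"
    using ip_expscale[OF bergman_vec_A2[OF x] f, of "- ((cmod w)\<^sup>2 / 2)"] by (simp add: orb_def)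
  also have "\<dots> = cnj (ip \<Omega> (\<lambda>y. f (orb w (orb w y))) (\<lambda>y. bergman_vec \<Omega> y x))"
    by (rule ip_cnj[OF open_\<Omega>, symmetric])
  also have "\<dots> = cnj (f (orb w (orb w x)))"
    using bergman_vec_reproducing[OF x A2_orb[OF f]] by simp
  finally show ?thesis unfolding orb_orb .
qed

lemma kernel_lift_A2:
  assumes x: "x \<in> \<Omega>"
  shows "(\<lambda>z. bergman_vec \<Omega> (fst z) x) \<in> A2 JP V"
proof -
  let ?q = "\<lambda>y. bergman_vec \<Omega> y x"
  have q: "?q \<in> A2 JV \<Omega>" by (rule bergman_vec_A2[OF x])
  have ch: "cholo_on JP (\<lambda>z. ?q (fst z)) V"
    by (rule cholo_on_compose[OF A2_cholo[OF open_\<Omega> q], where \<Phi>' = "\<lambda>_. fst"])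
      (auto dest: mem_V_base intro!: derivative_intros)
  \<comment> \<open>Boundedness along the orbit leaves the Gaussian density e^(-G |w|^2) to decide
    convergence over w, and G > 0.\<close>
  obtain B where B: "\<And>s. s \<ge> 0 \<Longrightarrow> cmod (?q (expscale S \<gamma> (- of_real s) x)) \<le> B"
    using bounded_on_orbit[OF A2_continuous[OF open_\<Omega> q] x] by blast
  have "0 \<le> B" using B[of 0] norm_ge_zero order_trans by blast
  \<comment> \<open>With f the kernel itself, \<open>ip_kernel_orb\<close> evaluates a squared norm
    as a kernel value on the orbit.\<close>
  have norm2_le: "norm2 \<Omega> (\<lambda>y. ?q (orb w y)) \<le> B" for w
  proof -
    have "of_real (norm2 \<Omega> (\<lambda>y. ?q (orb w y))) = cnj (?q (expscale S \<gamma> (- of_real ((cmod w)\<^sup>2)) x))"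
      unfolding ip_self[OF open_\<Omega>, symmetric] by (rule ip_kernel_orb[OF x A2_orb[OF q]])
    then have "\<bar>norm2 \<Omega> (\<lambda>y. ?q (orb w y))\<bar> = cmod (?q (expscale S \<gamma> (- of_real ((cmod w)\<^sup>2)) x))"
      by (metis complex_mod_cnj norm_of_real)
    then show ?thesis using B[of "(cmod w)\<^sup>2"] by simp
  qed
  let ?h = "\<lambda>y. ennreal (indicator \<Omega> y * (cmod (?q y))\<^sup>2)"
  have hm: "?h \<in> borel_measurable borel"
  proof -
    have "(\<lambda>y. indicator \<Omega> y *\<^sub>R (cmod (?q y))\<^sup>2) \<in> borel_measurable borel"
      by (intro borel_measurable_on_open[OF open_\<Omega>] continuous_intros A2_continuous[OF open_\<Omega> q])
    then show ?thesis by simp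
  qed
  have hf: "(\<lambda>z::(complex^'N) \<times> complex. ?h (fst z)) \<in> borel_measurable borel"
    by (rule measurable_compose[OF _ hm]) (intro borel_measurable_continuous_onI continuous_intros)
  have "(\<integral>\<^sup>+z. ennreal (indicator V z * (cmod (?q (fst z)))\<^sup>2) \<partial>lborel) = (\<integral>\<^sup>+z. indicator V z * ?h (fst z) \<partial>lborel)"
    by (intro nn_integral_cong) (auto simp: indicator_def dest: mem_V_base)
  also have "\<dots> = (\<integral>\<^sup>+w. \<integral>\<^sup>+y. indicator \<Omega> y * ?h (orb w y) * ennreal (exp (- (G * (cmod w)\<^sup>2))) \<partial>lborel \<partial>lborel)"
    using nn_integral_V[OF hf] by simp
  also have "\<dots> = (\<integral>\<^sup>+w. ennreal (norm2 \<Omega> (\<lambda>y. ?q (orb w y))) * ennreal (exp (- (G * (cmod w)\<^sup>2))) \<partial>lborel)"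
  proof (rule nn_integral_cong)
    fix w :: complex
    have "indicator \<Omega> y * ?h (orb w y) = ennreal (indicator \<Omega> y * (cmod (?q (orb w y)))\<^sup>2)" for y
      using orb_mem[of y w] by (auto simp: indicator_def)
    moreover have "(\<lambda>y. ennreal (indicator \<Omega> y * (cmod (?q (orb w y)))\<^sup>2)) \<in> borel_measurable lborel"
    proof -
      have "(\<lambda>y. indicator \<Omega> y *\<^sub>R (cmod (?q (orb w y)))\<^sup>2) \<in> borel_measurable borel"
        by (intro borel_measurable_on_open[OF open_\<Omega>] continuous_intros A2_continuous[OF open_\<Omega> A2_orb[OF q]])
      then show ?thesis by simp
    qed
    ultimately show "(\<integral>\<^sup>+y. indicator \<Omega> y * ?h (orb w y) * ennreal (exp (- (G * (cmod w)\<^sup>2))) \<partial>lborel) =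
      ennreal (norm2 \<Omega> (\<lambda>y. ?q (orb w y))) * ennreal (exp (- (G * (cmod w)\<^sup>2)))"
      by (simp only: nn_integral_multc nn_integral_A2[OF open_\<Omega> A2_orb[OF q]])
  qed
  also have "\<dots> \<le> (\<integral>\<^sup>+w. ennreal B * ennreal (exp (- (G * (cmod w)\<^sup>2))) \<partial>(lborel :: complex measure))"
    using norm2_le by (intro nn_integral_mono mult_right_mono ennreal_leI) auto
  also have "\<dots> = (\<integral>\<^sup>+s. ennreal (pi * indicator {0..} s) * (ennreal B * ennreal (exp (- (G * s)))) \<partial>lborel)"
    by (rule nn_integral_radial_complex) measurable
  also have "\<dots> = (\<integral>\<^sup>+s. (ennreal pi * ennreal B) * (ennreal (exp (- (G * s))) * indicator {0..} s) \<partial>lborel)"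
    by (intro nn_integral_cong) (auto simp: indicator_def mult_ac)
  also have "\<dots> = (ennreal pi * ennreal B) * ennreal (1 / G)"
    by (subst nn_integral_cmult) (simp_all add: nn_integral_exp_decay[OF G_pos])
  also have "\<dots> < \<infinity>" by (simp add: ennreal_mult_less_top)
  finally show ?thesis using ch by (simp add: A2_iff_nn[OF open_V])
qed

end

section \<open>The kernel formula\<close>

context hartogs
begin

lemma bergman_prod_A2:
  assumes "\<zeta> \<in> \<Omega>"
  shows "(\<lambda>z. bergman_prod V z (\<zeta>, 0)) \<in> A2 JP V"
  unfolding bergman_prod_def using assms
  by (intro bergman_gen_A2 open_V complex_structure_prod) (simp add: mem_V_0)

lemma cholo_bergman_prod_base:
  assumes "\<zeta> \<in> \<Omega>"
  shows "cholo_on JV (\<lambda>y. bergman_prod V (y, 0) (\<zeta>, 0)) \<Omega>"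
  by (rule cholo_on_compose[OF A2_cholo[OF open_V bergman_prod_A2[OF assms]], where \<Phi>' = "\<lambda>_ h. (h, 0)"])
    (auto simp: mem_V_0 intro!: derivative_intros)

text \<open>The finite squared norm over V is an integral over w of fibre norms, so almost all of
  these are finite. Independence of w replaces the point (orb w y, w) by (orb w y, 0).\<close>

lemma bergman_prod_orb_A2:
  assumes \<zeta>: "\<zeta> \<in> \<Omega>"
  shows "AE w in lborel. (\<lambda>y. bergman_prod V (orb w y, 0) (\<zeta>, 0)) \<in> A2 JV \<Omega>"
proof -
  let ?K = "\<lambda>z. bergman_prod V z (\<zeta>, 0)"
  let ?h = "\<lambda>z. ennreal (indicator V z * (cmod (?K z))\<^sup>2)"
  note K = bergman_prod_A2[OF \<zeta>]
  have hm: "?h \<in> borel_measurable borel"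
  proof -
    have "(\<lambda>z. indicator V z *\<^sub>R (cmod (?K z))\<^sup>2) \<in> borel_measurable borel"
      by (intro borel_measurable_on_open[OF open_V] continuous_intros A2_continuous[OF open_V K])
    then show ?thesis by simp
  qed
  let ?I = "\<lambda>w. \<integral>\<^sup>+y. indicator \<Omega> y * ?h (orb w y, w) * ennreal (exp (- (G * (cmod w)\<^sup>2))) \<partial>lborel"
  have "(\<integral>\<^sup>+w. ?I w \<partial>lborel) = (\<integral>\<^sup>+z. indicator V z * ?h z \<partial>lborel)"
    by (rule nn_integral_V[OF hm, symmetric])
  also have "\<dots> = (\<integral>\<^sup>+z. ?h z \<partial>lborel)"
    by (intro nn_integral_cong) (auto simp: indicator_def)
  also have "\<dots> < \<infinity>" using K by (simp add: A2_iff_nn[OF open_V])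
  finally have "AE w in lborel. ?I w \<noteq> \<infinity>"
    using measurable_nn_integral_V[OF hm] by (intro nn_integral_PInf_AE) auto
  then show ?thesis
  proof (rule AE_mp, intro AE_I2 impI)
    fix w :: complex assume fin: "?I w \<noteq> \<infinity>"
    have ch: "cholo_on JV (\<lambda>y. ?K (orb w y, 0)) \<Omega>"
      by (rule cholo_on_compose[OF cholo_bergman_prod_base[OF \<zeta>], where \<Phi>' = "\<lambda>_. orb w"])
        (auto simp: orb_mem has_derivative_orb orb_smult)
    have "indicator \<Omega> y * ?h (orb w y, w) = ennreal (indicator \<Omega> y * (cmod (?K (orb w y, 0)))\<^sup>2)" for y
      using bergman_prod_indep[of "orb w y" w \<zeta>] \<zeta> by (auto simp: indicator_def orb_mem_V)
    moreover have "(\<lambda>y. ennreal (indicator \<Omega> y * (cmod (?K (orb w y, 0)))\<^sup>2)) \<in> borel_measurable lborel"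
    proof -
      have "(\<lambda>y. indicator \<Omega> y *\<^sub>R (cmod (?K (orb w y, 0)))\<^sup>2) \<in> borel_measurable borel"
        by (intro borel_measurable_on_open[OF open_\<Omega>] continuous_intros cholo_on_imp_continuous_on[OF ch])
      then show ?thesis by simp
    qed
    ultimately have "?I w = (\<integral>\<^sup>+y. ennreal (indicator \<Omega> y * (cmod (?K (orb w y, 0)))\<^sup>2) \<partial>lborel) * ennreal (exp (- (G * (cmod w)\<^sup>2)))"
      by (simp only: nn_integral_multc)
    with fin have "(\<integral>\<^sup>+y. ennreal (indicator \<Omega> y * (cmod (?K (orb w y, 0)))\<^sup>2) \<partial>lborel) \<noteq> \<infinity>"
      by (auto simp: ennreal_mult_eq_top_iff)
    then show "(\<lambda>y. ?K (orb w y, 0)) \<in> A2 JV \<Omega>"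
      using ch by (simp add: A2_iff_nn[OF open_\<Omega>] less_top)
  qed
qed

lemma bergman_vec_eq_integral:
  assumes x: "x \<in> \<Omega>" and \<zeta>: "\<zeta> \<in> \<Omega>"
  shows "bergman_vec \<Omega> x \<zeta> = (LINT w|lborel. of_real (exp (- (G * (cmod w)\<^sup>2))) *
    bergman_prod V (expscale S \<gamma> (- of_real ((cmod w)\<^sup>2)) x, 0) (\<zeta>, 0))"
proof -
  let ?q = "\<lambda>y. bergman_vec \<Omega> y x"
  let ?K = "\<lambda>z. bergman_prod V z (\<zeta>, 0)"
  let ?e = "\<lambda>w. complex_of_real (exp (- (G * (cmod w)\<^sup>2)))"
  let ?k = "\<lambda>w. ?K (expscale S \<gamma> (- of_real ((cmod w)\<^sup>2)) x, 0)"
  have int: "set_integrable lborel V (\<lambda>z. ?q (fst z) * cnj (?K z))"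
    by (rule A2_integrable_mult[OF open_V kernel_lift_A2[OF x] bergman_prod_A2[OF \<zeta>]])
  have cont: "continuous_on UNIV (\<lambda>w. ?e w * cnj (?k w))"
  proof (intro continuous_intros)
    show "continuous_on UNIV ?k"
      by (rule continuous_on_compose2[OF cholo_on_imp_continuous_on[OF cholo_bergman_prod_base[OF \<zeta>]]])
        (auto intro!: continuous_intros orbit_mem[OF x] simp del: of_real_power)
  qed
  have "?q \<zeta> = ip V (\<lambda>z. ?q (fst z)) ?K"
    using bergman_gen_reproducing[OF open_V complex_structure_prod _ kernel_lift_A2[OF x], of "(\<zeta>, 0)"] \<zeta>
    by (simp add: bergman_prod_def mem_V_0)
  also have "\<dots> = (LINT w|lborel. ?e w * (LINT y:\<Omega>|lborel. ?q (orb w y) * cnj (?K (orb w y, w))))"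
    unfolding ip_def using integral_V[OF int] by simp
  \<comment> \<open>Self-adjointness applies on those fibres where the rescaled kernel is square
    integrable; the others form a null set.\<close>
  also have "\<dots> = (LINT w|lborel. ?e w * cnj (?k w))"
  proof (rule integral_cong_AE)
    show "(\<lambda>w. ?e w * (LINT y:\<Omega>|lborel. ?q (orb w y) * cnj (?K (orb w y, w)))) \<in> borel_measurable lborel"
      using integrable_V[OF int] by auto
    show "(\<lambda>w. ?e w * cnj (?k w)) \<in> borel_measurable lborel"
      using borel_measurable_continuous_onI[OF cont] by simp
    show "AE w in lborel. ?e w * (LINT y:\<Omega>|lborel. ?q (orb w y) * cnj (?K (orb w y, w))) = ?e w * cnj (?k w)"
      using bergman_prod_orb_A2[OF \<zeta>]
    proof (rule AE_mp, intro AE_I2 impI)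
      fix w assume A: "(\<lambda>y. ?K (orb w y, 0)) \<in> A2 JV \<Omega>"
      have "(LINT y:\<Omega>|lborel. ?q (orb w y) * cnj (?K (orb w y, w))) = ip \<Omega> (\<lambda>y. ?q (orb w y)) (\<lambda>y. ?K (orb w y, 0))"
        unfolding ip_def using bergman_prod_indep[of _ w \<zeta>] \<zeta> open_\<Omega>
        by (intro set_lebesgue_integral_cong) (auto simp: orb_mem_V)
      also have "\<dots> = cnj (?k w)"
        by (rule ip_kernel_orb[OF x, of "\<lambda>y. ?K (y, 0)", OF A])
      finally show "?e w * (LINT y:\<Omega>|lborel. ?q (orb w y) * cnj (?K (orb w y, w))) = ?e w * cnj (?k w)"
        by simp
    qed
  qed
  \<comment> \<open>This computes the kernel at (\<zeta>, x); conjugation and Hermitian symmetry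
    exchange the two points.\<close>
  finally have "?q \<zeta> = (LINT w|lborel. cnj (?e w * ?k w))" by simp
  then have "cnj (?q \<zeta>) = (LINT w|lborel. ?e w * ?k w)"
    by (simp only: Bochner_Integration.integral_cnj complex_cnj_cnj)
  moreover have "bergman_vec \<Omega> x \<zeta> = cnj (?q \<zeta>)"
    unfolding bergman_vec_def by (rule bergman_gen_hermitian[OF open_\<Omega> complex_structure_vec x \<zeta>])
  ultimately show ?thesis by simp
qed

text \<open>The absolute values make \<open>\<phi>\<close> continuous on the whole line; only \<open>s \<ge> 0\<close> matters.\<close>
lemma bergman_vec_orbit_integral:
  assumes x: "x \<in> \<Omega>" and \<zeta>: "\<zeta> \<in> \<Omega>"
  defines "\<phi> \<equiv> \<lambda>s::real. of_real (exp (- (G * \<bar>s\<bar>))) * bergman_prod V (expscale S \<gamma> (- of_real \<bar>s\<bar>) x, 0) (\<zeta>, 0)"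
  shows "continuous_on UNIV \<phi>" "set_integrable lborel {0..} \<phi>"
    and "\<And>a. a \<ge> 0 \<Longrightarrow> of_real (exp (- (G * a))) * bergman_vec \<Omega> (expscale S \<gamma> (- of_real a) x) \<zeta> =
      of_real pi * integral {a..} \<phi>"
proof -
  let ?k = "\<lambda>y. bergman_prod V (y, 0) (\<zeta>, 0)"
  have k: "continuous_on \<Omega> ?k" by (rule cholo_on_imp_continuous_on[OF cholo_bergman_prod_base[OF \<zeta>]])
  show cont: "continuous_on UNIV \<phi>"
    unfolding \<phi>_def
    by (intro continuous_intros continuous_on_compose2[OF k]) (auto intro!: continuous_intros orbit_mem[OF x])
  then have [measurable]: "\<phi> \<in> borel_measurable borel" by (rule borel_measurable_continuous_onI)
  obtain B where B: "\<And>s. s \<ge> 0 \<Longrightarrow> cmod (?k (expscale S \<gamma> (- of_real s) x)) \<le> B"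
    using bounded_on_orbit[OF k x] by blast
  show int: "set_integrable lborel {0..} \<phi>"
  proof (rule set_integrable_bound)
    have "(\<integral>\<^sup>+s. ennreal (norm (indicator {0..} s *\<^sub>R exp (- (G * s)))) \<partial>lborel) = (\<integral>\<^sup>+s. ennreal (exp (- (G * s))) * indicator {0..} s \<partial>lborel)"
      by (intro nn_integral_cong) (auto simp: indicator_def)
    then have "integrable lborel (\<lambda>s. indicator {0..} s *\<^sub>R exp (- (G * s)))"
      by (intro integrableI_bounded) (auto simp: nn_integral_exp_decay[OF G_pos])
    then have "set_integrable lborel {0..} (\<lambda>s. exp (- (G * s)))" by (simp add: set_integrable_def)
    then show "set_integrable lborel {0..} (\<lambda>s. exp (- (G * s)) * B)" by simp
    show "set_borel_measurable lborel {0..} \<phi>" unfolding set_borel_measurable_def by measurable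
    show "AE s in lborel. s \<in> {0..} \<longrightarrow> norm (\<phi> s) \<le> norm (exp (- (G * s)) * B)"
      using B by (intro AE_I2) (auto simp: \<phi>_def norm_mult intro!: order_trans[OF _ abs_ge_self])
  qed
  fix a :: real assume a: "a \<ge> 0"
  let ?y = "expscale S \<gamma> (- of_real a) x"
  \<comment> \<open>This is \<phi> for the orbit started at the later point ?y; by the flow law,
    e^(-G a) times it is \<phi> translated by a.\<close>
  let ?\<psi> = "\<lambda>s. of_real (exp (- (G * \<bar>s\<bar>))) * ?k (expscale S \<gamma> (- of_real \<bar>s\<bar>) ?y)"
  have y: "?y \<in> \<Omega>" by (rule orbit_mem[OF x a])
  have "continuous_on UNIV ?\<psi>"
    by (intro continuous_intros continuous_on_compose2[OF k]) (auto intro!: continuous_intros orbit_mem[OF y])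
  then have \<psi>: "?\<psi> \<in> borel_measurable borel" by (rule borel_measurable_continuous_onI)
  have "bergman_vec \<Omega> ?y \<zeta> = of_real pi * (LINT s:{0..}|lborel. ?\<psi> s)"
    using integral_radial_complex[OF \<psi>] bergman_vec_eq_integral[OF y \<zeta>] by simp
  then have "of_real (exp (- (G * a))) * bergman_vec \<Omega> ?y \<zeta> = of_real pi * (LINT s:{0..}|lborel. of_real (exp (- (G * a))) * ?\<psi> s)"
    by simp
  also have "(LINT s:{0..}|lborel. of_real (exp (- (G * a))) * ?\<psi> s) = (LINT s:{0..}|lborel. \<phi> (a + s))"
  proof (rule set_lebesgue_integral_cong)
    have "complex_of_real (exp (- (G * a))) * of_real (exp (- (G * s))) = of_real (exp (- (G * (a + s))))" for s
      by (simp add: ring_distribs exp_diff exp_minus field_simps exp_add flip: of_real_mult)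
    then show "\<forall>s. s \<in> {0..} \<longrightarrow> of_real (exp (- (G * a))) * ?\<psi> s = \<phi> (a + s)"
      using a by (auto simp: \<phi>_def expscale_add mult.assoc[symmetric] algebra_simps simp del: of_real_exp)
  qed simp
  also have "\<dots> = (LINT s:{a..}|lborel. \<phi> s)"
  proof -
    have "(LINT s:{a..}|lborel. \<phi> s) = (LINT s|distr lborel borel ((+) a). indicator {a..} s *\<^sub>R \<phi> s)"
      by (simp add: lborel_distr_plus set_lebesgue_integral_def)
    also have "\<dots> = (LINT s|lborel. indicator {a..} (a + s) *\<^sub>R \<phi> (a + s))"
      by (subst integral_distr) auto
    also have "\<dots> = (LINT s:{0..}|lborel. \<phi> (a + s))"
      unfolding set_lebesgue_integral_def
      by (intro Bochner_Integration.integral_cong) (auto simp: indicator_def)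
    finally show ?thesis by simp
  qed
  also have "\<dots> = integral {a..} \<phi>"
    using a by (intro set_borel_integral_eq_integral set_integrable_subset[OF int]) auto
  finally show "of_real (exp (- (G * a))) * bergman_vec \<Omega> ?y \<zeta> = of_real pi * integral {a..} \<phi>" .
qed

lemma bergman_prod_base:
  assumes x: "x \<in> \<Omega>" and \<zeta>: "\<zeta> \<in> \<Omega>"
    and L: "((\<lambda>y. bergman_vec \<Omega> y \<zeta>) has_derivative L) (at x)" "\<And>v. L (\<i> *s v) = \<i> * L v"
  shows "of_real pi * bergman_prod V (x, 0) (\<zeta>, 0) =
    (\<Sum>j\<in>S. of_real (\<gamma> j) * (bergman_vec \<Omega> x \<zeta> + x $ j * L (axis j 1)))"
proof -
  let ?q = "\<lambda>y. bergman_vec \<Omega> y \<zeta>"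
  let ?P = "\<lambda>a::real. of_real (exp (- (G * a))) * ?q (expscale S \<gamma> (- of_real a) x)"
  define \<phi> where "\<phi> = (\<lambda>s::real. of_real (exp (- (G * \<bar>s\<bar>))) * bergman_prod V (expscale S \<gamma> (- of_real \<bar>s\<bar>) x, 0) (\<zeta>, 0))"
  note \<phi> = bergman_vec_orbit_integral[OF x \<zeta>, folded \<phi>_def]
  have P: "?P a = ?P 0 - of_real pi * integral {0..a} \<phi>" if "a \<in> {0..1}" for a
  proof -
    have "integral {0..} \<phi> = integral {0..a} \<phi> + integral {a..} \<phi>"
    proof -
      have i: "(\<phi> has_integral integral {0..a} \<phi>) {0..a}" "(\<phi> has_integral integral {a..} \<phi>) {a..}"
        using \<phi>(1) that set_borel_integral_eq_integral(1)[OF set_integrable_subset[OF \<phi>(2), of "{a..}"]]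
        by (auto intro!: integrable_integral integrable_continuous_interval intro: continuous_on_subset)
      have "{0..a} \<inter> {a..} = {a}" "{0..a} \<union> {a..} = {0..}" using that by auto
      then show ?thesis using has_integral_Un[OF i] by (simp add: integral_unique)
    qed
    then show ?thesis using \<phi>(3)[of a] \<phi>(3)[of 0] that by (simp add: ring_distribs)
  qed
  \<comment> \<open>The derivative at 0 is one-sided: for a < 0 the point may leave \<Omega>, and
    the integral formula is stated for a \<ge> 0.\<close>
  have "((\<lambda>a. ?P 0 - of_real pi * integral {0..a} \<phi>) has_vector_derivative - (of_real pi * \<phi> 0)) (at 0 within {0..1})"
    using integral_has_vector_derivative[of 0 1 \<phi> 0] \<phi>(1)
    by (auto intro!: derivative_eq_intros intro: continuous_on_subset)
  then have d1: "(?P has_vector_derivative - (of_real pi * \<phi> 0)) (at 0 within {0..1})"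
    by (rule has_vector_derivative_transform[rotated 2]) (use P in auto)
  \<comment> \<open>The initial velocity of the orbit, so that L v is minus the weighted Euler
    derivative of the kernel.\<close>
  define v where "v = (\<chi> j. if j \<in> S then - (of_real (\<gamma> j) * x $ j) else 0)"
  have curve: "((\<lambda>a::real. expscale S \<gamma> (- of_real a) x) has_derivative (\<lambda>h. h *\<^sub>R v)) (at 0 within {0..1})"
  proof (rule has_derivative_vecI)
    fix j
    show "((\<lambda>a::real. expscale S \<gamma> (- of_real a) x $ j) has_derivative (\<lambda>h. (h *\<^sub>R v) $ j)) (at 0 within {0..1})"
    proof (cases "j \<in> S")
      case True
      have "((\<lambda>a::real. of_real (\<gamma> j) * - complex_of_real a) has_derivative (\<lambda>h. of_real (\<gamma> j) * - of_real h)) (at 0 within {0..1})"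
        by (auto intro!: derivative_eq_intros)
      from has_derivative_mult_left[OF has_derivative_exp_complex[OF this], of "x $ j"] True show ?thesis
        unfolding vector_scaleR_component by (simp add: expscale_nth v_def scaleR_conv_of_real mult_ac)
    qed (simp add: expscale_nth v_def)
  qed
  have "((\<lambda>a. ?q (expscale S \<gamma> (- of_real a) x)) has_derivative (\<lambda>h. L (h *\<^sub>R v))) (at 0 within {0..1})"
    using has_derivative_compose[OF curve, of ?q L] L by simp
  moreover have lin: "linear L" by (rule has_derivative_linear[OF L(1)])
  ultimately have "((\<lambda>a. ?q (expscale S \<gamma> (- of_real a) x)) has_vector_derivative L v) (at 0 within {0..1})"
    by (simp add: has_vector_derivative_def linear_scale)
  moreover have "((\<lambda>a. complex_of_real (exp (- (G * a)))) has_vector_derivative of_real (- G)) (at 0 within {0..1})"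
    by (intro has_vector_derivative_of_real) (auto intro!: derivative_eq_intros simp: has_real_derivative_iff_has_vector_derivative[symmetric])
  ultimately have "(?P has_vector_derivative (of_real (exp (- (G * 0))) * L v + of_real (- G) * ?q (expscale S \<gamma> (- of_real 0) x))) (at 0 within {0..1})"
    by (intro has_vector_derivative_mult)
  then have "- (of_real pi * \<phi> 0) = of_real (exp (- (G * 0))) * L v + of_real (- G) * ?q (expscale S \<gamma> (- of_real 0) x)"
    by (intro vector_derivative_unique_within_closed_interval[of 0 1 0, unfolded box_real, OF _ _ d1]) auto
  then have eq: "of_real pi * bergman_prod V (x, 0) (\<zeta>, 0) = of_real G * ?q x - L v"
    by (simp add: \<phi>_def algebra_simps)
  have "v = (\<Sum>j\<in>S. (- (of_real (\<gamma> j) * x $ j)) *s axis j 1)"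
  proof (simp only: vec_eq_iff sum_component, rule allI)
    fix i
    have "(\<Sum>j\<in>S. ((- (of_real (\<gamma> j) * x $ j)) *s axis j (1::complex)) $ i) = (\<Sum>j\<in>S. if j = i then - (of_real (\<gamma> j) * x $ j) else 0)"
      by (rule sum.cong) (auto simp: axis_def)
    then show "v $ i = (\<Sum>j\<in>S. ((- (of_real (\<gamma> j) * x $ j)) *s axis j 1) $ i)"
      by (simp add: v_def)
  qed
  then have "L v = - (\<Sum>j\<in>S. of_real (\<gamma> j) * x $ j * L (axis j 1))"
    by (simp only: linear_sum[OF lin] complex_linear_smult[OF lin L(2)]) (simp add: sum_negf)
  with eq show ?thesis
    by (simp add: ring_distribs sum.distrib sum_distrib_right mult.assoc)
qed

end

section \<open>From the fibre over 0 to the differential operator\<close>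

context hartogs
begin

lemma l_map_eq: "l_map S \<gamma> x w \<eta> = expscale S \<gamma> (w * cnj \<eta> - of_real ((cmod \<eta>)\<^sup>2)) x"
  by (simp add: l_map_def vec_eq_iff expscale_nth mult.commute)

text \<open>Flowing \<open>l_map\<close> further by |\<eta>|^2 / 2 gives the flow time w cnj \<eta>
  - |\<eta>|^2 / 2, the one that occurs in \<open>bergman_prod_shift\<close>. If the point leaves
  the slice, both kernels are 0 by normalisation, so the identity holds for every x and can be
  differentiated.\<close>

lemma bergman_vec_slice_l_map:
  assumes \<zeta>: "(\<zeta>, \<eta>) \<in> V"
  shows "bergman_vec (V_slice S \<gamma> \<Omega> \<eta>) (l_map S \<gamma> x v \<eta>) \<zeta> = exp (of_real (G * (cmod \<eta>)\<^sup>2)) *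
    bergman_vec \<Omega> (expscale S \<gamma> (v * cnj \<eta> - of_real ((cmod \<eta>)\<^sup>2 / 2)) x) (expscale S \<gamma> (of_real ((cmod \<eta>)\<^sup>2 / 2)) \<zeta>)"
proof -
  let ?l = "l_map S \<gamma> x v \<eta>"
  let ?a = "of_real ((cmod \<eta>)\<^sup>2 / 2) :: complex"
  have l: "expscale S \<gamma> ?a ?l = expscale S \<gamma> (v * cnj \<eta> - ?a) x"
    by (simp add: l_map_eq expscale_add field_simps)
  have \<zeta>s: "\<zeta> \<in> V_slice S \<gamma> \<Omega> \<eta>" using \<zeta> by (simp add: V_slice_def)
  show ?thesis
  proof (cases "?l \<in> V_slice S \<gamma> \<Omega> \<eta>")
    case True
    from bergman_vec_slice[OF True \<zeta>s] show ?thesis by (simp only: l)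
  next
    case False
    then have "expscale S \<gamma> (v * cnj \<eta> - ?a) x \<notin> \<Omega>" by (simp only: V_slice_eq vimage_eq l not_False_eq_True)
    moreover have "open (V_slice S \<gamma> \<Omega> \<eta>)"
      unfolding V_slice_eq by (intro open_vimage open_\<Omega> continuous_intros)
    ultimately show ?thesis
      using False by (simp add: bergman_vec_def bergman_gen_outside open_\<Omega> complex_structure_vec)
  qed
qed

lemma bergman_prod_eq_D_op:
  assumes z: "(z, w) \<in> V" and \<zeta>: "(\<zeta>, \<eta>) \<in> V"
  shows "bergman_prod V (z, w) (\<zeta>, \<eta>) =
    D_op S \<gamma> \<eta> (\<lambda>(x, v). bergman_vec (V_slice S \<gamma> \<Omega> \<eta>) (l_map S \<gamma> x v \<eta>) \<zeta>) (z, w)"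
proof -
  define a where "a = w * cnj \<eta> - of_real ((cmod \<eta>)\<^sup>2 / 2)"
  define X where "X = expscale S \<gamma> a z"
  define \<zeta>0 where "\<zeta>0 = expscale S \<gamma> (of_real ((cmod \<eta>)\<^sup>2 / 2)) \<zeta>"
  define q where "q = (\<lambda>y. bergman_vec \<Omega> y \<zeta>0)"
  define C where "C = exp (complex_of_real (G * (cmod \<eta>)\<^sup>2))"
  define F where "F = (\<lambda>(x, v). bergman_vec (V_slice S \<gamma> \<Omega> \<eta>) (l_map S \<gamma> x v \<eta>) \<zeta>)"
  have \<zeta>0: "\<zeta>0 \<in> \<Omega>" using \<zeta> by (simp only: mem_V \<zeta>0_def)
  have F: "F (x, w) = C * q (expscale S \<gamma> a x)" for x
    unfolding F_def prod.case C_def q_def a_def \<zeta>0_def by (rule bergman_vec_slice_l_map[OF \<zeta>])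
  have XV: "(X, w - \<eta>) \<in> V"
  proof -
    have "(cmod (1 * v + (- \<eta>)))\<^sup>2 / 2 + Re (cnj \<eta> * v + - of_real ((cmod \<eta>)\<^sup>2 / 2)) = (cmod v)\<^sup>2 / 2" for v
      by (simp add: cmod_power2) (simp add: power2_eq_square field_simps)
    from vaff_mem_V[OF this, of "(z, w)"] z show ?thesis
      by (simp add: vaff_def X_def a_def mult.commute)
  qed
  then have X: "X \<in> \<Omega>" by (rule mem_V_base)
  obtain L where L: "(q has_derivative L) (at X)" "\<And>v. L (\<i> *s v) = \<i> * L v"
    using A2_cholo[OF open_\<Omega> bergman_vec_A2[OF \<zeta>0]] X unfolding cholo_on_def q_def by blast
  have lin: "linear L" by (rule has_derivative_linear[OF L(1)])
  \<comment> \<open>The operators z_j d/dz_j commute with diagonal scalings: applied at z to the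
    composite they give the value at X of the same operator applied to q.\<close>
  have pd: "z $ j * pderiv_z F j (z, w) = C * (X $ j * L (axis j 1))" if j: "j \<in> S" for j
  proof -
    let ?e = "exp (of_real (\<gamma> j) * a)"
    let ?v = "?e *s axis j 1 :: complex^'N"
    have upd: "expscale S \<gamma> a (\<chi> k. if k = j then t else z $ k) = (X - z $ j *s ?v) + cscale JV t ?v" for t
      using j by (auto simp: cscale_vec vec_eq_iff X_def expscale_nth axis_def)
    have at: "(X - z $ j *s ?v) + cscale JV (z $ j) ?v = X"
      by (simp add: cscale_vec)
    have "((\<lambda>t. q ((X - z $ j *s ?v) + cscale JV t ?v)) has_field_derivative L ?v) (at (z $ j))"
      by (rule has_field_derivative_cscale_slice[OF complex_structure_vec, where L = L]) (simp_all only: at L)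
    then have "((\<lambda>t. C * q ((X - z $ j *s ?v) + cscale JV t ?v)) has_field_derivative C * L ?v) (at (z $ j))"
      by (rule DERIV_cmult)
    then have "pderiv_z F j (z, w) = C * L ?v"
      unfolding pderiv_z_def fst_conv snd_conv F upd by (rule DERIV_imp_deriv)
    also have "L ?v = ?e * L (axis j 1)" by (rule complex_linear_smult[OF lin L(2)])
    finally show ?thesis using j by (simp add: X_def expscale_nth)
  qed
  have "bergman_prod V (z, w) (\<zeta>, \<eta>) = exp (of_real G * (w * cnj \<eta>)) * bergman_prod V (X, 0) (\<zeta>0, 0)"
    unfolding bergman_prod_shift[OF z \<zeta>] using bergman_prod_indep[OF XV \<zeta>0]
    by (simp only: X_def a_def \<zeta>0_def)
  also have "bergman_prod V (X, 0) (\<zeta>0, 0) = (\<Sum>j\<in>S. of_real (\<gamma> j) * (q X + X $ j * L (axis j 1))) / of_real pi"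
    using bergman_prod_base[OF X \<zeta>0, of L] L unfolding q_def by (simp add: field_simps)
  \<comment> \<open>The shift factor splits into the prefactor of \<open>D_op\<close> and the
    constant C contributed by the slice kernel, which is then absorbed into F.\<close>
  also have "exp (of_real G * (w * cnj \<eta>)) = exp (of_real G * (w * cnj \<eta> - of_real ((cmod \<eta>)\<^sup>2))) * C"
    unfolding C_def exp_add[symmetric] by (simp only: of_real_mult) (simp add: algebra_simps)
  also have "exp (of_real G * (w * cnj \<eta> - of_real ((cmod \<eta>)\<^sup>2))) * C * ((\<Sum>j\<in>S. of_real (\<gamma> j) * (q X + X $ j * L (axis j 1))) / of_real pi)
      = exp (of_real G * (w * cnj \<eta> - of_real ((cmod \<eta>)\<^sup>2))) / of_real pi * (\<Sum>j\<in>S. of_real (\<gamma> j) * (C * q X + C * (X $ j * L (axis j 1))))"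
    by (simp add: sum_distrib_left ring_distribs mult_ac)
  also have "(\<Sum>j\<in>S. of_real (\<gamma> j) * (C * q X + C * (X $ j * L (axis j 1)))) = (\<Sum>j\<in>S. of_real (\<gamma> j) * (F (z, w) + z $ j * pderiv_z F j (z, w)))"
    by (rule sum.cong) (simp_all add: pd F X_def)
  finally show ?thesis unfolding D_op_def F_def[symmetric] fst_conv snd_conv .
qed

end

theorem theorem2:
  fixes S :: "'N::finite set" and \<Omega> :: "(complex^'N) set" and \<gamma> :: "'N \<Rightarrow> real"
  assumes "S \<noteq> {}"
    and "open \<Omega>" and "connected \<Omega>" and "\<Omega> \<noteq> {}"
    and "star_hartogs S \<Omega>"
    and "\<forall>j\<in>S. \<gamma> j > 0"
    and "(z, w) \<in> V_gamma S \<gamma> \<Omega>" and "(\<zeta>, \<eta>) \<in> V_gamma S \<gamma> \<Omega>"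
  shows "bergman_prod (V_gamma S \<gamma> \<Omega>) (z, w) (\<zeta>, \<eta>) =
    D_op S \<gamma> \<eta> (\<lambda>(x, v). bergman_vec (V_slice S \<gamma> \<Omega> \<eta>) (l_map S \<gamma> x v \<eta>) \<zeta>) (z, w)"
proof -
  interpret hartogs S \<gamma> \<Omega> by unfold_locales (use assms in auto)
  show ?thesis by (rule bergman_prod_eq_D_op) fact+
qed

end
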